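(* Let $\lambda>-\tfrac12$, $f\in C_c^\infty(0,\infty)$ and $m\in\mathbb N$ ($m\ge1$). Then, for almost every $x\in(0,\infty)$, \[ \begin{aligned} (\log^mB_\lambda)f(x)&=-m\sum_{j=0}^{m-1}(-1)^j\binom{m-1}{j}\partial_s^{m-j-1}\left(\frac{1}{\Gamma(1-s)}\right)\Bigg|_{s=0}\\ &\quad\times\Bigg[\int_0^\infty\big(f(y)-\mathcal X_{B(x,1)}(y)f(x)\big)\int_0^\infty W_t^\lambda(x,y)\frac{(\log t)^j}{t}\,dt\,dy\\ &\quad+f(x)\Bigg(-\int_{(0,\infty)\setminus B(x,1)}\int_0^1W_t^\lambda(x,y)\frac{(\log t)^j}{t}\,dt\,dy+\int_{B(x,1)}\int_1^\infty W_t^\lambda(x,y)\frac{(\log t)^j}{t}\,dt\,dy\\ &\quad+\int_0^\infty\int_0^1\big(W_t^\lambda(x,y)-W_t(x-y)\big)\frac{(\log t)^j}{t}\,dt\,dy\Bigg)\Bigg]+f(x)\,\partial_s^m\left(\frac{1}{\Gamma(1-s)}\right)\Bigg|_{s=0}. \end{aligned} \] Furthermore, for every $x\in(0,\infty)$ and every $j\in\{0,\dots,m-1\}$, the four integrals \[ \int_0^\infty\big(f(y)-\mathcal X_{B(x,1)}(y)f(x)\big)\int_0^\infty W_t^\lambda(x,y)\frac{(\log t)^j}{t}\,dt\,dy,\qquad \int_{(0,\infty)\setminus B(x,1)}\int_0^1W_t^\lambda(x,y)\frac{(\log t)^j}{t}\,dt\,dy, \] \[ \int_{B(x,1)}\int_1^\infty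 W_t^\lambda(x,y)\frac{(\log t)^j}{t}\,dt\,dy,\qquad \int_0^\infty\int_0^1\big(W_t^\lambda(x,y)-W_t(x-y)\big)\frac{(\log t)^j}{t}\,dt\,dy \] are absolutely convergent. Moreover, \[ (\log^mB_\lambda)f(x)=\partial_s^mB_\lambda^s(f)(x)\Big|_{s=0}=(-1)^m\partial_s^mB_\lambda^{-s}(f)(x)\Big|_{s=0},\quad\text{for a.e. }x\in(0,\infty). \]
   Context: $C_c^\infty(0,\infty)$ is the space of smooth functions on $(0,\infty)$ with compact support in $(0,\infty)$. For $\lambda>-1$, the Hankel transform is $h_\lambda(f)(x)=\int_0^\infty\sqrt{xy}\,J_\lambda(xy)f(y)\,dy$, $x\in(0,\infty)$, where $J_\lambda$ is the Bessel function of the first kind of order $\lambda$; $h_\lambda$ defines an isometric isomorphism of $L^2(0,\infty)$. The Bessel operator is $B_\lambda=-\frac{d^2}{dx^2}+\frac{\lambda^2-1/4}{x^2}$, realized as $B_\lambda f=h_\lambda(y^2h_\lambda(f))$. For $s\in\mathbb R\setminus\{0\}$, $B_\lambda^sf=h_\lambda(y^{2s}h_\lambda(f))$ with domain $D(B_\lambda^s)=\{f\in L^2(0,\infty): y^{2s}h_\lambda(f)\in L^2(0,\infty)\}$. For $m\in\mathbb N$, $(\log^mB_\lambda)f=h_\lambda((2\log y)^mh_\lambda(f))$ with domain $D(\log^mB_\lambda)=\{f\in L^2(0,\infty):(2\log y)^mh_\lambda(f)\in L^2(0,\infty)\}$. For $x,y,t\in(0,\infty)$, $W_t^\lambda(x,y)=\frac{\sqrt{xy}}{2t}I_\lambda\left(\frac{xy}{2t}\right)e^{-\frac{x^2+y^2}{4t}}$,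 where $I_\lambda$ is the modified Bessel function of the first kind of order $\lambda$; and $W_t(z)=\frac{1}{2\sqrt{\pi t}}e^{-z^2/(4t)}$, $z\in\mathbb R$, is the Euclidean heat kernel on $\mathbb R$. For $x,r\in(0,\infty)$, $B(x,r)=(0,\infty)\cap(x-r,x+r)$. $\mathcal X_E$ denotes the characteristic function of a set $E$, and $\Gamma$ is the Gamma function.
   Formalization: The printed formula is false (m=1, any f≠0): W_t(x-y) has mass 1 on ℝ, not on (0,∞). The formal formula subtracts the missing integral of W_t(x-y)(log t)^j/t over y<0, 0<t<1 inside the factor of f(x), and also proves that this integral converges absolutely. *)

theory Defs
  imports "HOL-Analysis.Analysis"
begin

definition bessel_J :: "real \<Rightarrow> real \<Rightarrow> real" where
  "bessel_J \<nu> z = (\<Sum>k. (-1) ^ k / (fact k * Gamma (\<nu> + real k + 1)) * (z / 2) powr (\<nu> + 2 * real k))"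

definition bessel_I :: "real \<Rightarrow> real \<Rightarrow> real" where
  "bessel_I \<nu> z = (\<Sum>k. 1 / (fact k * Gamma (\<nu> + real k + 1)) * (z / 2) powr (\<nu> + 2 * real k))"

text \<open>Functions on the half-line are total functions on the reals whose values outside
  \<open>{0<..}\<close> are never used. They are complex-valued, which includes the real-valued case.\<close>

definition Cc_smooth :: "(real \<Rightarrow> complex) set" where
  "Cc_smooth = {f.
     (\<exists>D :: nat \<Rightarrow> real \<Rightarrow> complex. D 0 = f \<and>
        (\<forall>n. \<forall>x>0. (D n has_vector_derivative D (Suc n) x) (at x))) \<and>
     (\<exists>K. compact K \<and> K \<subseteq> {0<..} \<and> (\<forall>x>0. x \<notin> K \<longrightarrow> f x = 0))}"

definition L2_pos :: "(real \<Rightarrow> complex) set" where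
  "L2_pos = {f. set_borel_measurable lborel {0<..} f \<and>
                set_integrable lborel {0<..} (\<lambda>y. (cmod (f y))\<^sup>2)}"

definition L2_tendsto :: "(nat \<Rightarrow> real \<Rightarrow> complex) \<Rightarrow> (real \<Rightarrow> complex) \<Rightarrow> bool" where
  "L2_tendsto u f \<longleftrightarrow>
     (\<lambda>n. \<integral>\<^sup>+y\<in>{0<..}. ennreal ((cmod (u n y - f y))\<^sup>2) \<partial>lborel) \<longlonglongrightarrow> 0"

definition hankel_kernel :: "real \<Rightarrow> real \<Rightarrow> real \<Rightarrow> real" where
  "hankel_kernel \<nu> x y = sqrt (x * y) * bessel_J \<nu> (x * y)"

definition hankel_integral :: "real \<Rightarrow> (real \<Rightarrow> complex) \<Rightarrow> real \<Rightarrow> complex" where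
  "hankel_integral \<nu> f x = (LINT y:{0<..}|lborel. of_real (hankel_kernel \<nu> x y) * f y)"

definition is_hankel_L2 :: "real \<Rightarrow> (real \<Rightarrow> complex) \<Rightarrow> (real \<Rightarrow> complex) \<Rightarrow> bool" where
  "is_hankel_L2 \<nu> f g \<longleftrightarrow> f \<in> L2_pos \<and> g \<in> L2_pos \<and>
     (\<exists>\<phi>. (\<forall>n. \<phi> n \<in> Cc_smooth) \<and> L2_tendsto \<phi> f \<and>
          L2_tendsto (\<lambda>n. hankel_integral \<nu> (\<phi> n)) g)"

text \<open>The Hankel transform on \<open>L\<^sup>2(0,\<infinity>)\<close> is the continuous extension of the integral operator from
  \<open>Cc_smooth\<close>, so it is determined only up to a null set. The representative is fixed by the
  integral formula at every point where the integral converges absolutely; at almost every such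
  point this is the value of the extension. Fixing it this way matters for pointwise derivatives
  in a parameter, as in \<open>\<partial>\<^sub>s B\<^sup>s f(x)\<close>.\<close>

definition hankel :: "real \<Rightarrow> (real \<Rightarrow> complex) \<Rightarrow> real \<Rightarrow> complex" where
  "hankel \<nu> f x =
     (if set_integrable lborel {0<..} (\<lambda>y. of_real (hankel_kernel \<nu> x y) * f y)
      then hankel_integral \<nu> f x
      else (SOME g. is_hankel_L2 \<nu> f g) x)"

text \<open>For \<open>s = 0\<close> the power is the identity operator.\<close>

definition bessel_pow :: "real \<Rightarrow> real \<Rightarrow> (real \<Rightarrow> complex) \<Rightarrow> real \<Rightarrow> complex" where
  "bessel_pow \<nu> s f =
     (if s = 0 then f else hankel \<nu> (\<lambda>y. of_real (y powr (2 * s)) * hankel \<nu> f y))"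

definition bessel_pow_dom :: "real \<Rightarrow> real \<Rightarrow> (real \<Rightarrow> complex) set" where
  "bessel_pow_dom \<nu> s =
     {f \<in> L2_pos. (\<lambda>y. of_real (y powr (2 * s)) * hankel \<nu> f y) \<in> L2_pos}"

definition bessel_log :: "real \<Rightarrow> nat \<Rightarrow> (real \<Rightarrow> complex) \<Rightarrow> real \<Rightarrow> complex" where
  "bessel_log \<nu> m f = hankel \<nu> (\<lambda>y. of_real ((2 * ln y) ^ m) * hankel \<nu> f y)"

definition bessel_log_dom :: "real \<Rightarrow> nat \<Rightarrow> (real \<Rightarrow> complex) set" where
  "bessel_log_dom \<nu> m =
     {f \<in> L2_pos. (\<lambda>y. of_real ((2 * ln y) ^ m) * hankel \<nu> f y) \<in> L2_pos}"

definition bessel_heat :: "real \<Rightarrow> real \<Rightarrow> real \<Rightarrow> real \<Rightarrow> real" where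
  "bessel_heat \<nu> t x y =
     sqrt (x * y) / (2 * t) * bessel_I \<nu> (x * y / (2 * t)) * exp (- ((x\<^sup>2 + y\<^sup>2) / (4 * t)))"

definition euclid_heat :: "real \<Rightarrow> real \<Rightarrow> real" where
  "euclid_heat t z = 1 / (2 * sqrt (pi * t)) * exp (- (z\<^sup>2 / (4 * t)))"

text \<open>The Euclidean heat kernel has total mass 1 on the whole line, not on \<open>{0<..}\<close>. Replacing
  \<open>f x\<close> by \<open>f x\<close> times that mass therefore leaves, next to the integral of
  \<open>W\<^sub>t\<^sup>\<nu>(x,y) - W\<^sub>t(x-y)\<close> over \<open>y > 0\<close>, the following contribution of \<open>y < 0\<close>. The formula for
  the logarithm is wrong without it: for \<open>\<nu> = 1/2\<close>, \<open>m = 1\<close> it would be off by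
  \<open>f x * euclid_tail 0 x\<close>, and \<open>euclid_tail 0 x > 0\<close>.\<close>

definition euclid_tail :: "nat \<Rightarrow> real \<Rightarrow> real" where
  "euclid_tail j x =
     (LINT y:{..<0}|lborel. LINT t:{0<..<1}|lborel. euclid_heat t (x - y) * (ln t ^ j / t))"

definition pos_ball :: "real \<Rightarrow> real \<Rightarrow> real set" where
  "pos_ball x r = {0<..} \<inter> {x - r<..<x + r}"

text \<open>\<open>has_nth_vderiv n g s d\<close>: the \<open>n\<close>-th derivative of \<open>g\<close> at \<open>s\<close> exists and equals \<open>d\<close>.\<close>

primrec has_nth_vderiv :: "nat \<Rightarrow> (real \<Rightarrow> complex) \<Rightarrow> real \<Rightarrow> complex \<Rightarrow> bool" where
  "has_nth_vderiv 0 g s d \<longleftrightarrow> g s = d"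
| "has_nth_vderiv (Suc n) g s d \<longleftrightarrow>
     (\<exists>h. (\<forall>\<^sub>F u in nhds s. has_nth_vderiv n g u (h u)) \<and> (h has_vector_derivative d) (at s))"

end

theory Submission
  imports Defs "HOL-Complex_Analysis.Complex_Analysis" "HOL-Probability.Distributions"
begin

text \<open>
Fix \<open>x > 0\<close>, put \<open>K(z) = sqrt z J\<^sub>\<nu>(z)\<close>, let \<open>F\<close> be the Hankel transform of \<open>f\<close>, and let
\<open>\<phi>(y) = K(x y) F(y)\<close>. All operators of the theorem are integrals against this one density: the power
\<open>s\<close> of the Bessel operator gives \<open>G(s) = \<integral> y powr (2 s) \<phi>(y) dy\<close> at \<open>x\<close>, and the logarithm of order
\<open>m\<close> gives \<open>\<integral> (2 ln y) ^ m \<phi>(y) dy\<close>. The kernel \<open>K\<close> is bounded (\<open>bessel_wave_bounded\<close>), hence \<open>F\<close> is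
bounded, and one integration by parts shows \<open>F(y) = O(y\<^sup>-\<^sup>2)\<close> (\<open>hankel_decay\<close>). So \<open>G\<close> may be
differentiated under the integral sign for \<open>\<bar>s\<bar> < 1/2\<close>, and the logarithm is the \<open>m\<close>-th derivative
of \<open>G\<close> at 0. As the power 0 is the identity, the last part of the theorem also requires
\<open>G(0) = f(x)\<close>, which is Hankel's inversion formula.

The heat kernel enters through Weber's integral
\<open>\<integral> exp (- t z\<^sup>2) K(x z) K(y z) dz = W\<^sub>t(x, y)\<close>, proved by multiplying power series and Vandermonde's
identity (\<open>Weber_second_exponential_integral\<close>). It says that the heat flow
\<open>u(t) = \<integral> W\<^sub>t(x, y) f(y) dy\<close> is \<open>\<integral> exp (- t z\<^sup>2) \<phi>(z) dz\<close>. On the other hand, \<open>W\<^sub>t(x, y)\<close> is the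
Euclidean heat kernel at \<open>x - y\<close> times the ratio of \<open>I\<^sub>\<nu>\<close> to its leading asymptotic term, at
\<open>x y / (2 t)\<close>. This ratio is bounded and tends to 1 with a rate, by Laplace's method in Poisson's
integral (\<open>bessel_ratio_bounds\<close>). Hence \<open>u(t) - f(x) = O(sqrt t)\<close> for small \<open>t\<close> and
\<open>u(t) = O(1 / sqrt t)\<close> for large \<open>t\<close>. The first estimate yields the inversion formula.

Let \<open>d(t)\<close> be \<open>u(t) - f(x)\<close> for \<open>t < 1\<close> and \<open>u(t)\<close> otherwise, and let
\<open>H(s) = \<integral> d(t) t powr (- s - 1) dt\<close>, a smooth function for \<open>\<bar>s\<bar> < 1/2\<close>. For \<open>- 1/2 < s < 0\<close> the Mellin
transform of \<open>u\<close> is \<open>\<Gamma>(- s) G(s)\<close>, and therefore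
\<open>G(s) = f(x) / \<Gamma>(1 - s) - s H(s) / \<Gamma>(1 - s)\<close> (\<open>functional_equation\<close>). By smoothness all derivatives
of the two sides agree at 0 as well. There the factor \<open>s\<close> turns the \<open>m\<close>-th derivative of the last
term into \<open>m\<close> times the derivative of order \<open>m - 1\<close> of \<open>H(s) / \<Gamma>(1 - s)\<close>, and Leibniz' rule gives the
sum over \<open>j\<close> in the theorem. Its terms contain \<open>\<integral> d(t) (ln t) ^ j / t dt\<close>. Splitting \<open>d\<close> into the part
of \<open>f\<close> that vanishes at \<open>x\<close>, and \<open>f(x)\<close> times differences of masses of the two heat kernels, turns
this into the integrals of the statement; the estimates behind \<open>d(t) = O(sqrt t)\<close> hold for each
part separately and allow the order of integration to be exchanged (\<open>weighted_defect\<close>).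
\<close>

section \<open>Bessel functions through an entire series\<close>

text \<open>The Bessel-Clifford function. Up to the factor \<open>(z / 2) powr \<nu>\<close>, the functions \<open>J\<close> and \<open>I\<close> are its
values at \<open>- z\<^sup>2 / 4\<close> and \<open>z\<^sup>2 / 4\<close>. Unlike them it is entire, so it can be differentiated term
by term, and signs are carried by the argument.\<close>
definition bessel_clifford :: "real \<Rightarrow> real \<Rightarrow> real" where
  "bessel_clifford \<nu> w = (\<Sum>k. w ^ k / (fact k * Gamma (\<nu> + real k + 1)))"

lemma Gamma_shift:
  assumes "\<nu> > (-1::real)"
  shows "Gamma (\<nu> + real k + 2) = (\<nu> + real k + 1) * Gamma (\<nu> + real k + 1)"
proof -
  have "\<nu> + real k + 1 \<notin> \<int>\<^sub>\<le>\<^sub>0" using assms nonpos_Ints_nonpos[of "\<nu> + real k + 1"] by force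
  from Gamma_plus1[OF this] show ?thesis by (simp add: add_ac)
qed

lemma summable_bessel_clifford:
  assumes "\<nu> > -1"
  shows "summable (\<lambda>k. w ^ k / (fact k * Gamma (\<nu> + real k + 1)))"
proof -
  define N where "N = nat \<lceil>2 * \<bar>w\<bar>\<rceil> + 1"
  show ?thesis
  proof (rule summable_ratio_test[of "1/2" N])
    fix n assume n: "n \<ge> N"
    have "2 * \<bar>w\<bar> \<le> real n" using n unfolding N_def by linarith
    moreover have "n \<ge> 1" using n by (simp add: N_def)
    ultimately have "2 * \<bar>w\<bar> * 1 \<le> (real n + 1) * (\<nu> + real n + 1)"
      using assms by (intro mult_mono) auto
    hence le: "\<bar>w\<bar> / ((real n + 1) * (\<nu> + real n + 1)) \<le> 1/2"
      using assms \<open>n \<ge> 1\<close> by (simp add: divide_simps)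
    define d g where "d = \<nu> + real n + 1" and "g = Gamma d"
    have dg: "d > 0" "g > 0" using assms by (auto simp: d_def g_def)
    have G: "Gamma (\<nu> + real (Suc n) + 1) = d * g"
      using Gamma_shift[OF assms, of n] by (simp add: d_def g_def add_ac)
    have "norm (w ^ Suc n / (fact (Suc n) * Gamma (\<nu> + real (Suc n) + 1)))
        = \<bar>w\<bar> / ((real n + 1) * d) * (\<bar>w\<bar> ^ n / (fact n * g))"
      unfolding G using dg by (simp add: abs_mult power_abs field_simps)
    also have "\<dots> = \<bar>w\<bar> / ((real n + 1) * (\<nu> + real n + 1)) * norm (w ^ n / (fact n * Gamma (\<nu> + real n + 1)))"
      using dg unfolding g_def d_def by (simp add: abs_mult power_abs)
    also have "\<dots> \<le> 1/2 * norm (w ^ n / (fact n * Gamma (\<nu> + real n + 1)))"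
      using le by (intro mult_right_mono) auto
    finally show "norm (w ^ Suc n / (fact (Suc n) * Gamma (\<nu> + real (Suc n) + 1)))
       \<le> 1/2 * norm (w ^ n / (fact n * Gamma (\<nu> + real n + 1)))" .
  qed simp
qed

lemma has_real_derivative_bessel_clifford:
  assumes "\<nu> > -1"
  shows "(bessel_clifford \<nu> has_real_derivative bessel_clifford (\<nu> + 1) w) (at w)"
proof -
  define c where "c = (\<lambda>k. 1 / (fact k * Gamma (\<nu> + real k + 1)))"
  have "((\<lambda>w. \<Sum>k. c k * w ^ k) has_real_derivative (\<Sum>k. diffs c k * w ^ k)) (at w)"
    using summable_bessel_clifford[OF assms]
    by (intro termdiffs_strong_converges_everywhere) (simp add: c_def)
  moreover have "diffs c k * w ^ k = w ^ k / (fact k * Gamma (\<nu> + 1 + real k + 1))" for k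
    by (simp add: diffs_def c_def divide_simps add_ac)
  ultimately show ?thesis
    by (simp add: bessel_clifford_def[abs_def] c_def)
qed

lemmas has_real_derivative_bessel_clifford' [derivative_intros] =
  DERIV_chain2[OF has_real_derivative_bessel_clifford]

text \<open>Comparison of coefficients reduces this to \<open>\<Gamma>(\<nu> + k + 2) = (\<nu> + k + 1) \<Gamma>(\<nu> + k + 1)\<close>. As
\<open>bessel_clifford (\<nu> + 1)\<close> and \<open>bessel_clifford (\<nu> + 2)\<close> are the first two derivatives of
\<open>bessel_clifford \<nu>\<close>, this is Bessel's differential equation.\<close>
lemma bessel_clifford_recurrence:
  assumes "\<nu> > -1"
  shows "w * bessel_clifford (\<nu> + 2) w + (\<nu> + 1) * bessel_clifford (\<nu> + 1) w = bessel_clifford \<nu> w"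
proof -
  let ?a = "\<lambda>\<nu> k. w ^ k / (fact k * Gamma (\<nu> + real k + 1))"
  have G: "Gamma (\<nu> + 1 + real k + 1) = (\<nu> + real k + 1) * Gamma (\<nu> + real k + 1)" for k
    using Gamma_shift[OF assms, of k] by (simp add: add_ac)
  have s: "summable (?a (\<nu> + 1))" "summable (?a (\<nu> + 2))" "summable (?a \<nu>)"
    by (rule summable_bessel_clifford, use assms in simp)+
  define b where "b k = (case k of 0 \<Rightarrow> 0 | Suc n \<Rightarrow> w * ?a (\<nu> + 2) n)" for k
  have bs: "b sums (w * bessel_clifford (\<nu> + 2) w)"
  proof -
    have "(\<lambda>n. b (Suc n)) sums (w * bessel_clifford (\<nu> + 2) w)"
      unfolding b_def bessel_clifford_def using s(2) by (simp del: times_divide_eq_right) (intro sums_mult summable_sums)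
    thus ?thesis by (subst (asm) sums_Suc_iff) (simp add: b_def)
  qed
  have "(\<lambda>k. b k + (\<nu> + 1) * ?a (\<nu> + 1) k) sums
     (w * bessel_clifford (\<nu> + 2) w + (\<nu> + 1) * bessel_clifford (\<nu> + 1) w)"
    using s unfolding bessel_clifford_def[of "\<nu>+1"] by (intro sums_add bs sums_mult summable_sums)
  moreover have "b k + (\<nu> + 1) * ?a (\<nu> + 1) k = ?a \<nu> k" for k
  proof -
    have "Gamma (\<nu> + real k + 1) > 0" "\<nu> + real k + 1 > 0" using assms by auto
    thus ?thesis
    proof (cases k)
      case 0 with \<open>\<nu> + real k + 1 > 0\<close> show ?thesis using G[of k] by (simp add: b_def)
    next
      case (Suc n)
      have "b k = real k * w ^ k / (fact k * Gamma (\<nu> + 1 + real k + 1))"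
        using Suc by (simp add: b_def add_ac divide_simps)
      hence "b k + (\<nu> + 1) * ?a (\<nu> + 1) k = (real k * w ^ k + (\<nu> + 1) * w ^ k) / (fact k * Gamma (\<nu> + 1 + real k + 1))"
        by (simp add: add_divide_distrib)
      also have "real k * w ^ k + (\<nu> + 1) * w ^ k = (\<nu> + real k + 1) * w ^ k" by (simp add: algebra_simps)
      also have "\<dots> / (fact k * Gamma (\<nu> + 1 + real k + 1)) = ?a \<nu> k"
        unfolding G using \<open>\<nu> + real k + 1 > 0\<close> by simp
      finally show ?thesis .
    qed
  qed
  ultimately show ?thesis unfolding bessel_clifford_def[of \<nu>] by (simp add: sums_iff)
qed

lemma bessel_clifford_nonneg: "\<nu> > -1 \<Longrightarrow> w \<ge> 0 \<Longrightarrow> bessel_clifford \<nu> w \<ge> 0"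
  unfolding bessel_clifford_def by (intro suminf_nonneg summable_bessel_clifford) auto

lemma abs_bessel_clifford_le:
  assumes "\<nu> > -1" "\<bar>w\<bar> \<le> v"
  shows "\<bar>bessel_clifford \<nu> w\<bar> \<le> bessel_clifford \<nu> v"
proof -
  have "norm (bessel_clifford \<nu> w) \<le> bessel_clifford \<nu> v"
    unfolding bessel_clifford_def
  proof (rule norm_suminf_le)
    show "norm (w ^ n / (fact n * Gamma (\<nu> + real n + 1))) \<le> v ^ n / (fact n * Gamma (\<nu> + real n + 1))" for n
      using assms by (auto simp: power_abs abs_mult intro!: divide_right_mono power_mono)
  qed (use assms summable_bessel_clifford in auto)
  thus ?thesis by simp
qed

lemma bessel_J_eq:
  assumes "\<nu> > -1" "z > 0"
  shows "bessel_J \<nu> z = (z / 2) powr \<nu> * bessel_clifford \<nu> (- (z\<^sup>2 / 4))"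
proof -
  have "(-1) ^ k / (fact k * Gamma (\<nu> + real k + 1)) * (z / 2) powr (\<nu> + 2 * real k)
     = (z / 2) powr \<nu> * ((- (z\<^sup>2 / 4)) ^ k / (fact k * Gamma (\<nu> + real k + 1)))" for k
  proof -
    have "(z / 2) powr (\<nu> + 2 * real k) = (z/2) powr \<nu> * (z/2)^(2 * k)"
      using assms powr_realpow[of "z/2" "2*k"] by (simp add: powr_add)
    moreover have "(- (z\<^sup>2 / 4)) ^ k = (-1)^k * (z/2)^(2*k)"
      by (simp add: power_mult power_minus[of "z\<^sup>2/4"] power_divide)
    ultimately show ?thesis by simp
  qed
  thus ?thesis unfolding bessel_J_def bessel_clifford_def
    by (simp only: suminf_mult[OF summable_bessel_clifford[OF assms(1)]])
qed

lemma bessel_I_eq: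
  assumes "\<nu> > -1" "z > 0"
  shows "bessel_I \<nu> z = (z / 2) powr \<nu> * bessel_clifford \<nu> (z\<^sup>2 / 4)"
proof -
  have "1 / (fact k * Gamma (\<nu> + real k + 1)) * (z / 2) powr (\<nu> + 2 * real k)
     = (z / 2) powr \<nu> * ((z\<^sup>2 / 4) ^ k / (fact k * Gamma (\<nu> + real k + 1)))" for k
  proof -
    have "(z / 2) powr (\<nu> + 2 * real k) = (z/2) powr \<nu> * (z/2)^(2 * k)"
      using assms powr_realpow[of "z/2" "2*k"] by (simp add: powr_add)
    moreover have "(z\<^sup>2 / 4) ^ k = (z/2)^(2*k)"
      by (simp add: power_mult power_divide)
    ultimately show ?thesis by simp
  qed
  thus ?thesis unfolding bessel_I_def bessel_clifford_def
    by (simp only: suminf_mult[OF summable_bessel_clifford[OF assms(1)]])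
qed

lemma bessel_measurable [measurable]:
  "bessel_J \<nu> \<in> borel_measurable borel" "bessel_I \<nu> \<in> borel_measurable borel"
  unfolding bessel_J_def[abs_def] bessel_I_def[abs_def] by measurable

section \<open>The Hankel kernel\<close>

text \<open>The Hankel kernel as a function of the product \<open>x y\<close>. The square root removes the first-order
term from Bessel's equation; what remains is \<open>bessel_wave_ode\<close>.\<close>
definition bessel_wave :: "real \<Rightarrow> real \<Rightarrow> real" where
  "bessel_wave \<nu> z = sqrt z * bessel_J \<nu> z"

lemma hankel_kernel_eq: "hankel_kernel \<nu> x y = bessel_wave \<nu> (x * y)"
  by (simp add: hankel_kernel_def bessel_wave_def)

lemma bessel_wave_measurable [measurable]: "bessel_wave \<nu> \<in> borel_measurable borel"
  unfolding bessel_wave_def[abs_def] by measurable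

lemma bessel_wave_eq:
  assumes "\<nu> > -1" "z > 0"
  shows "bessel_wave \<nu> z = 2 powr (- \<nu>) * z powr (\<nu> + 1/2) * bessel_clifford \<nu> (- (z\<^sup>2 / 4))"
proof -
  have "sqrt z * (z / 2) powr \<nu> = 2 powr (- \<nu>) * z powr (\<nu> + 1/2)"
    unfolding powr_add powr_minus using assms by (simp add: powr_divide powr_half_sqrt field_simps)
  thus ?thesis using assms by (simp add: bessel_wave_def bessel_J_eq mult.assoc[symmetric])
qed

definition bessel_wave' :: "real \<Rightarrow> real \<Rightarrow> real" where
  "bessel_wave' \<nu> z = 2 powr (- \<nu>) * ((\<nu> + 1/2) * z powr (\<nu> - 1/2) * bessel_clifford \<nu> (- (z\<^sup>2 / 4))
      - z powr (\<nu> + 3/2) / 2 * bessel_clifford (\<nu> + 1) (- (z\<^sup>2 / 4)))"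

lemma has_real_derivative_bessel_wave:
  assumes "\<nu> > -1" "z > 0"
  shows "(bessel_wave \<nu> has_real_derivative bessel_wave' \<nu> z) (at z)"
proof -
  define q where "q = z powr (\<nu> - 1/2)"
  have q: "z powr (\<nu> + 1/2) = z * q" "z powr (\<nu> + 1/2 - 1) = q" "z powr (\<nu> + 3/2) = z\<^sup>2 * q" 
    using assms powr_add[of z "\<nu> - 1/2" 1] powr_add[of z "\<nu> - 1/2" 2]
    by (auto simp: q_def powr_numeral add.commute)
  have "((\<lambda>z. 2 powr (- \<nu>) * z powr (\<nu> + 1/2) * bessel_clifford \<nu> (- (z\<^sup>2 / 4))) 
     has_real_derivative bessel_wave' \<nu> z) (at z)"
    apply (rule DERIV_cong)
     apply (rule derivative_eq_intros refl | use assms in force)+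
    unfolding bessel_wave'_def q q_def[symmetric]
    using assms by (simp add: algebra_simps power2_eq_square)
  moreover have "eventually (\<lambda>z. bessel_wave \<nu> z = 2 powr (- \<nu>) * z powr (\<nu> + 1/2) * bessel_clifford \<nu> (- (z\<^sup>2 / 4))) (nhds z)"
    using eventually_nhds_in_open[of "{0<..}" z] assms
    by (auto elim!: eventually_mono simp: bessel_wave_eq)
  ultimately show ?thesis by (subst DERIV_cong_ev[OF refl _ refl])
qed

lemma bessel_wave_ode:
  assumes "\<nu> > -1" "z > 0"
  shows "(bessel_wave' \<nu> has_real_derivative ((\<nu>\<^sup>2 - 1/4) / z\<^sup>2 - 1) * bessel_wave \<nu> z) (at z)"
proof -
  have [simp]: "\<nu> + 1 + 1 = \<nu> + 2" by simp
  define E0 E1 E2 where "E0 = bessel_clifford \<nu> (- (z\<^sup>2 / 4))" and "E1 = bessel_clifford (\<nu> + 1) (- (z\<^sup>2 / 4))"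
    and "E2 = bessel_clifford (\<nu> + 2) (- (z\<^sup>2 / 4))"
  have rec: "E0 = - (z\<^sup>2 / 4) * E2 + (\<nu> + 1) * E1"
    using bessel_clifford_recurrence[OF assms(1), of "- (z\<^sup>2 / 4)"] by (simp add: E0_def E1_def E2_def)
  define q where "q = z powr (\<nu> - 3/2)"
  have q: "z powr (\<nu> - 1/2) = z * q" "z powr (\<nu> - 1/2 - 1) = q" "z powr (\<nu> + 3/2) = z^3 * q" 
    "z powr (\<nu> + 3/2 - 1) = z^2 * q" "z powr (\<nu> + 1/2) = z^2 * q"
    using assms powr_add[of z "\<nu> - 3/2" 1] powr_add[of z "\<nu> - 3/2" 2] powr_add[of z "\<nu> - 3/2" 3]
    by (auto simp: q_def powr_numeral add.commute)
  define P where "P = 2 powr (- \<nu>)"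
  have "(bessel_wave' \<nu> has_real_derivative
      P * ((\<nu> + 1/2) * ((\<nu> - 1/2) * q * E0 + z * q * (E1 * (- (z / 2))))
      - ((\<nu> + 3/2) * (z\<^sup>2 * q) / 2 * E1 + z ^ 3 * q / 2 * (E2 * (- (z / 2)))))) (at z)"
    unfolding bessel_wave'_def[abs_def]
    apply (rule DERIV_cong)
     apply (rule derivative_eq_intros refl | use assms in force)+
    unfolding q q_def[symmetric] E0_def[symmetric] E1_def[symmetric] E2_def[symmetric] P_def[symmetric]
      \<open>\<nu> + 1 + 1 = \<nu> + 2\<close>
    by (simp add: field_simps power2_eq_square power3_eq_cube)
  also have "P * ((\<nu> + 1/2) * ((\<nu> - 1/2) * q * E0 + z * q * (E1 * (- (z / 2))))
      - ((\<nu> + 3/2) * (z\<^sup>2 * q) / 2 * E1 + z ^ 3 * q / 2 * (E2 * (- (z / 2)))))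
      = P * (\<nu>\<^sup>2 - 1/4) * q * E0 - P * z\<^sup>2 * q * (- (z\<^sup>2 / 4) * E2 + (\<nu> + 1) * E1)"
    by (simp add: field_simps power2_eq_square power3_eq_cube; linarith?)
  also have "\<dots> = P * (\<nu>\<^sup>2 - 1/4) * q * E0 - P * z\<^sup>2 * q * E0" using rec by simp
  also have "\<dots> = ((\<nu>\<^sup>2 - 1/4) / z\<^sup>2 - 1) * bessel_wave \<nu> z"
    unfolding bessel_wave_eq[OF assms] q E0_def[symmetric] P_def[symmetric] using assms
    by (simp add: field_simps)
  finally show ?thesis .
qed

text \<open>An energy argument. Put \<open>\<kappa> = \<nu>\<^sup>2 - 1/4\<close>. For \<open>K'' = (\<kappa> / z\<^sup>2 - 1) K\<close>, the derivative of
\<open>K\<^sup>2 + K'\<^sup>2\<close> is \<open>2 \<kappa> K K' / z\<^sup>2\<close>, which is at most \<open>\<bar>\<kappa>\<bar> / z\<^sup>2\<close> times \<open>K\<^sup>2 + K'\<^sup>2\<close>. After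
multiplication by \<open>exp (\<bar>\<kappa>\<bar> / z)\<close>, a factor between 1 and \<open>exp \<bar>\<kappa>\<bar>\<close> for \<open>z \<ge> 1\<close>, the energy is
decreasing on \<open>[1, \<infinity>)\<close>. On \<open>(0, 1]\<close> the power series gives a bound by a multiple of
\<open>z powr (\<nu> + 1/2)\<close>, and here \<open>\<nu> > - 1/2\<close> enters.\<close>
lemma bessel_wave_bounded:
  assumes "\<nu> > - (1/2)"
  obtains C where "C > 0" "\<And>z. z > 0 \<Longrightarrow> \<bar>bessel_wave \<nu> z\<bar> \<le> C"
proof -
  let ?K = "bessel_wave \<nu>" and ?K' = "bessel_wave' \<nu>"
  have \<nu>: "\<nu> > -1" using assms by simp
  define C0 where "C0 = 2 powr (- \<nu>) * bessel_clifford \<nu> (1/4)"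
  define \<kappa> where "\<kappa> = \<nu>\<^sup>2 - 1/4"
  define Q where "Q z = ((?K z)\<^sup>2 + (?K' z)\<^sup>2) * exp (\<bar>\<kappa>\<bar> / z)" for z
  have C0: "C0 \<ge> 0" unfolding C0_def using \<nu> by (intro mult_nonneg_nonneg bessel_clifford_nonneg) auto
  have small: "\<bar>?K z\<bar> \<le> C0 * z powr (\<nu> + 1/2)" if "0 < z" "z \<le> 1" for z
  proof -
    have "\<bar>- (z\<^sup>2 / 4)\<bar> \<le> 1/4" using that by (simp add: power_le_one)
    from abs_bessel_clifford_le[OF \<nu> this] that \<nu> show ?thesis
      by (auto simp: bessel_wave_eq C0_def abs_mult mult_ac intro!: mult_left_mono)
  qed
  have Q: "Q z \<le> Q 1" if "z \<ge> 1" for z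
  proof (rule DERIV_nonpos_imp_nonincreasing[OF that])
    fix x :: real assume x: "1 \<le> x" "x \<le> z"
    define a b where "a = ?K x" and "b = ?K' x"
    have "((\<lambda>z. (?K z)\<^sup>2 + (?K' z)\<^sup>2) has_real_derivative 2 * a * b + 2 * b * ((\<kappa> / x\<^sup>2 - 1) * a)) (at x)"
      using DERIV_add[OF DERIV_power[OF has_real_derivative_bessel_wave[OF \<nu>], of x 2] 
          DERIV_power[OF bessel_wave_ode[OF \<nu>], of x 2]] x
      by (simp add: a_def b_def \<kappa>_def mult_ac)
    moreover have "((\<lambda>z. exp (\<bar>\<kappa>\<bar> / z)) has_real_derivative exp (\<bar>\<kappa>\<bar> / x) * (- \<bar>\<kappa>\<bar> / x\<^sup>2)) (at x)"
      using x by (auto intro!: derivative_eq_intros simp: power2_eq_square)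
    ultimately have "(Q has_real_derivative (2 * a * b + 2 * b * ((\<kappa> / x\<^sup>2 - 1) * a)) * exp (\<bar>\<kappa>\<bar> / x)
        + exp (\<bar>\<kappa>\<bar> / x) * (- \<bar>\<kappa>\<bar> / x\<^sup>2) * (a\<^sup>2 + b\<^sup>2)) (at x)"
      unfolding Q_def[abs_def] a_def b_def by (rule DERIV_mult)
    also have "exp (\<bar>\<kappa>\<bar> / x) * (- \<bar>\<kappa>\<bar> / x\<^sup>2) * (a\<^sup>2 + b\<^sup>2) = (a\<^sup>2 + b\<^sup>2) * (exp (\<bar>\<kappa>\<bar> / x) * (- \<bar>\<kappa>\<bar> / x\<^sup>2))"
      by simp
    also have "(2 * a * b + 2 * b * ((\<kappa> / x\<^sup>2 - 1) * a)) * exp (\<bar>\<kappa>\<bar> / x)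
        + (a\<^sup>2 + b\<^sup>2) * (exp (\<bar>\<kappa>\<bar> / x) * (- \<bar>\<kappa>\<bar> / x\<^sup>2)) = 
        exp (\<bar>\<kappa>\<bar> / x) / x\<^sup>2 * (2 * \<kappa> * (a * b) - \<bar>\<kappa>\<bar> * (a\<^sup>2 + b\<^sup>2))"
      using x by (simp add: field_simps)
    finally have D: "(Q has_real_derivative exp (\<bar>\<kappa>\<bar> / x) / x\<^sup>2 * (2 * \<kappa> * (a * b) - \<bar>\<kappa>\<bar> * (a\<^sup>2 + b\<^sup>2))) (at x)" .
    have "\<bar>2 * (a * b)\<bar> \<le> a\<^sup>2 + b\<^sup>2"
      using sum_squares_bound[of a b] sum_squares_bound[of a "-b"] by (simp add: abs_if)
    hence "\<bar>\<kappa>\<bar> * \<bar>2 * (a * b)\<bar> \<le> \<bar>\<kappa>\<bar> * (a\<^sup>2 + b\<^sup>2)" by (intro mult_left_mono) auto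
    moreover have "2 * \<kappa> * (a * b) \<le> \<bar>\<kappa>\<bar> * \<bar>2 * (a * b)\<bar>"
      using abs_ge_self[of "\<kappa> * (2 * (a * b))"] by (simp add: abs_mult mult_ac)
    ultimately have "2 * \<kappa> * (a * b) - \<bar>\<kappa>\<bar> * (a\<^sup>2 + b\<^sup>2) \<le> 0" by linarith
    hence "exp (\<bar>\<kappa>\<bar> / x) / x\<^sup>2 * (2 * \<kappa> * (a * b) - \<bar>\<kappa>\<bar> * (a\<^sup>2 + b\<^sup>2)) \<le> 0"
      by (intro mult_nonneg_nonpos) auto
    with D show "\<exists>y. (Q has_real_derivative y) (at x) \<and> y \<le> 0" by blast
  qed
  have large: "\<bar>?K z\<bar> \<le> sqrt (Q 1)" if "z \<ge> 1" for z
  proof (rule real_le_rsqrt)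
    have "(?K z)\<^sup>2 * 1 \<le> ((?K z)\<^sup>2 + (?K' z)\<^sup>2) * exp (\<bar>\<kappa>\<bar> / z)"
      using that by (intro mult_mono) auto
    with Q[OF that] show "\<bar>?K z\<bar>\<^sup>2 \<le> Q 1" by (simp add: Q_def)
  qed
  define C where "C = C0 + sqrt (Q 1) + 1"
  have s: "sqrt (Q 1) \<ge> 0" by (simp add: Q_def)
  show ?thesis
  proof (rule that[of C])
    show "C > 0" using C0 s unfolding C_def by linarith
    fix z :: real assume z: "z > 0"
    show "\<bar>?K z\<bar> \<le> C"
    proof (cases "z \<le> 1")
      case True
      have "\<bar>?K z\<bar> \<le> C0 * z powr (\<nu> + 1/2)" using small z True by auto
      also have "\<dots> \<le> C0 * 1" using z True assms C0 by (intro mult_left_mono powr_le1) auto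
      finally show ?thesis using s unfolding C_def by linarith
    qed (use large[of z] C0 in \<open>unfold C_def, linarith\<close>)
  qed
qed

section \<open>Derivatives under the integral sign\<close>

lemma abs_exp_minus_linear_le: "\<bar>exp a - 1 - a\<bar> \<le> a\<^sup>2 * exp \<bar>a\<bar>" for a :: real
proof -
  obtain t where t: "\<bar>t\<bar> \<le> \<bar>a\<bar>" "exp a = (\<Sum>m<2. a ^ m / fact m) + exp t / fact 2 * a ^ 2"
    using Maclaurin_exp_le[of a 2] by blast
  hence "exp a - 1 - a = a\<^sup>2 * (exp t / 2)" by (simp add: numeral_2_eq_2)
  hence "\<bar>exp a - 1 - a\<bar> = a\<^sup>2 * (exp t / 2)" by (simp only: abs_mult) simp
  also have "exp t \<le> exp \<bar>a\<bar>" using t(1) by simp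
  hence "a\<^sup>2 * (exp t / 2) \<le> a\<^sup>2 * exp \<bar>a\<bar>" by (intro mult_left_mono) (use exp_gt_zero[of t] in linarith, auto)
  finally show ?thesis .
qed

lemma power_le_fact_exp: "x ^ n \<le> fact n * exp x" if "x \<ge> 0" for x :: real
proof -
  have "(\<Sum>k\<in>{n}. x ^ k /\<^sub>R fact k) \<le> exp x"
    unfolding exp_def by (intro sum_le_suminf summable_exp_generic) (use that in auto)
  thus ?thesis by (simp add: field_simps)
qed

lemma exp_abs_le: "exp (d * \<bar>l\<bar>) \<le> exp (d * l) + exp (- d * l)" for d l :: real
  by (auto simp: abs_if)

text \<open>A power of \<open>L\<close> is dominated by an arbitrarily small exponential: \<open>\<bar>l\<bar> ^ n\<close> is at most a constant
times \<open>exp (d l) + exp (- d l)\<close>, and \<open>s + d\<close>, \<open>s - d\<close> stay inside the interval if \<open>d\<close> is small.\<close>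
lemma integrable_power_exp_family:
  fixes L :: "'a \<Rightarrow> real" and \<phi> :: "'a \<Rightarrow> complex"
  assumes [measurable]: "L \<in> borel_measurable M" "\<phi> \<in> borel_measurable M"
    and int: "\<And>s. \<bar>s\<bar> < \<epsilon> \<Longrightarrow> integrable M (\<lambda>t. exp (s * L t) *\<^sub>R \<phi> t)"
    and s: "\<bar>s\<bar> < \<epsilon>"
  shows "integrable M (\<lambda>t. (L t ^ n * exp (s * L t)) *\<^sub>R \<phi> t)"
proof -
  define d where "d = (\<epsilon> - \<bar>s\<bar>) / 2"
  have d: "d > 0" "\<bar>s + d\<bar> < \<epsilon>" "\<bar>s - d\<bar> < \<epsilon>" using s by (simp_all add: d_def abs_if field_simps split: if_splits)
  define C where "C = fact n / d ^ n"
  have "C \<ge> 0" using d by (simp add: C_def)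
  show ?thesis
  proof (rule Bochner_Integration.integrable_bound)
    show "integrable M (\<lambda>t. C *\<^sub>R (norm (exp ((s + d) * L t) *\<^sub>R \<phi> t) + norm (exp ((s - d) * L t) *\<^sub>R \<phi> t)))"
      using int d by (intro integrable_scaleR_right Bochner_Integration.integrable_add integrable_norm) auto
    show "AE t in M. norm ((L t ^ n * exp (s * L t)) *\<^sub>R \<phi> t) \<le> norm
      (C *\<^sub>R (norm (exp ((s + d) * L t) *\<^sub>R \<phi> t) + norm (exp ((s - d) * L t) *\<^sub>R \<phi> t)))"
    proof (rule AE_I2)
      fix t
      have "(d * \<bar>L t\<bar>) ^ n \<le> fact n * exp (d * \<bar>L t\<bar>)" using d by (intro power_le_fact_exp) auto
      hence "\<bar>L t\<bar> ^ n \<le> C * exp (d * \<bar>L t\<bar>)" using d by (simp add: C_def power_mult_distrib field_simps)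
      also have "\<dots> \<le> C * (exp (d * L t) + exp (- d * L t))"
        using exp_abs_le[of d "L t"] \<open>C \<ge> 0\<close> by (intro mult_left_mono) auto
      finally have "\<bar>L t\<bar> ^ n * exp (s * L t) * norm (\<phi> t) \<le> C * (exp (d * L t) + exp (- d * L t)) * exp (s * L t) * norm (\<phi> t)"
        by (intro mult_right_mono) auto
      also have "\<dots> = C * (exp ((s + d) * L t) * norm (\<phi> t) + exp ((s - d) * L t) * norm (\<phi> t))"
        by (simp add: algebra_simps exp_add[symmetric] mult_exp_exp)
      finally show "norm ((L t ^ n * exp (s * L t)) *\<^sub>R \<phi> t) \<le> norm
        (C *\<^sub>R (norm (exp ((s + d) * L t) *\<^sub>R \<phi> t) + norm (exp ((s - d) * L t) *\<^sub>R \<phi> t)))"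
        using \<open>C \<ge> 0\<close> by (simp add: abs_mult power_abs)
    qed
  qed simp
qed

text \<open>Differentiation of the moment generating function of a complex density \<open>\<phi>\<close>. It serves twice:
for \<open>L y = 2 ln y\<close> the integrals are those of \<open>y powr (2 s)\<close>, as in the powers of the Bessel
operator, and for \<open>L t = - ln t\<close> they are Mellin transforms. Taylor's formula bounds the error
in the difference quotient by \<open>\<bar>h\<bar>\<close> times a fixed integral.\<close>
lemma has_vector_derivative_exp_family:
  fixes L :: "'a \<Rightarrow> real" and \<phi> :: "'a \<Rightarrow> complex"
  assumes [measurable]: "L \<in> borel_measurable M" "\<phi> \<in> borel_measurable M"
    and int: "\<And>s. \<bar>s\<bar> < \<epsilon> \<Longrightarrow> integrable M (\<lambda>t. exp (s * L t) *\<^sub>R \<phi> t)"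
    and s: "\<bar>s\<bar> < \<epsilon>"
  shows "((\<lambda>s. \<integral>t. (L t ^ n * exp (s * L t)) *\<^sub>R \<phi> t \<partial>M) has_vector_derivative
           (\<integral>t. (L t ^ Suc n * exp (s * L t)) *\<^sub>R \<phi> t \<partial>M)) (at s)"
proof -
  let ?F = "\<lambda>n s t. (L t ^ n * exp (s * L t)) *\<^sub>R \<phi> t"
  define G where "G n s = (\<integral>t. ?F n s t \<partial>M)" for n s
  have I: "integrable M (?F n s)" if "\<bar>s\<bar> < \<epsilon>" for n s
    by (rule integrable_power_exp_family[OF assms(1,2) int that])
  define d where "d = (\<epsilon> - \<bar>s\<bar>) / 2"
  have d: "d > 0" "\<bar>s + d\<bar> < \<epsilon>" "\<bar>s - d\<bar> < \<epsilon>" using s by (simp_all add: d_def abs_if field_simps split: if_splits)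
  define g where "g t = norm (?F (n + 2) (s + d) t) + norm (?F (n + 2) (s - d) t)" for t
  have g: "integrable M g" unfolding g_def
    by (intro Bochner_Integration.integrable_add integrable_norm I d)
  define C where "C = (\<integral>t. g t \<partial>M)"
  have bound: "norm (G n (s + h) - G n s - h *\<^sub>R G (Suc n) s) \<le> C * h\<^sup>2" if h: "\<bar>h\<bar> < d" for h
  proof -
    have "\<bar>s + h\<bar> < \<epsilon>" using h s by (auto simp: d_def)
    have "G n (s + h) - G n s - h *\<^sub>R G (Suc n) s = (\<integral>t. ?F n (s + h) t - ?F n s t - h *\<^sub>R ?F (Suc n) s t \<partial>M)"
      using Bochner_Integration.integral_diff[OF Bochner_Integration.integrable_diff[OF I[OF \<open>\<bar>s + h\<bar> < \<epsilon>\<close>] I[OF s]] integrable_scaleR_right[OF I[OF s]], of n n h "Suc n"]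
        Bochner_Integration.integral_diff[OF I[OF \<open>\<bar>s + h\<bar> < \<epsilon>\<close>, of n] I[OF s, of n]]
      by (simp only: G_def integral_scaleR_right)
    also have "norm \<dots> \<le> (\<integral>t. h\<^sup>2 * g t \<partial>M)"
    proof (rule order_trans[OF integral_norm_bound integral_mono])
      fix t
      define l where "l = L t"
      have "\<bar>exp (h * l) - 1 - h * l\<bar> \<le> (h * l)\<^sup>2 * exp \<bar>h * l\<bar>" by (rule abs_exp_minus_linear_le)
      also have "exp \<bar>h * l\<bar> \<le> exp (d * \<bar>l\<bar>)" using h by (auto simp: abs_mult intro!: mult_right_mono)
      also have "\<dots> \<le> exp (d * l) + exp (- d * l)" by (rule exp_abs_le)
      finally have "\<bar>exp (h * l) - 1 - h * l\<bar> \<le> (h * l)\<^sup>2 * (exp (d * l) + exp (- d * l))"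
        by (simp add: mult_left_mono)
      hence "\<bar>l\<bar> ^ n * exp (s * l) * \<bar>exp (h * l) - 1 - h * l\<bar> * norm (\<phi> t) \<le>
         \<bar>l\<bar> ^ n * exp (s * l) * ((h * l)\<^sup>2 * (exp (d * l) + exp (- d * l))) * norm (\<phi> t)"
        by (intro mult_right_mono mult_left_mono) auto
      also have "\<dots> = h\<^sup>2 * g t"
        by (simp add: g_def l_def[symmetric] abs_mult power_abs power_mult_distrib power_add 
              algebra_simps exp_add power2_eq_square exp_diff exp_minus divide_inverse)
      finally have "\<bar>l\<bar> ^ n * exp (s * l) * \<bar>exp (h * l) - 1 - h * l\<bar> * norm (\<phi> t) \<le> h\<^sup>2 * g t" .
      moreover have "?F n (s + h) t - ?F n s t - h *\<^sub>R ?F (Suc n) s t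
         = (l ^ n * exp (s * l) * (exp (h * l) - 1 - h * l)) *\<^sub>R \<phi> t"
        by (simp add: l_def algebra_simps exp_add)
      ultimately show "norm (?F n (s + h) t - ?F n s t - h *\<^sub>R ?F (Suc n) s t) \<le> h\<^sup>2 * g t"
        by (simp add: abs_mult power_abs)
    next
      show "integrable M (\<lambda>t. norm (?F n (s + h) t - ?F n s t - h *\<^sub>R ?F (Suc n) s t))"
        using I[OF \<open>\<bar>s + h\<bar> < \<epsilon>\<close>, of n] I[OF s, of n] I[OF s, of "Suc n"] 
        by (intro integrable_norm Bochner_Integration.integrable_diff integrable_scaleR_right) 
    qed (use g in auto)
    finally show ?thesis by (simp add: C_def mult.commute)
  qed
  have "(G n has_vector_derivative G (Suc n) s) (at s)"
    unfolding has_vector_derivative_def has_derivative_at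
  proof (intro conjI bounded_linear_scaleR_left)
    show "(\<lambda>h. norm (G n (s + h) - G n s - h *\<^sub>R G (Suc n) s) / norm h) \<midarrow>0\<rightarrow> 0"
    proof (rule tendsto_sandwich[OF _ _ tendsto_const])
      show "\<forall>\<^sub>F h in at 0. 0 \<le> norm (G n (s + h) - G n s - h *\<^sub>R G (Suc n) s) / norm h" by simp
      have "\<forall>\<^sub>F h in at 0. \<bar>h\<bar> < d" 
        unfolding eventually_at using d by (auto intro!: exI[of _ d] simp: dist_norm)
      thus "\<forall>\<^sub>F h in at 0. norm (G n (s + h) - G n s - h *\<^sub>R G (Suc n) s) / norm h \<le> C * \<bar>h\<bar>"
      proof eventually_elim
        case (elim h)
        show ?case
        proof (cases "h = 0")
          case False
          hence "C * h\<^sup>2 / \<bar>h\<bar> = C * \<bar>h\<bar>" by (simp add: power2_eq_square field_simps abs_if)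
          with divide_right_mono[OF bound[OF elim], of "\<bar>h\<bar>"] show ?thesis by simp
        qed simp
      qed
      show "((\<lambda>h. C * \<bar>h\<bar>) \<longlongrightarrow> 0) (at 0)" by (auto intro!: tendsto_eq_intros)
    qed
  qed
  thus ?thesis by (simp add: G_def[abs_def])
qed

lemma has_nth_vderiv_cong:
  assumes "\<forall>\<^sub>F u in nhds s. f u = g u" "has_nth_vderiv n f s d"
  shows "has_nth_vderiv n g s d"
  using assms
proof (induction n arbitrary: s d)
  case 0 thus ?case using eventually_nhds_x_imp_x by fastforce
next
  case (Suc n)
  from Suc.prems(2) obtain h where h: "\<forall>\<^sub>F u in nhds s. has_nth_vderiv n f u (h u)" "(h has_vector_derivative d) (at s)"
    by auto
  from Suc.prems(1) have "\<forall>\<^sub>F u in nhds s. \<forall>\<^sub>F v in nhds u. f v = g v" by (simp add: eventually_eventually)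
  with h(1) have "\<forall>\<^sub>F u in nhds s. has_nth_vderiv n g u (h u)"
    by eventually_elim (use Suc.IH in blast)
  with h(2) show ?case by auto
qed

lemma has_nth_vderiv_chain:
  assumes "\<And>n s. \<bar>s\<bar> < \<epsilon> \<Longrightarrow> (G n has_vector_derivative G (Suc n) s) (at s)" "\<bar>s\<bar> < \<epsilon>"
  shows "has_nth_vderiv n (G k) s (G (n + k) s)"
  using assms(2)
proof (induction n arbitrary: s)
  case (Suc n)
  have "\<forall>\<^sub>F u in nhds s. \<bar>u\<bar> < \<epsilon>"
    using Suc.prems by (intro order_tendstoD[of abs]) (auto intro!: tendsto_eq_intros filterlim_ident)
  hence "\<forall>\<^sub>F u in nhds s. has_nth_vderiv n (G k) u (G (n + k) u)"
    by eventually_elim (rule Suc.IH)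
  with assms(1)[OF Suc.prems, of "n + k"] show ?case by auto
qed simp

text \<open>The \<open>n\<close>-th derivative of the product \<open>A 0 * B 0\<close> when \<open>A k\<close> and \<open>B k\<close> are the \<open>k\<close>-th derivatives
of the two factors.\<close>
definition leibniz_sum :: "(nat \<Rightarrow> real \<Rightarrow> complex) \<Rightarrow> (nat \<Rightarrow> real \<Rightarrow> complex) \<Rightarrow> nat \<Rightarrow> real \<Rightarrow> complex" where
  "leibniz_sum A B n s = (\<Sum>k\<le>n. of_nat (n choose k) * A (n - k) s * B k s)"

lemma has_vector_derivative_leibniz_sum:
  assumes A: "\<And>n. (A n has_vector_derivative A (Suc n) s) (at s)"
    and B: "\<And>n. (B n has_vector_derivative B (Suc n) s) (at s)"
  shows "(leibniz_sum A B n has_vector_derivative leibniz_sum A B (Suc n) s) (at s)"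
proof -
  define X where "X k = A (Suc n - k) s * B k s" for k
  have "(leibniz_sum A B n has_vector_derivative
      (\<Sum>k\<le>n. of_nat (n choose k) * A (n - k) s * B (Suc k) s + of_nat (n choose k) * A (Suc (n - k)) s * B k s)) (at s)"
    unfolding leibniz_sum_def[abs_def]
    by (rule has_vector_derivative_sum) 
       (rule has_vector_derivative_mult[OF has_vector_derivative_mult_right[OF A] B])
  also have "(\<Sum>k\<le>n. of_nat (n choose k) * A (n - k) s * B (Suc k) s + of_nat (n choose k) * A (Suc (n - k)) s * B k s)
      = (\<Sum>k\<le>n. of_nat (n choose k) * X (Suc k)) + (\<Sum>k\<le>n. of_nat (n choose k) * X k)"
    by (simp add: sum.distrib X_def Suc_diff_le mult.assoc)
  also have "(\<Sum>k\<le>n. of_nat (n choose k) * X k) = (\<Sum>k\<le>Suc n. of_nat (n choose k) * X k)" by simp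
  also have "\<dots> = X 0 + (\<Sum>k\<le>n. of_nat (n choose Suc k) * X (Suc k))"
    by (subst sum.atMost_Suc_shift) simp
  also have "(\<Sum>k\<le>n. of_nat (n choose k) * X (Suc k)) + (X 0 + (\<Sum>k\<le>n. of_nat (n choose Suc k) * X (Suc k)))
     = X 0 + (\<Sum>k\<le>n. of_nat (Suc n choose Suc k) * X (Suc k))"
    by (simp add: algebra_simps sum.distrib)
  also have "\<dots> = (\<Sum>k\<le>Suc n. of_nat (Suc n choose k) * X k)"
    by (subst sum.atMost_Suc_shift) simp
  also have "\<dots> = leibniz_sum A B (Suc n) s" by (simp add: leibniz_sum_def X_def mult.assoc)
  finally show ?thesis .
qed

text \<open>The derivatives of \<open>1 / \<Gamma>(1 - s)\<close> on the real line, taken from the entire function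
\<open>z \<mapsto> 1 / \<Gamma>(1 - z)\<close>, so that the existence of all of them is clear.\<close>
definition rGamma_deriv :: "nat \<Rightarrow> real \<Rightarrow> real" where
  "rGamma_deriv n s = Re ((deriv ^^ n) (\<lambda>z. rGamma (1 - z)) (complex_of_real s))"

lemma has_real_derivative_rGamma_deriv:
  "(rGamma_deriv n has_real_derivative rGamma_deriv (Suc n) s) (at s)"
proof -
  let ?f = "\<lambda>z::complex. rGamma (1 - z)"
  have h: "?f holomorphic_on UNIV" by (intro holomorphic_intros)
  have "(deriv ^^ n) ?f holomorphic_on UNIV" by (rule holomorphic_higher_deriv[OF h]) auto
  hence "((deriv ^^ n) ?f has_field_derivative (deriv ^^ Suc n) ?f (of_real s)) (at (of_real s))"
    by (simp add: holomorphic_derivI)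
  hence "((\<lambda>x. (deriv ^^ n) ?f (complex_of_real x)) has_vector_derivative (deriv ^^ Suc n) ?f (of_real s)) (at s)"
    by (rule has_vector_derivative_real_field)
  from bounded_linear.has_vector_derivative[OF bounded_linear_Re this] show ?thesis
    unfolding rGamma_deriv_def[abs_def] has_real_derivative_iff_has_vector_derivative .
qed

lemma deriv_inverse_Gamma_eq: "(deriv ^^ n) (\<lambda>s::real. 1 / Gamma (1 - s)) = rGamma_deriv n"
proof (induction n)
  case 0
  show ?case
  proof
    fix s :: real
    have "rGamma (1 - complex_of_real s) = of_real (rGamma (1 - s))"
      by (metis of_real_1 of_real_diff rGamma_complex_of_real)
    thus "(deriv ^^ 0) (\<lambda>s::real. 1 / Gamma (1 - s)) s = rGamma_deriv 0 s"
      by (simp add: rGamma_deriv_def Gamma_def divide_inverse)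
  qed
next
  case (Suc n)
  show ?case by (auto simp: Suc.IH intro!: ext DERIV_imp_deriv has_real_derivative_rGamma_deriv)
qed

section \<open>Weber's second exponential integral\<close>

lemma gbinomial_shift_Gamma:
  assumes "\<nu> > (-1::real)" "l \<le> i"
  shows "(\<nu> + real i) gchoose (i - l) = Gamma (\<nu> + real i + 1) / (fact (i - l) * Gamma (\<nu> + real l + 1))"
proof -
  have "\<nu> + real i + 1 > 0" using assms by linarith
  hence "\<nu> + real i + 1 \<notin> \<int>\<^sub>\<le>\<^sub>0" using nonpos_Ints_nonpos[of "\<nu> + real i + 1"] by force
  from gbinomial_Gamma[OF this, of "i - l"] assms show ?thesis by (simp add: of_nat_diff algebra_simps)
qed

text \<open>Vandermonde's identity for the binomial coefficient of \<open>\<nu> + i + j\<close> over \<open>i\<close>, with all generalised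
binomial coefficients written as quotients of Gamma values.\<close>
lemma Gamma_Vandermonde:
  assumes "\<nu> > (-1::real)"
  shows "(\<Sum>l | l \<le> i \<and> l \<le> j. 1 / (fact l * Gamma (\<nu> + real l + 1) * fact (i - l) * fact (j - l)))
    = Gamma (\<nu> + real (i + j) + 1) / (fact i * fact j * Gamma (\<nu> + real i + 1) * Gamma (\<nu> + real j + 1))"
proof -
  let ?G = "\<lambda>k. Gamma (\<nu> + real k + 1)"
  have G: "?G k > 0" for k using assms by (intro Gamma_real_pos) linarith
  have "(\<Sum>k\<in>{0..i}. ((\<nu> + real i) gchoose k) * (real j gchoose (i - k))) = (\<nu> + real i + real j) gchoose i"
    by (rule gbinomial_Vandermonde)
  also have "\<dots> = ?G (i + j) / (fact i * ?G j)"
    using gbinomial_shift_Gamma[OF assms, of j "i + j"] by (simp add: add_ac)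
  also have "(\<Sum>k\<in>{0..i}. ((\<nu> + real i) gchoose k) * (real j gchoose (i - k)))
     = (\<Sum>l\<in>{..i}. ((\<nu> + real i) gchoose (i - l)) * (real j gchoose l))"
    by (rule sum.reindex_bij_witness[of _ "\<lambda>l. i - l" "\<lambda>l. i - l"]) auto
  also have "\<dots> = (\<Sum>l | l \<le> i \<and> l \<le> j. ((\<nu> + real i) gchoose (i - l)) * (real j gchoose l))"
    by (rule sum.mono_neutral_right) (auto simp: binomial_gbinomial[symmetric])
  also have "\<dots> = (\<Sum>l | l \<le> i \<and> l \<le> j. fact j * ?G i * (1 / (fact l * ?G l * fact (i - l) * fact (j - l))))"
  proof (rule sum.cong[OF refl])
    fix l assume "l \<in> {l. l \<le> i \<and> l \<le> j}"
    hence l: "l \<le> i" "l \<le> j" by auto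
    show "((\<nu> + real i) gchoose (i - l)) * (real j gchoose l) = fact j * ?G i * (1 / (fact l * ?G l * fact (i - l) * fact (j - l)))"
      using l gbinomial_shift_Gamma[OF assms l(1)] 
      by (simp add: binomial_gbinomial[symmetric] binomial_fact mult_ac)
  qed
  also have "\<dots> = fact j * ?G i * (\<Sum>l | l \<le> i \<and> l \<le> j. (1 / (fact l * ?G l * fact (i - l) * fact (j - l))))"
    by (simp add: sum_distrib_left)
  finally show ?thesis using G[of i] G[of j] by (simp add: field_simps)
qed

lemma power_sum_div_fact:
  "(a + b) ^ n / fact n = (\<Sum>q\<le>n. a ^ q * b ^ (n - q) / (fact q * fact (n - q)))" for a b :: real
proof -
  have "(a + b) ^ n / fact n = (\<Sum>q\<le>n. of_nat (n choose q) * a ^ q * b ^ (n - q) / fact n)"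
    by (simp add: binomial_ring sum_divide_distrib)
  also have "\<dots> = (\<Sum>q\<le>n. a ^ q * b ^ (n - q) / (fact q * fact (n - q)))"
    by (intro sum.cong) (auto simp: binomial_fact)
  finally show ?thesis .
qed

text \<open>The coefficients of \<open>s \<mapsto> bessel_clifford \<nu> (c s\<^sup>2)\<close> as a power series in \<open>s\<close>. The odd ones are
included as zeros because the Cauchy product with the exponential series runs over all powers.\<close>
definition bessel_sq_coeff :: "real \<Rightarrow> real \<Rightarrow> nat \<Rightarrow> real" where
  "bessel_sq_coeff \<nu> c m = (if even m then c ^ (m div 2) / (fact (m div 2) * Gamma (\<nu> + real (m div 2) + 1)) else 0)"

lemma bessel_sq_coeff_sums:
  assumes "\<nu> > -1"
  shows "bessel_sq_coeff \<nu> c sums bessel_clifford \<nu> c"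
proof -
  have "(\<lambda>k. bessel_sq_coeff \<nu> c (2 * k)) sums bessel_clifford \<nu> c"
    using summable_sums[OF summable_bessel_clifford[OF assms, of c]] by (simp add: bessel_sq_coeff_def bessel_clifford_def)
  thus ?thesis
    by (subst (asm) sums_mono_reindex) (auto simp: strict_mono_def bessel_sq_coeff_def image_iff elim!: evenE)
qed

text \<open>On the left is a coefficient of the product of two Bessel-Clifford series, multiplied by the
Gamma value that integration against a Gaussian produces; on the right is a coefficient of
\<open>exp ((a + b) s)\<close> times \<open>bessel_clifford \<nu> (a b s\<^sup>2)\<close>. If \<open>(a + b) ^ (n - 2 l)\<close> is expanded, the
coefficients of \<open>a ^ i * b ^ (n - i)\<close> agree by \<open>Gamma_Vandermonde\<close>.\<close>
lemma Gamma_Cauchy_product: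
  fixes a b :: real
  assumes \<nu>: "\<nu> > (-1::real)"
  shows "Gamma (\<nu> + real n + 1) * (\<Sum>i\<le>n. a ^ i / (fact i * Gamma (\<nu> + real i + 1)) * (b ^ (n - i) / (fact (n - i) * Gamma (\<nu> + real (n - i) + 1))))
    = (\<Sum>m\<le>n. bessel_sq_coeff \<nu> (a * b) m * ((a + b) ^ (n - m) / fact (n - m)))"
proof -
  let ?G = "\<lambda>k. Gamma (\<nu> + real k + 1)"
  have "(\<Sum>m\<le>n. bessel_sq_coeff \<nu> (a * b) m * ((a + b) ^ (n - m) / fact (n - m)))
    = (\<Sum>m\<in>(\<lambda>l. 2 * l) ` {l. 2 * l \<le> n}. bessel_sq_coeff \<nu> (a * b) m * ((a + b) ^ (n - m) / fact (n - m)))"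
    by (rule sum.mono_neutral_right) (auto simp: bessel_sq_coeff_def image_iff elim!: evenE)
  also have "\<dots> = (\<Sum>l | 2 * l \<le> n. (a * b) ^ l / (fact l * ?G l) * ((a + b) ^ (n - 2 * l) / fact (n - 2 * l)))"
    by (subst sum.reindex) (auto simp: inj_on_def bessel_sq_coeff_def)
  also have "\<dots> = (\<Sum>l | 2 * l \<le> n. \<Sum>q\<le>n - 2 * l. (a * b) ^ l / (fact l * ?G l) * (a ^ q * b ^ (n - 2 * l - q) / (fact q * fact (n - 2 * l - q))))"
    by (simp add: power_sum_div_fact sum_distrib_left)
  also have "\<dots> = (\<Sum>(l,q)\<in>(SIGMA l:{l. 2 * l \<le> n}. {..n - 2 * l}). (a * b) ^ l / (fact l * ?G l) * (a ^ q * b ^ (n - 2 * l - q) / (fact q * fact (n - 2 * l - q))))"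
    by (rule sum.Sigma) (auto intro: finite_subset[of _ "{..n}"])
  also have "\<dots> = (\<Sum>(i,l)\<in>(SIGMA i:{..n}. {l. l \<le> i \<and> l \<le> n - i}). a ^ i * b ^ (n - i) * (1 / (fact l * ?G l * fact (i - l) * fact (n - i - l))))"
  proof (rule sum.reindex_bij_witness[of _ "\<lambda>(i,l). (l, i - l)" "\<lambda>(l,q). (l + q, l)"], goal_cases)
    case (5 lq)
    obtain l q where [simp]: "lq = (l, q)" by force
    have lq: "2 * l + q \<le> n" using 5 by auto
    have "n - (l + q) = l + (n - 2 * l - q)" "n - (l + q) - l = n - 2 * l - q" using lq by auto
    moreover have "n - (l + q + l) = n - 2 * l - q" by simp
    ultimately show ?case by (simp add: power_add power_mult_distrib mult_ac)
  qed auto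
  also have "\<dots> = (\<Sum>i\<le>n. \<Sum>l | l \<le> i \<and> l \<le> n - i. a ^ i * b ^ (n - i) * (1 / (fact l * ?G l * fact (i - l) * fact (n - i - l))))"
    by (rule sum.Sigma[symmetric]) (auto intro: finite_subset[of _ "{..n}"])
  also have "\<dots> = (\<Sum>i\<le>n. a ^ i * b ^ (n - i) * (?G n / (fact i * fact (n - i) * ?G i * ?G (n - i))))"
    by (intro sum.cong refl, subst sum_distrib_left[symmetric], subst Gamma_Vandermonde[OF \<nu>]) auto
  also have "\<dots> = ?G n * (\<Sum>i\<le>n. a ^ i / (fact i * ?G i) * (b ^ (n - i) / (fact (n - i) * ?G (n - i))))"
    by (subst sum_distrib_left, intro sum.cong refl) (simp add: mult_ac)
  finally show ?thesis ..
qed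

lemma set_integral_eqI_nn_integral:
  fixes f :: "real \<Rightarrow> real"
  assumes [measurable]: "f \<in> borel_measurable borel" "A \<in> sets borel"
    and "\<And>x. x \<in> A \<Longrightarrow> f x \<ge> 0" "c \<ge> 0"
    and "(\<integral>\<^sup>+x. ennreal (indicator A x * f x) \<partial>lborel) = ennreal c"
  shows "set_integrable lborel A f" "(LINT x:A|lborel. f x) = c"
proof -
  have "has_bochner_integral lborel (\<lambda>x. indicator A x * f x) c"
    by (rule has_bochner_integral_nn_integral) (use assms in \<open>auto simp: indicator_def\<close>)
  thus "set_integrable lborel A f" "(LINT x:A|lborel. f x) = c"
    by (auto simp: set_integrable_def set_lebesgue_integral_def has_bochner_integral_iff)
qed

lemma
  assumes "p > 0" "z > (0::real)"
  shows set_integrable_Gamma_scaled: "set_integrable lborel {0<..} (\<lambda>r. exp (- (z * r)) * r powr (p - 1))"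
    and set_integral_Gamma_scaled: "(LINT r:{0<..}|lborel. exp (- (z * r)) * r powr (p - 1)) = Gamma p * z powr (- p)"
proof -
  have "ennreal (Gamma p) = ennreal \<bar>z\<bar> * (\<integral>\<^sup>+t. ennreal (indicator {0..} (0 + z * t) * (0 + z * t) powr (p - 1) / exp (0 + z * t)) \<partial>lborel)"
    unfolding Gamma_conv_nn_integral_real[OF assms(1)]
    by (rule nn_integral_real_affine) (use assms in auto)
  also have "(\<lambda>t. ennreal (indicator {0..} (0 + z * t) * (0 + z * t) powr (p - 1) / exp (0 + z * t)))
     = (\<lambda>t. ennreal (z powr (p - 1)) * ennreal (indicator {0<..} t * (exp (- (z * t)) * t powr (p - 1))))"
  proof
    fix t show "ennreal (indicator {0..} (0 + z * t) * (0 + z * t) powr (p - 1) / exp (0 + z * t)) = 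
       ennreal (z powr (p - 1)) * ennreal (indicator {0<..} t * (exp (- (z * t)) * t powr (p - 1)))"
    proof (cases "t > 0")
      case True
      thus ?thesis using assms by (simp add: ennreal_mult'[symmetric] powr_mult exp_minus field_simps)
    next
      case False
      hence "indicator {0..} (0 + z * t) * (0 + z * t) powr (p - 1) = 0"
        using assms by (cases "t = 0") (auto simp: indicator_def zero_le_mult_iff)
      thus ?thesis using False by (simp add: indicator_def)
    qed
  qed
  also have "(\<integral>\<^sup>+t. ennreal (z powr (p - 1)) * ennreal (indicator {0<..} t * (exp (- (z * t)) * t powr (p - 1))) \<partial>lborel)
      = ennreal (z powr (p - 1)) * (\<integral>\<^sup>+t. ennreal (indicator {0<..} t * (exp (- (z * t)) * t powr (p - 1))) \<partial>lborel)"
    by (rule nn_integral_cmult) simp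
  finally have *: "ennreal (Gamma p) = ennreal (z powr p) * (\<integral>\<^sup>+t. ennreal (indicator {0<..} t * (exp (- (z * t)) * t powr (p - 1))) \<partial>lborel)"
    using assms by (simp add: mult.assoc[symmetric] ennreal_mult'[symmetric] powr_diff)
  have "ennreal (z powr (- p)) * ennreal (Gamma p) = (\<integral>\<^sup>+t. ennreal (indicator {0<..} t * (exp (- (z * t)) * t powr (p - 1))) \<partial>lborel)"
    unfolding * using assms by (simp add: mult.assoc[symmetric] ennreal_mult'[symmetric] powr_minus)
  hence **: "(\<integral>\<^sup>+t. ennreal (indicator {0<..} t * (exp (- (z * t)) * t powr (p - 1))) \<partial>lborel) = ennreal (Gamma p * z powr (- p))"
    using assms by (simp add: ennreal_mult'[symmetric] mult.commute Gamma_real_pos less_imp_le)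
  show "set_integrable lborel {0<..} (\<lambda>r. exp (- (z * r)) * r powr (p - 1))"
    "(LINT r:{0<..}|lborel. exp (- (z * r)) * r powr (p - 1)) = Gamma p * z powr (- p)"
    using assms by (auto intro!: set_integral_eqI_nn_integral(1)[OF _ _ _ _ **] set_integral_eqI_nn_integral(2)[OF _ _ _ _ **]
      simp: Gamma_real_pos less_imp_le)
qed

lemma
  assumes a: "a > 0" and t: "t > (0::real)"
  shows set_integrable_Gaussian_moment: "set_integrable lborel {0<..} (\<lambda>z. z powr (2 * a - 1) * exp (- (t * z\<^sup>2)))"
    and set_integral_Gaussian_moment: "(LINT z:{0<..}|lborel. z powr (2 * a - 1) * exp (- (t * z\<^sup>2))) = Gamma a / (2 * t powr a)"
proof -
  define f where "f = (\<lambda>w::real. exp (- w) * w powr (a - 1))"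
  have f: "f integrable_on {0<..}" "integral {0<..} f = Gamma a"
    using set_borel_integral_eq_integral[OF set_integrable_Gamma_scaled[OF a, of 1]] set_integral_Gamma_scaled[OF a, of 1]
    by (auto simp: f_def)
  have f': "f absolutely_integrable_on {0<..}"
    using f(1) by (rule nonnegative_absolutely_integrable_1) (simp add: f_def)
  have im: "(\<lambda>z. t * z\<^sup>2) ` {0<..} = {0<..}"
  proof (intro equalityI subsetI)
    fix w :: real assume "w \<in> {0<..}"
    thus "w \<in> (\<lambda>z. t * z\<^sup>2) ` {0<..}" using t by (intro image_eqI[of _ _ "sqrt (w / t)"]) auto
  qed (use t in auto)
  have "(\<lambda>z. \<bar>2 * t * z\<bar> * f (t * z\<^sup>2)) absolutely_integrable_on {0<..} \<and> 
     integral {0<..} (\<lambda>z. \<bar>2 * t * z\<bar> * f (t * z\<^sup>2)) = Gamma a"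
    using f f' t
    by (subst has_absolute_integral_change_of_variables_1'[where g = "\<lambda>z. t * z\<^sup>2"])
       (auto simp: im inj_on_def intro!: derivative_eq_intros)
  hence "((\<lambda>z. \<bar>2 * t * z\<bar> * f (t * z\<^sup>2)) has_integral Gamma a) {0<..}"
    using set_lebesgue_integral_eq_integral(1) integrable_integral by metis
  hence "((\<lambda>z. 1 / (2 * t powr a) * (\<bar>2 * t * z\<bar> * f (t * z\<^sup>2))) has_integral 1 / (2 * t powr a) * Gamma a) {0<..}"
    by (rule has_integral_mult_right)
  also have "?this \<longleftrightarrow> ((\<lambda>z. z powr (2 * a - 1) * exp (- (t * z\<^sup>2))) has_integral 1 / (2 * t powr a) * Gamma a) {0<..}"
  proof (rule has_integral_cong)
    fix z :: real assume z: "z \<in> {0<..}"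
    have "z powr (2 * a - 1) = z * (z powr (a - 1) * z powr (a - 1))"
      using z powr_add[of z 1 "2 * a - 2"] powr_add[of z "a - 1" "a - 1"] by simp
    moreover have "t powr a = t * t powr (a - 1)" using t powr_add[of t 1 "a - 1"] by simp
    moreover have "(t * z\<^sup>2) powr (a - 1) = t powr (a - 1) * (z powr (a - 1) * z powr (a - 1))"
      using z t by (simp add: powr_mult power2_eq_square)
    ultimately show "1 / (2 * t powr a) * (\<bar>2 * t * z\<bar> * f (t * z\<^sup>2)) = z powr (2 * a - 1) * exp (- (t * z\<^sup>2))"
      using z t by (simp add: f_def)
  qed
  finally have "((\<lambda>z. z powr (2 * a - 1) * exp (- (t * z\<^sup>2))) has_integral Gamma a / (2 * t powr a)) {0<..}" by simp
  from nn_integral_has_integral_lebesgue[OF _ this]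
  have **: "(\<integral>\<^sup>+z. ennreal (indicator {0<..} z * (z powr (2 * a - 1) * exp (- (t * z\<^sup>2)))) \<partial>lborel) = ennreal (Gamma a / (2 * t powr a))"
    by simp
  show "set_integrable lborel {0<..} (\<lambda>z. z powr (2 * a - 1) * exp (- (t * z\<^sup>2)))"
    "(LINT z:{0<..}|lborel. z powr (2 * a - 1) * exp (- (t * z\<^sup>2))) = Gamma a / (2 * t powr a)"
    using assms by (auto intro!: set_integral_eqI_nn_integral(1)[OF _ _ _ _ **] set_integral_eqI_nn_integral(2)[OF _ _ _ _ **]
      simp: Gamma_real_pos less_imp_le)
qed

text \<open>The product of the two kernels is a power series in \<open>z\<close> by the Cauchy product; it is integrated
term by term. Each power of \<open>z\<close> contributes a Gamma value, and \<open>Gamma_Cauchy_product\<close> identifies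
the resulting series as the exponential series times that of \<open>I\<close>. The integrals of the absolute
values form the same series without signs, whence its absolute convergence.\<close>
lemma Weber_second_exponential_integral:
  assumes \<nu>: "\<nu> > -1" and pos: "x > 0" "y > 0" "t > 0"
  shows "set_integrable lborel {0<..} (\<lambda>z. exp (- (t * z\<^sup>2)) * (bessel_wave \<nu> (x * z) * bessel_wave \<nu> (y * z)))"
    and "(LINT z:{0<..}|lborel. exp (- (t * z\<^sup>2)) * (bessel_wave \<nu> (x * z) * bessel_wave \<nu> (y * z))) = bessel_heat \<nu> t x y"
proof -
  define \<alpha> \<beta> where "\<alpha> = x\<^sup>2 / 4" and "\<beta> = y\<^sup>2 / 4"
  define a b where "a = \<alpha> / t" and "b = \<beta> / t"
  have ab: "\<alpha> > 0" "\<beta> > 0" "a > 0" "b > 0" using pos by (auto simp: \<alpha>_def \<beta>_def a_def b_def)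
  let ?G = "\<lambda>k. Gamma (\<nu> + real k + 1)"
  have G: "?G k > 0" for k using \<nu> by (intro Gamma_real_pos) linarith
  define e where "e c k = c ^ k / (fact k * ?G k)" for c :: real and k
  define P where "P n = (\<Sum>i\<le>n. e \<alpha> i * e \<beta> (n - i))" for n
  define D where "D = sqrt (x * y) * (x * y / 4) powr \<nu>"
  define F where "F n z = D * ((-1) ^ n * P n) * (z powr (2 * (\<nu> + real n + 1) - 1) * exp (- (t * z\<^sup>2)))" for n z
  define Q where "Q n = (\<Sum>m\<le>n. bessel_sq_coeff \<nu> (a * b) m * ((a + b) ^ (n - m) / fact (n - m)))" for n
  have e: "summable (\<lambda>k. norm (e c k))" for c
    using summable_bessel_clifford[OF \<nu>, of "\<bar>c\<bar>"] G by (simp add: e_def abs_mult power_abs abs_of_pos)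
  have "P n \<ge> 0" for n unfolding P_def e_def
    by (intro sum_nonneg mult_nonneg_nonneg divide_nonneg_nonneg zero_le_power less_imp_le[OF G]) (use ab in auto)
  have "D > 0" using pos by (simp add: D_def)
  \<comment> \<open>the product of the two kernels as a power series\<close>
  have series: "(\<lambda>n. F n z) sums (exp (- (t * z\<^sup>2)) * (bessel_wave \<nu> (x * z) * bessel_wave \<nu> (y * z)))"
      and abs_series: "summable (\<lambda>n. norm (F n z))" if z: "z > 0" for z
  proof -
    have esum: "(\<Sum>k. e c k) = bessel_clifford \<nu> c" for c by (simp add: e_def bessel_clifford_def)
    have prod: "(\<Sum>i\<le>n. e (w * \<alpha>) i * e (w * \<beta>) (n - i)) = w ^ n * P n" for w n
      unfolding P_def e_def sum_distrib_left
      by (intro sum.cong refl) (auto simp: power_mult_distrib power_add[symmetric] mult_ac)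
    have "(\<lambda>n. (- z\<^sup>2) ^ n * P n) sums (bessel_clifford \<nu> (- z\<^sup>2 * \<alpha>) * bessel_clifford \<nu> (- z\<^sup>2 * \<beta>))"
      using Cauchy_product_sums[OF e e, of "- z\<^sup>2 * \<alpha>" "- z\<^sup>2 * \<beta>"] unfolding prod esum .
    hence "(\<lambda>n. D * z powr (2 * \<nu> + 1) * exp (- (t * z\<^sup>2)) * ((- z\<^sup>2) ^ n * P n)) sums
      (D * z powr (2 * \<nu> + 1) * exp (- (t * z\<^sup>2)) * (bessel_clifford \<nu> (- z\<^sup>2 * \<alpha>) * bessel_clifford \<nu> (- z\<^sup>2 * \<beta>)))"
      by (rule sums_mult)
    moreover have F: "F n z = D * z powr (2 * \<nu> + 1) * exp (- (t * z\<^sup>2)) * ((- z\<^sup>2) ^ n * P n)" for n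
    proof -
      have "z powr (2 * (\<nu> + real n + 1) - 1) = z powr (2 * \<nu> + 1) * (z\<^sup>2) ^ n"
      proof -
        have "z powr (2 * (\<nu> + real n + 1) - 1) = z powr (2 * \<nu> + 1) * z powr (real (2 * n))"
          by (simp add: powr_add[symmetric] algebra_simps)
        also have "z powr (real (2 * n)) = (z\<^sup>2) ^ n" using z by (subst powr_realpow) (auto simp: power_mult)
        finally show ?thesis .
      qed
      moreover have "(- z\<^sup>2) ^ n = (-1) ^ n * (z\<^sup>2) ^ n" by (rule power_minus)
      ultimately show ?thesis by (simp add: F_def)
    qed
    moreover have "D * z powr (2 * \<nu> + 1) * exp (- (t * z\<^sup>2)) * (bessel_clifford \<nu> (- z\<^sup>2 * \<alpha>) * bessel_clifford \<nu> (- z\<^sup>2 * \<beta>))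
        = exp (- (t * z\<^sup>2)) * (bessel_wave \<nu> (x * z) * bessel_wave \<nu> (y * z))"
    proof -
      have "D * z powr (2 * \<nu> + 1) = sqrt (x * z) * (x * z / 2) powr \<nu> * (sqrt (y * z) * (y * z / 2) powr \<nu>)"
        using pos z powr_add[of z \<nu> \<nu>]
        by (simp add: D_def real_sqrt_mult powr_mult powr_divide powr_add powr_mult[of 2 2, simplified, symmetric] algebra_simps)
      thus ?thesis using pos z \<nu>
        by (simp add: bessel_wave_def bessel_J_eq \<alpha>_def \<beta>_def power_mult_distrib mult_ac)
    qed
    ultimately show "(\<lambda>n. F n z) sums (exp (- (t * z\<^sup>2)) * (bessel_wave \<nu> (x * z) * bessel_wave \<nu> (y * z)))" by (simp only:)
    have "summable (\<lambda>n. norm (F n z)) \<longleftrightarrow> summable (\<lambda>n. D * z powr (2 * \<nu> + 1) * exp (- (t * z\<^sup>2)) * ((z\<^sup>2) ^ n * P n))"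
      unfolding F using \<open>D > 0\<close> \<open>\<And>n. P n \<ge> 0\<close> by (simp add: abs_mult power_abs)
    also have \<dots>
      using summable_Cauchy_product[OF e e, of "z\<^sup>2 * \<alpha>" "z\<^sup>2 * \<beta>"] unfolding prod by (rule summable_mult)
    finally show "summable (\<lambda>n. norm (F n z))" .
  qed
  have PQ: "P n * ?G n / t ^ n = Q n" for n
  proof -
    have "Q n = ?G n * (\<Sum>i\<le>n. e a i * e b (n - i))"
      unfolding Q_def e_def by (rule Gamma_Cauchy_product[OF \<nu>, symmetric])
    also have "(\<Sum>i\<le>n. e a i * e b (n - i)) = P n / t ^ n"
      unfolding P_def e_def a_def b_def sum_divide_distrib
    proof (intro sum.cong refl)
      fix i assume "i \<in> {..n}"
      hence "t ^ n = t ^ i * t ^ (n - i)" by (simp add: power_add[symmetric])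
      thus "(\<alpha> / t) ^ i / (fact i * ?G i) * ((\<beta> / t) ^ (n - i) / (fact (n - i) * ?G (n - i)))
         = \<alpha> ^ i / (fact i * ?G i) * (\<beta> ^ (n - i) / (fact (n - i) * ?G (n - i))) / t ^ n"
        by (simp add: power_divide)
    qed
    finally show ?thesis by (simp add: mult.commute)
  qed
  have mom: "set_integrable lborel {0<..} (\<lambda>z. z powr (2 * (\<nu> + real n + 1) - 1) * exp (- (t * z\<^sup>2)))"
    "(LINT z:{0<..}|lborel. z powr (2 * (\<nu> + real n + 1) - 1) * exp (- (t * z\<^sup>2))) = ?G n / (2 * t powr (\<nu> + real n + 1))" for n
    using set_integrable_Gaussian_moment[of "\<nu> + real n + 1" t] set_integral_Gaussian_moment[of "\<nu> + real n + 1" t] \<nu> pos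
    by auto
  have tp: "t powr (\<nu> + real n + 1) = t powr (\<nu> + 1) * t ^ n" for n
    using pos powr_add[of t "\<nu> + 1" "real n"] by (simp add: powr_realpow add_ac)
  \<comment> \<open>the factor common to all integrated terms\<close>
  define c where "c = D / (2 * t powr (\<nu> + 1))"
  have FI: "set_integrable lborel {0<..} (F n)" for n
    unfolding F_def by (intro set_integrable_mult_right mom)
  have F_int: "(LINT z:{0<..}|lborel. F n z) = c * ((-1) ^ n * Q n)" for n
    unfolding F_def by (simp only: set_integral_mult_right mom(2) tp c_def PQ[symmetric]) simp
  have F_norm_int: "(LINT z:{0<..}|lborel. norm (F n z)) = c * Q n" for n
  proof -
    have "(LINT z:{0<..}|lborel. norm (F n z)) = (LINT z:{0<..}|lborel. D * P n * (z powr (2 * (\<nu> + real n + 1) - 1) * exp (- (t * z\<^sup>2))))"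
      using \<open>D > 0\<close> \<open>\<And>n. P n \<ge> 0\<close> by (intro set_lebesgue_integral_cong) (auto simp: F_def abs_mult)
    also have "\<dots> = c * Q n" by (simp only: set_integral_mult_right mom(2) tp c_def PQ[symmetric]) simp
    finally show ?thesis .
  qed
  let ?u = "bessel_sq_coeff \<nu> (a * b)" and ?v = "\<lambda>s m. s ^ m / fact m :: real"
  have u_nonneg: "?u m \<ge> 0" for m using G ab by (auto simp: bessel_sq_coeff_def intro!: divide_nonneg_pos)
  have u: "summable (\<lambda>m. norm (?u m))" "summable (\<lambda>m. norm ((-1) ^ m * ?u m))"
    using bessel_sq_coeff_sums[OF \<nu>, of "a * b"] u_nonneg by (auto simp: abs_mult sums_iff)
  have v: "summable (\<lambda>m. norm (?v s m))" "(\<Sum>m. ?v s m) = exp s" for s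
    using summable_norm_exp[of s] by (auto simp: exp_def field_simps)
  have Q_sum: "summable Q" unfolding Q_def using summable_Cauchy_product[OF u(1) v(1)] .
  have "(\<lambda>n. \<Sum>m\<le>n. ((-1) ^ m * ?u m) * ?v (- (a + b)) (n - m)) sums ((\<Sum>m. (-1) ^ m * ?u m) * exp (- (a + b)))"
    unfolding v(2)[symmetric] by (rule Cauchy_product_sums[OF u(2) v(1)])
  also have "(\<lambda>n. \<Sum>m\<le>n. ((-1) ^ m * ?u m) * ?v (- (a + b)) (n - m)) = (\<lambda>n. (-1) ^ n * Q n)"
  proof
    fix n
    have "((-1) ^ m * ?u m) * ?v (- (a + b)) (n - m) = (-1) ^ n * (?u m * ?v (a + b) (n - m))" if "m \<le> n" for m
    proof -
      have "(-1::real) ^ n = (-1) ^ m * (-1) ^ (n - m)" using that by (simp add: power_add[symmetric])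
      moreover have "(- (a + b)) ^ (n - m) = (-1) ^ (n - m) * (a + b) ^ (n - m)" by (rule power_minus)
      ultimately show ?thesis by simp
    qed
    thus "(\<Sum>m\<le>n. ((-1) ^ m * ?u m) * ?v (- (a + b)) (n - m)) = (-1) ^ n * Q n"
      unfolding Q_def sum_distrib_left by (intro sum.cong) auto
  qed
  also have "(\<Sum>m. (-1) ^ m * ?u m) = bessel_clifford \<nu> (a * b)"
  proof -
    have "(\<lambda>m. (-1) ^ m * ?u m) = ?u" by (auto simp: bessel_sq_coeff_def fun_eq_iff)
    thus ?thesis using bessel_sq_coeff_sums[OF \<nu>, of "a * b"] by (simp add: sums_iff)
  qed
  finally have Q_alt: "(\<lambda>n. c * ((-1) ^ n * Q n)) sums (c * (bessel_clifford \<nu> (a * b) * exp (- (a + b))))"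
    by (rule sums_mult)
  have heat: "c * (bessel_clifford \<nu> (a * b) * exp (- (a + b))) = bessel_heat \<nu> t x y"
  proof -
    have h1: "(x * y / (2 * t) / 2) powr \<nu> = (x * y / 4) powr \<nu> / t powr \<nu>"
      using pos by (simp add: powr_divide[symmetric])
    have h2: "(x * y / (2 * t))\<^sup>2 / 4 = a * b" by (simp add: a_def b_def \<alpha>_def \<beta>_def power_divide power_mult_distrib power2_eq_square)
    have h3: "- ((x\<^sup>2 + y\<^sup>2) / (4 * t)) = - (a + b)" using pos by (simp add: a_def b_def \<alpha>_def \<beta>_def field_simps)
    have h4: "t powr (\<nu> + 1) = t powr \<nu> * t" using pos by (simp add: powr_add)
    have h5: "x * y / (2 * t) > 0" using pos by simp
    show ?thesis unfolding bessel_heat_def bessel_I_eq[OF \<nu> h5] h1 h2 h3 c_def D_def h4 by (simp add: mult_ac)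
  qed
  define H where "H n z = indicator {0<..} z *\<^sub>R F n z" for n z
  have H: "integrable lborel (H n)" for n using FI unfolding H_def set_integrable_def .
  have H_abs: "AE z in lborel. summable (\<lambda>n. norm (H n z))"
    using abs_series by (intro AE_I2) (auto simp: H_def indicator_def)
  have H_norm: "summable (\<lambda>n. \<integral>z. norm (H n z) \<partial>lborel)"
  proof -
    have "(\<integral>z. norm (H n z) \<partial>lborel) = c * Q n" for n
      unfolding F_norm_int[symmetric] set_lebesgue_integral_def H_def by (simp add: abs_mult)
    thus ?thesis using summable_mult[OF Q_sum] by simp
  qed
  have sumH: "(\<Sum>n. H n z) = indicator {0<..} z *\<^sub>R (exp (- (t * z\<^sup>2)) * (bessel_wave \<nu> (x * z) * bessel_wave \<nu> (y * z)))" for z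
    using series[of z] by (auto simp: H_def indicator_def sums_iff)
  have "integrable lborel (\<lambda>z. \<Sum>n. H n z)" by (rule integrable_suminf[OF H H_abs H_norm])
  thus "set_integrable lborel {0<..} (\<lambda>z. exp (- (t * z\<^sup>2)) * (bessel_wave \<nu> (x * z) * bessel_wave \<nu> (y * z)))"
    unfolding set_integrable_def sumH .
  have "(\<lambda>n. integral\<^sup>L lborel (H n)) sums (\<integral>z. (\<Sum>n. H n z) \<partial>lborel)" by (rule sums_integral[OF H H_abs H_norm])
  moreover have "integral\<^sup>L lborel (H n) = c * ((-1) ^ n * Q n)" for n
    unfolding F_int[symmetric] set_lebesgue_integral_def H_def ..
  ultimately have "(\<integral>z. (\<Sum>n. H n z) \<partial>lborel) = bessel_heat \<nu> t x y"
    using Q_alt unfolding heat by (simp add: sums_iff)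
  thus "(LINT z:{0<..}|lborel. exp (- (t * z\<^sup>2)) * (bessel_wave \<nu> (x * z) * bessel_wave \<nu> (y * z))) = bessel_heat \<nu> t x y"
    unfolding set_lebesgue_integral_def sumH .
qed

section \<open>Asymptotics of the modified Bessel function\<close>

lemma cosh_borel_measurable [measurable]: "(cosh :: real \<Rightarrow> real) \<in> borel_measurable borel"
  by (intro borel_measurable_continuous_onI continuous_intros)

lemma Gamma_half_over_fact: "Gamma (real k + 1/2) / fact (2 * k) = sqrt pi / (4 ^ k * fact k)"
proof (induction k)
  case 0 show ?case by (simp add: Gamma_one_half_real)
next
  case (Suc k)
  have "real k + 1/2 \<notin> \<int>\<^sub>\<le>\<^sub>0" using nonpos_Ints_nonpos[of "real k + 1/2"] by force
  hence "Gamma (real (Suc k) + 1/2) = (real k + 1/2) * Gamma (real k + 1/2)"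
    using Gamma_plus1[of "real k + 1/2"] by (simp add: add_ac)
  hence "Gamma (real (Suc k) + 1/2) / fact (2 * Suc k) = 
     (real k + 1/2) / ((2 * real k + 2) * (2 * real k + 1)) * (Gamma (real k + 1/2) / fact (2 * k))"
    by (simp add: add_ac mult_ac)
  also have "\<dots> = 1 / (4 * (real k + 1)) * (sqrt pi / (4 ^ k * fact k))"
    unfolding Suc.IH by (simp add: divide_simps) (simp add: algebra_simps)
  also have "\<dots> = sqrt pi / (4 ^ Suc k * fact (Suc k))" by (simp add: field_simps)
  finally show ?case .
qed

text \<open>Poisson's integral representation of \<open>I\<close>: the series of \<open>cosh\<close> is integrated term by term, and
each term is a Beta integral.\<close>
lemma Poisson_integral_cosh_sqrt:
  assumes p: "p > 0" and z: "z \<ge> (0::real)"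
  shows "(\<integral>\<^sup>+s. ennreal (indicator {0..1} s * (cosh (z * sqrt s) * s powr (-1/2) * (1 - s) powr (p - 1))) \<partial>lborel)
     = ennreal (sqrt pi * Gamma p * bessel_clifford (p - 1/2) (z\<^sup>2 / 4))"
proof -
  define f where "f k s = z ^ (2 * k) / fact (2 * k) * (indicator {0..1} s * (s powr (real k + 1/2 - 1) * (1 - s) powr (p - 1)))" for k s
  have [measurable]: "f k \<in> borel_measurable borel" for k unfolding f_def by measurable
  have f_nonneg: "f k s \<ge> 0" for k s using z by (simp add: f_def)
  have sums: "(\<lambda>k. f k s) sums (indicator {0..1} s * (cosh (z * sqrt s) * s powr (-1/2) * (1 - s) powr (p - 1)))" for s
  proof (cases "s \<in> {0<..1}")
    case True
    have "(\<lambda>k. (\<lambda>n. if even n then (z * sqrt s) ^ n /\<^sub>R fact n else 0) (2 * k)) sums cosh (z * sqrt s)"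
      by (subst sums_mono_reindex) (auto simp: strict_mono_def image_iff cosh_converges elim!: evenE)
    hence "(\<lambda>k. (z * sqrt s) ^ (2 * k) / fact (2 * k)) sums cosh (z * sqrt s)"
      by (simp add: divide_inverse mult.commute)
    hence "(\<lambda>k. (z * sqrt s) ^ (2 * k) / fact (2 * k) * (s powr (-1/2) * (1 - s) powr (p - 1))) sums
       (cosh (z * sqrt s) * (s powr (-1/2) * (1 - s) powr (p - 1)))" by (rule sums_mult2)
    also have "(\<lambda>k. (z * sqrt s) ^ (2 * k) / fact (2 * k) * (s powr (-1/2) * (1 - s) powr (p - 1))) = (\<lambda>k. f k s)"
    proof
      fix k
      have "(z * sqrt s) ^ (2 * k) = z ^ (2 * k) * s ^ k" using True by (simp add: power_mult_distrib power_mult)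
      moreover have "s powr (real k + 1/2 - 1) = s ^ k * s powr (-1/2)"
        using True powr_add[of s "real k" "-1/2"] by (simp add: powr_realpow)
      ultimately show "(z * sqrt s) ^ (2 * k) / fact (2 * k) * (s powr (-1/2) * (1 - s) powr (p - 1)) = f k s"
        using True by (simp add: f_def)
    qed
    finally show ?thesis using True by (simp add: mult_ac)
  next
    case False
    thus ?thesis by (cases "s = 0") (auto simp: f_def)
  qed
  have each: "(\<integral>\<^sup>+s. ennreal (f k s) \<partial>lborel) = ennreal (sqrt pi * Gamma p * ((z\<^sup>2 / 4) ^ k / (fact k * Gamma (p - 1/2 + real k + 1))))" for k
  proof -
    have "(\<integral>\<^sup>+s. ennreal (f k s) \<partial>lborel) = ennreal (z ^ (2 * k) / fact (2 * k)) *
       (\<integral>\<^sup>+s. ennreal (indicator {0..1} s * (s powr (real k + 1/2 - 1) * (1 - s) powr (p - 1))) \<partial>lborel)"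
      unfolding f_def using z by (subst nn_integral_cmult[symmetric]) (auto simp: ennreal_mult'[symmetric] simp del: times_divide_eq_left)
    also have "\<dots> = ennreal (z ^ (2 * k) / fact (2 * k)) * ennreal (Beta (real k + 1/2) p)"
      using p by (subst nn_integral_has_integral_lebesgue[OF _ has_integral_Beta_real]) auto
    also have "\<dots> = ennreal (z ^ (2 * k) / fact (2 * k) * Beta (real k + 1/2) p)"
      using z by (subst ennreal_mult'[symmetric]) auto
    also have "z ^ (2 * k) / fact (2 * k) * Beta (real k + 1/2) p = 
       z ^ (2 * k) * (Gamma (real k + 1/2) / fact (2 * k)) * Gamma p / Gamma (p - 1/2 + real k + 1)"
      by (simp add: Beta_def add_ac)
    also have "\<dots> = sqrt pi * Gamma p * ((z\<^sup>2 / 4) ^ k / (fact k * Gamma (p - 1/2 + real k + 1)))"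
      unfolding Gamma_half_over_fact power_mult[of z 2 k] by (simp add: power_divide mult_ac)
    finally show ?thesis .
  qed
  have "(\<integral>\<^sup>+s. ennreal (indicator {0..1} s * (cosh (z * sqrt s) * s powr (-1/2) * (1 - s) powr (p - 1))) \<partial>lborel)
     = (\<integral>\<^sup>+s. (\<Sum>k. ennreal (f k s)) \<partial>lborel)"
  proof (rule nn_integral_cong)
    fix s
    have "(\<Sum>k. ennreal (f k s)) = ennreal (\<Sum>k. f k s)"
      by (rule suminf_ennreal2[OF f_nonneg sums_summable[OF sums]])
    also have "(\<Sum>k. f k s) = indicator {0..1} s * (cosh (z * sqrt s) * s powr (-1/2) * (1 - s) powr (p - 1))"
      by (rule sums_unique[OF sums, symmetric])
    finally show "ennreal (indicator {0..1} s * (cosh (z * sqrt s) * s powr (-1/2) * (1 - s) powr (p - 1))) = (\<Sum>k. ennreal (f k s))" ..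
  qed
  also have "\<dots> = (\<Sum>k. \<integral>\<^sup>+s. ennreal (f k s) \<partial>lborel)"
    by (rule nn_integral_suminf) simp
  also have "\<dots> = (\<Sum>k. ennreal (sqrt pi * Gamma p * ((z\<^sup>2 / 4) ^ k / (fact k * Gamma (p - 1/2 + real k + 1)))))"
    by (simp only: each)
  also have "(\<Sum>k. ennreal (sqrt pi * Gamma p * ((z\<^sup>2 / 4) ^ k / (fact k * Gamma (p - 1/2 + real k + 1)))))
     = ennreal (\<Sum>k. sqrt pi * Gamma p * ((z\<^sup>2 / 4) ^ k / (fact k * Gamma (p - 1/2 + real k + 1))))"
    using p summable_bessel_clifford[of "p - 1/2" "z\<^sup>2 / 4"]
    by (intro suminf_ennreal2 summable_mult) (auto intro!: mult_nonneg_nonneg divide_nonneg_nonneg less_imp_le[OF Gamma_real_pos])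
  also have "(\<Sum>k. sqrt pi * Gamma p * ((z\<^sup>2 / 4) ^ k / (fact k * Gamma (p - 1/2 + real k + 1))))
      = sqrt pi * Gamma p * bessel_clifford (p - 1/2) (z\<^sup>2 / 4)"
    unfolding bessel_clifford_def using p by (intro suminf_mult summable_bessel_clifford) auto
  finally show ?thesis .
qed

text \<open>The substitution \<open>s = (1 - r)\<^sup>2\<close> moves the maximum of \<open>cosh\<close> to \<open>r = 0\<close>, where Laplace's method
applies.\<close>
lemma Poisson_integral:
  assumes p: "p > 0" and z: "z \<ge> (0::real)"
  shows "(\<integral>\<^sup>+r. ennreal (indicator {0..1} r * (2 * cosh (z * (1 - r)) * (r * (2 - r)) powr (p - 1))) \<partial>lborel)
     = ennreal (sqrt pi * Gamma p * bessel_clifford (p - 1/2) (z\<^sup>2 / 4))"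
proof -
  define h where "h s = cosh (z * sqrt s) * s powr (-1/2) * (1 - s) powr (p - 1)" for s
  have [measurable]: "h \<in> borel_measurable borel" unfolding h_def by measurable
  define k where "k t = indicator {0..1} t * (2 * cosh (z * t) * (1 - t\<^sup>2) powr (p - 1))" for t
  have [measurable]: "k \<in> borel_measurable borel" unfolding k_def by measurable
  have "ennreal (sqrt pi * Gamma p * bessel_clifford (p - 1/2) (z\<^sup>2 / 4)) = (\<integral>\<^sup>+s. ennreal (indicator {0..1} s * h s) \<partial>lborel)"
    unfolding h_def using Poisson_integral_cosh_sqrt[OF assms] by simp
  also have "\<dots> = (\<integral>\<^sup>+s. h s * indicator {0\<^sup>2..1\<^sup>2} s \<partial>lborel)"
    by (intro nn_integral_cong) (auto simp: indicator_def)
  also have "\<dots> = (\<integral>\<^sup>+t. h (t\<^sup>2) * (2 * t) * indicator {0..1} t \<partial>lborel)"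
    by (rule nn_integral_substitution)
       (auto intro!: derivative_eq_intros continuous_intros simp: set_borel_measurable_def)
  also have "\<dots> = (\<integral>\<^sup>+t. ennreal (k t) \<partial>lborel)"
  proof (rule nn_integral_cong_AE, rule AE_mp[OF AE_lborel_singleton[of 0] AE_I2], rule impI)
    fix t :: real assume "t \<noteq> 0"
    show "ennreal (h (t\<^sup>2) * (2 * t) * indicator {0..1} t) = ennreal (k t)"
    proof (cases "t \<in> {0..1}")
      case True
      with \<open>t \<noteq> 0\<close> have "t > 0" by simp
      hence "(t\<^sup>2) powr (-1/2) = 1 / t"
        by (simp add: powr_minus powr_half_sqrt inverse_eq_divide)
      with True \<open>t > 0\<close> show ?thesis by (simp add: h_def k_def)
    qed (simp add: k_def)
  qed
  also have "\<dots> = ennreal \<bar>-1\<bar> * (\<integral>\<^sup>+r. ennreal (k (1 + (-1) * r)) \<partial>lborel)"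
    by (rule nn_integral_real_affine) auto
  also have "\<dots> = (\<integral>\<^sup>+r. ennreal (indicator {0..1} r * (2 * cosh (z * (1 - r)) * (r * (2 - r)) powr (p - 1))) \<partial>lborel)"
  proof -
    have "k (1 + (-1) * r) = indicator {0..1} r * (2 * cosh (z * (1 - r)) * (r * (2 - r)) powr (p - 1))" for r
    proof -
      have "1 - (1 - r)\<^sup>2 = r * (2 - r)" by (simp add: power2_eq_square algebra_simps)
      moreover have "1 - r \<in> {0..1} \<longleftrightarrow> r \<in> {0..1}" by auto
      ultimately show ?thesis by (simp add: k_def indicator_def del: atLeastAtMost_iff)
    qed
    thus ?thesis by simp
  qed
  finally show ?thesis ..
qed

text \<open>\<open>I\<close> divided by its leading term \<open>exp z / sqrt (2 \<pi> z)\<close> at infinity. By \<open>bessel_heat_eq\<close> below it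
is also the quotient of the Bessel heat kernel by the Euclidean one.\<close>
definition bessel_ratio :: "real \<Rightarrow> real \<Rightarrow> real" where
  "bessel_ratio \<nu> z = sqrt (2 * pi * z) * exp (- z) * bessel_I \<nu> z"

lemma bessel_ratio_measurable [measurable]: "bessel_ratio \<nu> \<in> borel_measurable borel"
  unfolding bessel_ratio_def[abs_def] by measurable

lemma bessel_ratio_eq:
  assumes "p > 0" "z > 0"
  shows "bessel_ratio (p - 1/2) z = 2 powr (1 - p) * z powr p * exp (- z) * (sqrt pi * bessel_clifford (p - 1/2) (z\<^sup>2 / 4))"
proof -
  have "sqrt 2 * sqrt z * (z / 2) powr (p - 1/2) = 2 powr (1 - p) * z powr p"
  proof -
    have "2 powr (1 - p) = sqrt 2 / 2 powr (p - 1/2)"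
      by (simp add: powr_half_sqrt[symmetric] powr_diff[symmetric])
    moreover have "z powr p = sqrt z * z powr (p - 1/2)"
      using assms powr_add[of z "1/2" "p - 1/2"] by (simp add: powr_half_sqrt)
    ultimately show ?thesis using assms by (simp only: powr_divide) (simp add: powr_divide)
  qed
  hence "sqrt (2 * pi * z) * (z / 2) powr (p - 1/2) = 2 powr (1 - p) * z powr p * sqrt pi"
    by (simp add: real_sqrt_mult mult_ac)
  thus ?thesis using assms by (simp add: bessel_ratio_def bessel_I_eq mult_ac)
qed

lemma bessel_ratio_integral:
  assumes p: "p > 0" and z: "z > (0::real)"
  defines "h \<equiv> \<lambda>r. (exp (- (z * r)) + exp (- (z * (2 - r)))) * r powr (p - 1) * (1 - r / 2) powr (p - 1)"
  shows "set_integrable lborel {0..1} h"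
    and "(LINT r:{0..1}|lborel. h r) = Gamma p * z powr (- p) * bessel_ratio (p - 1/2) z"
proof -
  have [measurable]: "h \<in> borel_measurable borel" unfolding h_def by measurable
  define c where "c = 2 powr (1 - p) * exp (- z)"
  have c: "c > 0" by (simp add: c_def)
  have eq: "h r = c * (2 * cosh (z * (1 - r)) * (r * (2 - r)) powr (p - 1))" if "r \<in> {0..1}" for r
  proof -
    have "(2 - r) powr (p - 1) = 2 powr (p - 1) * (1 - r / 2) powr (p - 1)"
      using that powr_mult[of 2 "1 - r / 2" "p - 1"] by (simp add: right_diff_distrib)
    moreover have "2 powr (1 - p) * 2 powr (p - 1) = (1::real)" by (simp add: powr_add[symmetric])
    moreover have "exp (- z) * (2 * cosh (z * (1 - r))) = exp (- (z * r)) + exp (- (z * (2 - r)))"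
      by (simp add: cosh_def algebra_simps mult_exp_exp)
    moreover have "c * (2 * cosh (z * (1 - r)) * (r * (2 - r)) powr (p - 1))
       = (exp (- z) * (2 * cosh (z * (1 - r)))) * (2 powr (1 - p) * (2 - r) powr (p - 1)) * r powr (p - 1)"
      using that by (simp add: c_def powr_mult mult_ac)
    ultimately show ?thesis by (simp add: h_def mult_ac)
  qed
  have "(\<integral>\<^sup>+r. ennreal (indicator {0..1} r * h r) \<partial>lborel)
     = (\<integral>\<^sup>+r. ennreal c * ennreal (indicator {0..1} r * (2 * cosh (z * (1 - r)) * (r * (2 - r)) powr (p - 1))) \<partial>lborel)"
    by (intro nn_integral_cong) (use c eq in \<open>auto simp: indicator_def ennreal_mult'[symmetric]\<close>)
  also have "\<dots> = ennreal c * ennreal (sqrt pi * Gamma p * bessel_clifford (p - 1/2) (z\<^sup>2 / 4))"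
    using assms by (subst nn_integral_cmult) (auto simp: Poisson_integral)
  also have "\<dots> = ennreal (c * (sqrt pi * Gamma p * bessel_clifford (p - 1/2) (z\<^sup>2 / 4)))"
    using c by (simp add: ennreal_mult')
  also have "c * (sqrt pi * Gamma p * bessel_clifford (p - 1/2) (z\<^sup>2 / 4)) = Gamma p * z powr (- p) * bessel_ratio (p - 1/2) z"
    unfolding bessel_ratio_eq[OF p z] c_def using z by (simp add: powr_minus)
  finally have *: "(\<integral>\<^sup>+r. ennreal (indicator {0..1} r * h r) \<partial>lborel) = ennreal (Gamma p * z powr (- p) * bessel_ratio (p - 1/2) z)" .
  have nn: "Gamma p * z powr (- p) * bessel_ratio (p - 1/2) z \<ge> 0"
    using assms bessel_clifford_nonneg[of "p - 1/2" "z\<^sup>2 / 4"] by (simp add: bessel_ratio_eq Gamma_real_pos less_imp_le)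
  show "set_integrable lborel {0..1} h" "(LINT r:{0..1}|lborel. h r) = Gamma p * z powr (- p) * bessel_ratio (p - 1/2) z"
    by (rule set_integral_eqI_nn_integral[OF _ _ _ nn *]; simp add: h_def)+
qed

lemma one_minus_half_powr_bound:
  fixes q :: real
  obtains C where "C > 0" "\<And>r. 0 \<le> r \<Longrightarrow> r \<le> 1 \<Longrightarrow> \<bar>(1 - r / 2) powr q - 1\<bar> \<le> C * r"
proof -
  define B where "B = 1 + 2 powr (1 - q)"
  have "B > 0" by (simp add: B_def add_pos_pos)
  have B: "u powr (q - 1) \<le> B" if "1/2 \<le> u" "u \<le> 1" for u
  proof (cases "q \<ge> 1")
    case True
    hence "u powr (q - 1) \<le> 1" using that by (intro powr_le1) auto
    thus ?thesis using powr_gt_zero[of 2 "1 - q"] unfolding B_def by linarith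
  next
    case False
    hence "u powr (q - 1) \<le> (1/2) powr (q - 1)" using that by (intro powr_mono2') auto
    also have "(1/2) powr (q - 1) = 2 powr (1 - q)" by (simp add: powr_divide powr_diff)
    finally show ?thesis unfolding B_def by linarith
  qed
  show ?thesis
  proof (rule that[of "(\<bar>q\<bar> + 1) * B"])
    show "(\<bar>q\<bar> + 1) * B > 0" using \<open>B > 0\<close> by (simp add: add_nonneg_pos)
    fix r :: real assume r: "0 \<le> r" "r \<le> 1"
    show "\<bar>(1 - r / 2) powr q - 1\<bar> \<le> (\<bar>q\<bar> + 1) * B * r"
    proof (cases "r = 0")
      case False
      hence "0 < r" using r by simp
      have "\<exists>\<xi>. 0 < \<xi> \<and> \<xi> < r \<and> (1 - r / 2) powr q - (1 - 0 / 2) powr q = (r - 0) * (q * (1 - \<xi> / 2) powr (q - 1) * (- 1 / 2))"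
        by (rule MVT2[OF \<open>0 < r\<close>]) (use r in \<open>auto intro!: derivative_eq_intros\<close>)
      then obtain \<xi> where \<xi>: "0 < \<xi>" "\<xi> < r" "(1 - r / 2) powr q - 1 = r * (q * (1 - \<xi> / 2) powr (q - 1) * (- 1 / 2))"
        by auto
      have "\<bar>(1 - r / 2) powr q - 1\<bar> = r * (\<bar>q\<bar> / 2 * (1 - \<xi> / 2) powr (q - 1))"
        unfolding \<xi>(3) using r by (simp add: abs_mult)
      also have "\<dots> \<le> r * ((\<bar>q\<bar> + 1) * B)"
        using \<xi> r \<open>B > 0\<close> by (intro mult_left_mono mult_mono B) auto
      finally show ?thesis by (simp add: mult_ac)
    qed simp
  qed
qed

lemma powr_le_powr_mult_exp:
  assumes "q > 0" "z > (0::real)"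
  shows "z powr q \<le> q powr q * exp z"
proof -
  have "z / q \<le> exp (z / q)" using exp_ge_add_one_self[of "z / q"] by linarith
  hence "(z / q) powr q \<le> exp (z / q) powr q" using assms by (intro powr_mono2) auto
  thus ?thesis using assms by (simp add: powr_divide exp_powr_real field_simps)
qed

text \<open>Laplace's method. With \<open>p = \<nu> + 1/2\<close>, both 1 and the ratio are \<open>z powr p / Gamma p\<close> times an
integral. For 1 the integrand is \<open>exp (- z r) * r powr (p - 1)\<close> on \<open>(0, \<infinity>)\<close>. For the ratio it
is cut off at \<open>r = 1\<close>, has the additional factor \<open>(1 - r / 2) powr (p - 1)\<close>, which is \<open>1 + O(r)\<close>,
and an additional term of size \<open>exp (- z)\<close>. A factor \<open>r\<close> in the integrand gains \<open>1 / z\<close>. The rate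
is stated as \<open>1 / sqrt z\<close> so that it also holds for small \<open>z\<close>, where only boundedness is
available.\<close>
lemma bessel_ratio_bounds:
  assumes "\<nu> > - (1/2)"
  obtains C where "C > 0" "\<And>z. z > 0 \<Longrightarrow> \<bar>bessel_ratio \<nu> z\<bar> \<le> C" "\<And>z. z > 0 \<Longrightarrow> \<bar>bessel_ratio \<nu> z - 1\<bar> \<le> C / sqrt z"
proof -
  define p where "p = \<nu> + 1/2"
  have p: "p > 0" and \<nu>: "\<nu> = p - 1/2" using assms by (auto simp: p_def)
  let ?M = "bessel_ratio \<nu>"
  obtain A where A: "A > 0" "\<And>r. 0 \<le> r \<Longrightarrow> r \<le> 1 \<Longrightarrow> \<bar>(1 - r / 2) powr (p - 1) - 1\<bar> \<le> A * r"
    using one_minus_half_powr_bound[of "p - 1"] by blast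
  have Gp: "Gamma p > 0" "Gamma (p + 1) > 0" using p by auto
  define B where "B = ((A + 1) * Gamma (p + 1) + (1 + A) * (p + 1) powr (p + 1) / p) / Gamma p"
  have "B > 0" unfolding B_def using A Gp p by (intro divide_pos_pos add_pos_nonneg mult_pos_pos) auto
  have large: "\<bar>?M z - 1\<bar> \<le> B / z" if z: "z > 0" for z
  proof -
    define g where "g r = exp (- (z * r)) * r powr (p - 1)" for r
    define h where "h r = (exp (- (z * r)) + exp (- (z * (2 - r)))) * r powr (p - 1) * (1 - r / 2) powr (p - 1)" for r
    define D where "D r = indicator {0..1} r *\<^sub>R h r - indicator {0<..} r *\<^sub>R g r" for r
    \<comment> \<open>a majorant of the difference of the two integrands: one factor \<open>r\<close> more, plus the exponentially small term\<close>
    define E where "E r = (A + 1) * (indicator {0<..} r *\<^sub>R (exp (- (z * r)) * r powr (p + 1 - 1)))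
       + (1 + A) * exp (- z) * (indicator {0..1} r *\<^sub>R (r powr (p - 1) * (1 - r) powr (1 - 1)))" for r
    have h: "set_integrable lborel {0..1} h" "(LINT r:{0..1}|lborel. h r) = Gamma p * z powr (- p) * ?M z"
      using bessel_ratio_integral[OF p z] unfolding \<nu> h_def by auto
    have g: "set_integrable lborel {0<..} g" "(LINT r:{0<..}|lborel. g r) = Gamma p * z powr (- p)"
      using set_integrable_Gamma_scaled[OF p z] set_integral_Gamma_scaled[OF p z] unfolding g_def by auto
    have D: "integrable lborel D" "(\<integral>r. D r \<partial>lborel) = Gamma p * z powr (- p) * ?M z - Gamma p * z powr (- p)"
      using h g by (auto simp: D_def[abs_def] set_integrable_def set_lebesgue_integral_def)
    have gam: "set_integrable lborel {0<..} (\<lambda>r. exp (- (z * r)) * r powr (p + 1 - 1))"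
      "(LINT r:{0<..}|lborel. exp (- (z * r)) * r powr (p + 1 - 1)) = Gamma (p + 1) * z powr (- (p + 1))"
      using set_integrable_Gamma_scaled[of "p + 1" z] set_integral_Gamma_scaled[of "p + 1" z] p z by auto
    have bet: "set_integrable lborel {0..1} (\<lambda>r. r powr (p - 1) * (1 - r) powr (1 - 1))"
      "(LINT r:{0..1}|lborel. r powr (p - 1) * (1 - r) powr (1 - 1)) = 1 / p"
    proof -
      show I: "set_integrable lborel {0..1} (\<lambda>r. r powr (p - 1) * (1 - r) powr (1 - 1))"
        using p by (intro integrable_Beta) auto
      have "(LINT r:{0..1}|lborel. r powr (p - 1) * (1 - r) powr (1 - 1)) = Beta p 1"
        using set_borel_integral_eq_integral(2)[OF I] has_integral_Beta_real[of p 1] p by (simp add: integral_unique)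
      also have "\<dots> = 1 / p" 
      proof -
        have "p \<notin> \<int>\<^sub>\<le>\<^sub>0" using nonpos_Ints_nonpos[of p] p by force
        from Gamma_plus1[OF this] show ?thesis
          using \<open>p \<notin> \<int>\<^sub>\<le>\<^sub>0\<close> p by (simp add: Beta_def Gamma_eq_zero_iff)
      qed
      finally show "(LINT r:{0..1}|lborel. r powr (p - 1) * (1 - r) powr (1 - 1)) = 1 / p" .
    qed
    have E: "integrable lborel E" "(\<integral>r. E r \<partial>lborel) = (A + 1) * (Gamma (p + 1) * z powr (- (p + 1))) + (1 + A) * exp (- z) * (1 / p)"
    proof -
      have i1: "integrable lborel (\<lambda>r. (A + 1) * (indicator {0<..} r *\<^sub>R (exp (- (z * r)) * r powr (p + 1 - 1))))"
        using gam(1) unfolding set_integrable_def by (rule integrable_mult_right)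
      have i2: "integrable lborel (\<lambda>r. (1 + A) * exp (- z) * (indicator {0..1} r *\<^sub>R (r powr (p - 1) * (1 - r) powr (1 - 1))))"
        using bet(1) unfolding set_integrable_def by (rule integrable_mult_right)
      note i = i1 i2
      show "integrable lborel E" unfolding E_def[abs_def] using i by (rule Bochner_Integration.integrable_add)
      show "(\<integral>r. E r \<partial>lborel) = (A + 1) * (Gamma (p + 1) * z powr (- (p + 1))) + (1 + A) * exp (- z) * (1 / p)"
        unfolding E_def Bochner_Integration.integral_add[OF i] integral_mult_right_zero
        using gam(2) bet(2) unfolding set_lebesgue_integral_def by simp
    qed
    have "\<bar>D r\<bar> \<le> E r" if "r \<noteq> 1" for r
    proof -
      consider "r \<le> 0" | "0 < r" "r < 1" | "r > 1" using \<open>r \<noteq> 1\<close> by linarith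
      thus ?thesis
      proof cases
        case 1
        thus ?thesis using A by (cases "r = 0") (auto simp: D_def E_def h_def)
      next
        case 2
        define w where "w = (1 - r / 2) powr (p - 1)"
        have w: "\<bar>w - 1\<bar> \<le> A * r" unfolding w_def using 2 by (intro A) auto
        have "A * r \<le> A * 1" using A 2 by (intro mult_left_mono) auto
        hence w1: "w \<le> 1 + A" "0 \<le> w" using w by (auto simp: w_def)
        have "D r = exp (- (z * r)) * r powr (p - 1) * (w - 1) + exp (- (z * (2 - r))) * r powr (p - 1) * w"
          using 2 by (simp add: D_def h_def g_def w_def algebra_simps)
        also have "\<bar>\<dots>\<bar> \<le> \<bar>exp (- (z * r)) * r powr (p - 1) * (w - 1)\<bar> + \<bar>exp (- (z * (2 - r))) * r powr (p - 1) * w\<bar>"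
          by (rule abs_triangle_ineq)
        also have "\<bar>exp (- (z * r)) * r powr (p - 1) * (w - 1)\<bar> = exp (- (z * r)) * r powr (p - 1) * \<bar>w - 1\<bar>"
          by (simp add: abs_mult)
        also have "\<dots> \<le> exp (- (z * r)) * r powr (p - 1) * (A * r)"
          using w by (intro mult_left_mono) auto
        also have "\<dots> = A * (exp (- (z * r)) * r powr p)"
          using 2 by (simp add: powr_diff)
        also have "\<dots> \<le> (A + 1) * (exp (- (z * r)) * r powr p)" by (intro mult_right_mono) auto
        also have "\<bar>exp (- (z * (2 - r))) * r powr (p - 1) * w\<bar> = exp (- (z * (2 - r))) * r powr (p - 1) * w"
          using w1 by (simp add: abs_mult)
        also have "\<dots> \<le> exp (- z) * r powr (p - 1) * (1 + A)"
          using w1 2 z mult_left_mono[of 1 "2 - r" z] by (intro mult_mono mult_nonneg_nonneg) auto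
        finally show ?thesis using 2 by (simp add: E_def mult_ac)
      next
        case 3
        have "exp (- (z * r)) * r powr (p - 1) \<le> exp (- (z * r)) * r powr p"
          using 3 by (intro mult_left_mono powr_mono) auto
        also have "\<dots> \<le> (A + 1) * (exp (- (z * r)) * r powr p)"
          using mult_right_mono[of 1 "A + 1" "exp (- (z * r)) * r powr p"] A(1) by simp
        finally show ?thesis using 3 by (simp add: D_def E_def g_def)
      qed
    qed
    hence AE: "AE r in lborel. norm (D r) \<le> E r" using AE_lborel_singleton[of 1] by auto
    have "\<bar>\<integral>r. D r \<partial>lborel\<bar> \<le> (\<integral>r. norm (D r) \<partial>lborel)"
      using integral_norm_bound[of lborel D] by simp
    also have "\<dots> \<le> (\<integral>r. E r \<partial>lborel)" using D(1) E(1) AE by (intro integral_mono_AE) auto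
    finally have D_le: "\<bar>Gamma p * z powr (- p) * (?M z - 1)\<bar> \<le> (A + 1) * (Gamma (p + 1) * z powr (- (p + 1))) + (1 + A) * exp (- z) * (1 / p)"
      unfolding D E by (simp add: algebra_simps)
    have "exp (- z) \<le> q powr q * z powr (- q)" if "q > 0" for q
      using powr_le_powr_mult_exp[OF that z] z by (simp add: powr_minus exp_minus field_simps)
    from this[of "p + 1"] p have "exp (- z) \<le> (p + 1) powr (p + 1) * z powr (- (p + 1))" by simp
    hence "(1 + A) * exp (- z) * (1 / p) \<le> (1 + A) * ((p + 1) powr (p + 1) * z powr (- (p + 1))) * (1 / p)"
      using A p by (intro mult_right_mono mult_left_mono) auto
    with D_le have "\<bar>Gamma p * z powr (- p) * (?M z - 1)\<bar> \<le> (A + 1) * (Gamma (p + 1) * z powr (- (p + 1)))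
        + (1 + A) * ((p + 1) powr (p + 1) * z powr (- (p + 1))) * (1 / p)" by linarith
    also have "\<dots> = (Gamma p * z powr (- p)) * (B / z)"
    proof -
      have "z powr (- (p + 1)) = z powr (- p) / z" 
      proof -
        have "- (p + 1) = - p - 1" by simp
        thus ?thesis using z by (simp only: powr_diff) simp
      qed
      moreover have "(A + 1) * (G1 * (Z / z)) + (1 + A) * (Q * (Z / z)) * (1 / p) = G * Z * (((A + 1) * G1 + (1 + A) * Q / p) / G / z)"
        if "G > 0" for G G1 Q Z :: real
        using that p z by (simp add: field_simps)
      ultimately show ?thesis unfolding B_def using Gp(1) by (simp only:)
    qed
    finally have "Gamma p * z powr (- p) * \<bar>?M z - 1\<bar> \<le> (Gamma p * z powr (- p)) * (B / z)"
      using Gp by (simp add: abs_mult)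
    thus ?thesis by (subst (asm) mult_le_cancel_left_pos) (use Gp z in auto)
  qed
  define C0 where "C0 = 2 powr (1 - p) * (sqrt pi * bessel_clifford (p - 1/2) (1/4))"
  have "C0 \<ge> 0" unfolding C0_def using p by (intro mult_nonneg_nonneg bessel_clifford_nonneg) auto
  have bound: "\<bar>?M z\<bar> \<le> C0 + B + 1" if z: "z > 0" for z
  proof (cases "z \<ge> 1")
    case True
    have "B / z \<le> B" using True \<open>B > 0\<close> by (simp add: field_simps)
    with large[OF z] \<open>C0 \<ge> 0\<close> show ?thesis by linarith
  next
    case False
    have "\<bar>z\<^sup>2 / 4\<bar> \<le> 1/4" using False z by (simp add: power_le_one)
    from abs_bessel_clifford_le[OF _ this, of "p - 1/2"] 
    have b: "\<bar>bessel_clifford (p - 1/2) (z\<^sup>2 / 4)\<bar> \<le> bessel_clifford (p - 1/2) (1/4)" using p by simp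
    have "z powr p * exp (- z) \<le> 1 * 1" using False z p by (intro mult_mono powr_le1) auto
    hence "(z powr p * exp (- z)) * (2 powr (1 - p) * (sqrt pi * \<bar>bessel_clifford (p - 1/2) (z\<^sup>2 / 4)\<bar>)) \<le>
       1 * (2 powr (1 - p) * (sqrt pi * bessel_clifford (p - 1/2) (1/4)))"
      using b by (intro mult_mono mult_left_mono) auto
    hence "\<bar>?M z\<bar> \<le> C0" using z p by (simp add: \<nu> bessel_ratio_eq C0_def abs_mult mult_ac)
    thus ?thesis using \<open>B > 0\<close> by simp
  qed
  show ?thesis
  proof (rule that[of "C0 + B + 2"])
    show "C0 + B + 2 > 0" using \<open>C0 \<ge> 0\<close> \<open>B > 0\<close> by simp
    fix z :: real assume z: "z > 0"
    show "\<bar>?M z\<bar> \<le> C0 + B + 2" using bound[OF z] by simp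
    show "\<bar>?M z - 1\<bar> \<le> (C0 + B + 2) / sqrt z"
    proof (cases "z \<ge> 1")
      case True
      have "sqrt z * 1 \<le> sqrt z * sqrt z" using True by (intro mult_left_mono) auto
      hence "sqrt z \<le> z" using z by simp
      hence "B / z \<le> B / sqrt z" using z \<open>B > 0\<close> by (intro divide_left_mono) auto
      also have "\<dots> \<le> (C0 + B + 2) / sqrt z" using z \<open>C0 \<ge> 0\<close> by (intro divide_right_mono) auto
      finally show ?thesis using large[OF z] by linarith
    next
      case False
      have "\<bar>?M z - 1\<bar> \<le> C0 + B + 2" using bound[OF z] by linarith
      also have "\<dots> \<le> (C0 + B + 2) / sqrt z"
        using False z \<open>C0 \<ge> 0\<close> \<open>B > 0\<close> by (simp add: le_divide_eq mult_left_le)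
      finally show ?thesis .
    qed
  qed
qed

section \<open>Fubini's theorem and Gaussian bounds\<close>

text \<open>Tonelli's theorem for a majorant whose mass in the first variable is bounded uniformly in the
second one.\<close>
lemma set_integrable_prod_dominated:
  fixes F :: "real \<times> real \<Rightarrow> 'b::{banach, second_countable_topology}"
  assumes [measurable]: "S \<in> sets borel" "T \<in> sets borel"
    and F: "set_borel_measurable (lborel \<Otimes>\<^sub>M lborel) (S \<times> T) F"
    and [measurable]: "(\<lambda>(y, t). g t y) \<in> borel_measurable (borel \<Otimes>\<^sub>M borel)" "w \<in> borel_measurable borel"
    and bound: "\<And>y t. y \<in> S \<Longrightarrow> t \<in> T \<Longrightarrow> norm (F (y, t)) \<le> g t y * w t"
    and mass: "\<And>t. t \<in> T \<Longrightarrow> (\<integral>\<^sup>+y. ennreal (g t y) \<partial>lborel) \<le> ennreal K"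
    and w: "\<And>t. t \<in> T \<Longrightarrow> w t \<ge> 0" "set_integrable lborel T w"
  shows "set_integrable (lborel \<Otimes>\<^sub>M lborel) (S \<times> T) F"
  unfolding set_integrable_def
proof (rule integrableI_bounded)
  show "(\<lambda>x. indicator (S \<times> T) x *\<^sub>R F x) \<in> borel_measurable (lborel \<Otimes>\<^sub>M lborel)"
    using F unfolding set_borel_measurable_def .
  have [measurable]: "(\<lambda>p. ennreal (g (snd p) (fst p)) * ennreal (indicator T (snd p) * w (snd p))) \<in> borel_measurable (lborel \<Otimes>\<^sub>M lborel)"
    using assms(4) by (auto simp: case_prod_beta')
  have "(\<integral>\<^sup>+x. ennreal (norm (indicator (S \<times> T) x *\<^sub>R F x)) \<partial>(lborel \<Otimes>\<^sub>M lborel))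
     \<le> (\<integral>\<^sup>+p. ennreal (g (snd p) (fst p)) * ennreal (indicator T (snd p) * w (snd p)) \<partial>(lborel \<Otimes>\<^sub>M lborel))"
  proof (rule nn_integral_mono)
    fix x :: "real \<times> real"
    show "ennreal (norm (indicator (S \<times> T) x *\<^sub>R F x)) \<le> ennreal (g (snd x) (fst x)) * ennreal (indicator T (snd x) * w (snd x))"
    proof (cases "x \<in> S \<times> T")
      case True
      then obtain y t where x: "x = (y, t)" "y \<in> S" "t \<in> T" by auto
      have "ennreal (norm (F (y, t))) \<le> ennreal (g t y * w t)" using bound x by (intro ennreal_leI) auto
      also have "\<dots> = ennreal (g t y) * ennreal (w t)" using w(1)[of t] x by (simp add: ennreal_mult'')
      finally show ?thesis using x by simp
    qed simp
  qed
  also have "\<dots> = (\<integral>\<^sup>+t. (\<integral>\<^sup>+y. ennreal (g t y) * ennreal (indicator T t * w t) \<partial>lborel) \<partial>lborel)"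
    by (subst lborel_pair.nn_integral_snd[symmetric]) auto
  also have "\<dots> \<le> (\<integral>\<^sup>+t. ennreal K * ennreal (indicator T t * w t) \<partial>lborel)"
  proof (rule nn_integral_mono)
    fix t :: real
    have [measurable]: "(\<lambda>y. g t y) \<in> borel_measurable borel"
      using measurable_compose[OF measurable_Pair2' assms(4), of t] by simp
    show "(\<integral>\<^sup>+y. ennreal (g t y) * ennreal (indicator T t * w t) \<partial>lborel) \<le> ennreal K * ennreal (indicator T t * w t)"
      using mass[of t] by (subst nn_integral_multc) (auto simp: indicator_def mult_right_mono)
  qed
  also have "\<dots> = ennreal K * (\<integral>\<^sup>+t. ennreal (indicator T t * w t) \<partial>lborel)"
    by (rule nn_integral_cmult) measurable
  also have "(\<integral>\<^sup>+t. ennreal (indicator T t * w t) \<partial>lborel) = ennreal (LINT t:T|lborel. w t)"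
    using w unfolding set_integrable_def set_lebesgue_integral_def
    by (subst nn_integral_eq_integral) (auto simp: indicator_def)
  also have "ennreal K * \<dots> < \<infinity>" by (simp add: ennreal_mult_less_top)
  finally show "(\<integral>\<^sup>+x. ennreal (norm (indicator (S \<times> T) x *\<^sub>R F x)) \<partial>(lborel \<Otimes>\<^sub>M lborel)) < \<infinity>" .
qed

lemma
  fixes F :: "real \<times> real \<Rightarrow> 'b::{banach, second_countable_topology}"
  assumes "set_integrable (lborel \<Otimes>\<^sub>M lborel) (S \<times> T) F"
  shows set_Fubini: "(LINT y:S|lborel. LINT t:T|lborel. F (y, t)) = (LINT t:T|lborel. LINT y:S|lborel. F (y, t))"
    and set_integrable_inner: "set_integrable lborel T (\<lambda>t. LINT y:S|lborel. F (y, t))"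
proof -
  define G where "G y t = indicator S y *\<^sub>R indicator T t *\<^sub>R F (y, t)" for y t
  have "(\<lambda>x. indicator (S \<times> T) x *\<^sub>R F x) = case_prod G"
    by (auto simp: G_def indicator_def fun_eq_iff)
  hence G: "integrable (lborel \<Otimes>\<^sub>M lborel) (case_prod G)"
    using assms unfolding set_integrable_def by simp
  have 1: "(\<integral>t. G y t \<partial>lborel) = indicator S y *\<^sub>R (LINT t:T|lborel. F (y, t))" for y
    unfolding G_def set_lebesgue_integral_def by (rule integral_scaleR_right)
  have 2: "(\<integral>y. G y t \<partial>lborel) = indicator T t *\<^sub>R (LINT y:S|lborel. F (y, t))" for t
    unfolding G_def set_lebesgue_integral_def by (subst scaleR_left_commute) (rule integral_scaleR_right)
  show "(LINT y:S|lborel. LINT t:T|lborel. F (y, t)) = (LINT t:T|lborel. LINT y:S|lborel. F (y, t))"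
    using lborel_pair.Fubini_integral[OF G] unfolding 1 2 set_lebesgue_integral_def[of lborel S "\<lambda>y. LINT t:T|lborel. F (y, t)"]
      set_lebesgue_integral_def[of lborel T "\<lambda>t. LINT y:S|lborel. F (y, t)"] by simp
  show "set_integrable lborel T (\<lambda>t. LINT y:S|lborel. F (y, t))"
    using lborel_pair.integrable_snd[OF G] unfolding 2 set_integrable_def .
qed

lemma euclid_heat_eq_normal_density:
  assumes "t > 0" shows "euclid_heat t (x - y) = normal_density x (sqrt (2 * t)) y"
proof -
  have "sqrt (2 * pi * (2 * t)) = 2 * sqrt (pi * t)" using real_sqrt_mult[of 4 "pi * t"] by (simp add: mult_ac)
  thus ?thesis using assms by (simp add: euclid_heat_def normal_density_def power2_commute[of x y] mult_ac)
qed

lemma euclid_heat_nonneg: "euclid_heat t z \<ge> 0" if "t > 0"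
  using that by (simp add: euclid_heat_def)

lemma integrable_euclid_heat: "t > 0 \<Longrightarrow> integrable lborel (\<lambda>y. euclid_heat t (x - y))"
  by (simp add: euclid_heat_eq_normal_density)

lemma integral_euclid_heat: "t > 0 \<Longrightarrow> (\<integral>y. euclid_heat t (x - y) \<partial>lborel) = 1"
  by (simp add: euclid_heat_eq_normal_density)

lemma euclid_heat_le:
  assumes "t > 0" shows "euclid_heat t z \<le> 1 / (2 * sqrt (pi * t))"
proof -
  have "exp (- (z\<^sup>2 / (4 * t))) \<le> 1" using assms by simp
  hence "1 / (2 * sqrt (pi * t)) * exp (- (z\<^sup>2 / (4 * t))) \<le> 1 / (2 * sqrt (pi * t)) * 1"
    using assms by (intro mult_left_mono) auto
  thus ?thesis by (simp add: euclid_heat_def)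
qed

text \<open>Half of the Gaussian absorbs the factor: with \<open>a = \<bar>z\<bar> / sqrt (8 t)\<close> this is \<open>a * exp (- a\<^sup>2) \<le> 1\<close>,
and the other half is the Gaussian at time \<open>2 t\<close>.\<close>
lemma abs_mult_euclid_heat_le:
  assumes "t > 0"
  shows "\<bar>z\<bar> * euclid_heat t z \<le> 4 * sqrt t * euclid_heat (2 * t) z"
proof -
  define a where "a = \<bar>z\<bar> / (2 * sqrt 2 * sqrt t)"
  have a2: "a\<^sup>2 = z\<^sup>2 / (8 * t)" using assms by (simp add: a_def power_divide power_mult_distrib)
  have "a \<ge> 0" using assms by (simp add: a_def)
  moreover have "2 * a \<le> a\<^sup>2 + 1" using sum_squares_bound[of a 1] by simp
  ultimately have "a \<le> 1 + a\<^sup>2" by linarith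
  also have "\<dots> \<le> exp (a\<^sup>2)" by (rule exp_ge_add_one_self)
  finally have "a * exp (- a\<^sup>2) \<le> 1" by (simp add: exp_minus field_simps)
  hence "a * exp (- a\<^sup>2) * exp (- a\<^sup>2) \<le> 1 * exp (- a\<^sup>2)" by (intro mult_right_mono) auto
  hence "4 * sqrt t * (1 / (2 * (sqrt 2 * sqrt (pi * t)))) * (a * (exp (- a\<^sup>2) * exp (- a\<^sup>2)))
     \<le> 4 * sqrt t * (1 / (2 * (sqrt 2 * sqrt (pi * t)))) * exp (- a\<^sup>2)"
    using assms by (intro mult_left_mono) auto
  moreover have "exp (- (z\<^sup>2 / (4 * t))) = exp (- a\<^sup>2) * exp (- a\<^sup>2)"
    unfolding a2 by (simp add: mult_exp_exp)
  moreover have "\<bar>z\<bar> * (1 / (2 * sqrt (pi * t))) = 4 * sqrt t * (1 / (2 * (sqrt 2 * sqrt (pi * t)))) * a"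
    using assms by (simp add: a_def)
  moreover have "euclid_heat (2 * t) z = 1 / (2 * (sqrt 2 * sqrt (pi * t))) * exp (- a\<^sup>2)"
    unfolding a2 by (simp add: euclid_heat_def real_sqrt_mult)
  moreover have "\<bar>z\<bar> * euclid_heat t z = (\<bar>z\<bar> * (1 / (2 * sqrt (pi * t)))) * exp (- (z\<^sup>2 / (4 * t)))"
    by (simp add: euclid_heat_def)
  ultimately show ?thesis by (simp only: mult.assoc)
qed

text \<open>A majorant of mass 2 at every time. It covers at once the kernels that are estimated by
\<open>euclid_heat t\<close> directly and those that need \<open>abs_mult_euclid_heat_le\<close>.\<close>
definition double_heat :: "real \<Rightarrow> real \<Rightarrow> real" where
  "double_heat t z = euclid_heat t z + euclid_heat (2 * t) z"

lemma integrable_double_heat: "t > 0 \<Longrightarrow> integrable lborel (\<lambda>y. double_heat t (x - y))"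
  unfolding double_heat_def by (intro Bochner_Integration.integrable_add integrable_euclid_heat) auto

lemma integral_double_heat: "t > 0 \<Longrightarrow> (\<integral>y. double_heat t (x - y) \<partial>lborel) = 2"
  unfolding double_heat_def by (simp add: integrable_euclid_heat integral_euclid_heat)

lemma double_heat_nonneg: "t > 0 \<Longrightarrow> double_heat t z \<ge> 0"
  by (simp add: double_heat_def euclid_heat_nonneg)

lemma euclid_heat_le_double_heat: "t > 0 \<Longrightarrow> euclid_heat t z \<le> double_heat t z"
  by (simp add: double_heat_def euclid_heat_nonneg)

lemma abs_mult_euclid_heat_le_double_heat:
  assumes "t > 0"
  shows "\<bar>z\<bar> * euclid_heat t z \<le> 4 * sqrt t * double_heat t z"
proof -
  have "4 * sqrt t * euclid_heat (2 * t) z \<le> 4 * sqrt t * double_heat t z"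
    using assms by (intro mult_left_mono) (auto simp: double_heat_def euclid_heat_nonneg)
  with abs_mult_euclid_heat_le[OF assms, of z] show ?thesis by linarith
qed

lemma set_integrable_small_time:
  fixes F :: "real \<times> real \<Rightarrow> 'b::{banach, second_countable_topology}"
  assumes [measurable]: "S \<in> sets borel" "w \<in> borel_measurable borel"
    and F: "set_borel_measurable (lborel \<Otimes>\<^sub>M lborel) (S \<times> {0<..1}) F"
    and bound: "\<And>y t. y \<in> S \<Longrightarrow> 0 < t \<Longrightarrow> t \<le> 1 \<Longrightarrow> norm (F (y, t)) \<le> C * (sqrt t * double_heat t (x - y)) * \<bar>w t\<bar>"
    and C: "C \<ge> 0"
    and w: "set_integrable lborel {0<..1} (\<lambda>t. sqrt t * \<bar>w t\<bar>)"
  shows "set_integrable (lborel \<Otimes>\<^sub>M lborel) (S \<times> {0<..1}) F"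
proof (rule set_integrable_prod_dominated[OF _ _ F, where g = "\<lambda>t y. double_heat t (x - y)" and w = "\<lambda>t. C * (sqrt t * \<bar>w t\<bar>)" and K = 2])
  have "(\<lambda>p. double_heat (snd p) (x - fst p)) \<in> borel_measurable (borel \<Otimes>\<^sub>M borel)"
    unfolding double_heat_def euclid_heat_def by measurable
  thus "(\<lambda>(y, t). double_heat t (x - y)) \<in> borel_measurable (borel \<Otimes>\<^sub>M borel)"
    by (simp add: case_prod_beta')
  fix t :: real assume t: "t \<in> {0<..1}"
  show "(\<integral>\<^sup>+y. ennreal (double_heat t (x - y)) \<partial>lborel) \<le> ennreal 2"
    using t by (subst nn_integral_eq_integral) (auto simp: integrable_double_heat integral_double_heat double_heat_nonneg)
  show "0 \<le> C * (sqrt t * \<bar>w t\<bar>)" using C t by simp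
  fix y assume "y \<in> S"
  thus "norm (F (y, t)) \<le> double_heat t (x - y) * (C * (sqrt t * \<bar>w t\<bar>))"
    using bound[of y t] t by (simp add: mult_ac)
qed (use w in \<open>auto intro: set_integrable_mult_right\<close>)

lemma set_integrable_large_time:
  fixes F :: "real \<times> real \<Rightarrow> 'b::{banach, second_countable_topology}"
  assumes [measurable]: "S \<in> sets borel" "w \<in> borel_measurable borel"
    and F: "set_borel_measurable (lborel \<Otimes>\<^sub>M lborel) (S \<times> {1..}) F"
    and bound: "\<And>y t. y \<in> S \<Longrightarrow> 1 \<le> t \<Longrightarrow> norm (F (y, t)) \<le> C * indicator {a..b} y / sqrt t * \<bar>w t\<bar>"
    and C: "C \<ge> 0"
    and w: "set_integrable lborel {1..} (\<lambda>t. \<bar>w t\<bar> / sqrt t)"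
  shows "set_integrable (lborel \<Otimes>\<^sub>M lborel) (S \<times> {1..}) F"
proof (rule set_integrable_prod_dominated[OF _ _ F, where g = "\<lambda>t y. indicator {a..b} y" and w = "\<lambda>t. C * (\<bar>w t\<bar> / sqrt t)" and K = "max 0 (b - a)"])
  show "set_integrable lborel {1..} (\<lambda>t. C * (\<bar>w t\<bar> / sqrt t))" by (intro set_integrable_mult_right w)
  fix t :: real assume t: "t \<in> {1..}"
  have "(\<integral>\<^sup>+y. ennreal (indicator {a..b} y) \<partial>lborel) = emeasure lborel {a..b}"
    by (simp only: ennreal_indicator) simp
  also have "\<dots> \<le> ennreal (max 0 (b - a))" by (auto simp: emeasure_lborel_Icc_eq)
  finally show "(\<integral>\<^sup>+y. ennreal (indicator {a..b} y) \<partial>lborel) \<le> ennreal (max 0 (b - a))" .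
  show "0 \<le> C * (\<bar>w t\<bar> / sqrt t)" using C t by simp
  fix y assume "y \<in> S"
  thus "norm (F (y, t)) \<le> indicator {a..b} y * (C * (\<bar>w t\<bar> / sqrt t))"
    using bound[of y t] t by (simp add: mult_ac)
qed (use w in \<open>auto intro: set_integrable_mult_right\<close>)

lemma set_integrable_powr_0_1: "a > (-1::real) \<Longrightarrow> set_integrable lborel {0<..1} (\<lambda>t. t powr a)"
proof -
  assume "a > (-1::real)"
  hence "((\<lambda>t. t powr a) has_integral (1 powr (a + 1) / (a + 1))) {0..1}" by (intro has_integral_powr_from_0) auto
  from nn_integral_has_integral_lebesgue[OF _ this] \<open>a > -1\<close> 
  have "set_integrable lborel {0..1} (\<lambda>t. t powr a)"
    by (intro set_integral_eqI_nn_integral(1)[where c = "1 powr (a + 1) / (a + 1)"]) auto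
  thus ?thesis by (rule set_integrable_subset) auto
qed

lemma set_integrable_powr_1_inf: "a < (-1::real) \<Longrightarrow> set_integrable lborel {1..} (\<lambda>t. t powr a)"
proof -
  assume a: "a < (-1::real)"
  hence "((\<lambda>t. t powr a) has_integral (- (1 powr (a + 1)) / (a + 1))) {1..}" by (intro has_integral_powr_to_inf) auto
  from nn_integral_has_integral_lebesgue[OF _ this] a
  show ?thesis
    by (intro set_integral_eqI_nn_integral(1)[where c = "- (1 powr (a + 1)) / (a + 1)"]) (auto simp: divide_nonpos_neg)
qed

text \<open>The logarithms arise by differentiating \<open>t powr (a + s)\<close> in \<open>s\<close>, so \<open>integrable_power_exp_family\<close>
with \<open>L = ln\<close> applies.\<close>
lemma set_integrable_log_powr:
  fixes A :: "real set"
  assumes [measurable]: "A \<in> sets borel" and A: "A \<subseteq> {0<..}" and \<epsilon>: "\<epsilon> > 0"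
    and "\<And>s. \<bar>s\<bar> < \<epsilon> \<Longrightarrow> set_integrable lborel A (\<lambda>t. t powr (a + s))"
  shows "set_integrable lborel A (\<lambda>t. \<bar>ln t\<bar> ^ j * t powr a)"
proof -
  define \<phi> where "\<phi> t = complex_of_real (indicator A t * t powr a)" for t
  have [measurable]: "\<phi> \<in> borel_measurable borel" unfolding \<phi>_def by measurable
  have "integrable lborel (\<lambda>t. (ln t ^ j * exp (0 * ln t)) *\<^sub>R \<phi> t)"
  proof (rule integrable_power_exp_family[where \<epsilon> = \<epsilon>])
    fix s :: real assume "\<bar>s\<bar> < \<epsilon>"
    from assms(4)[OF this] have "integrable lborel (\<lambda>t. complex_of_real (indicator A t *\<^sub>R t powr (a + s)))"
      unfolding set_integrable_def by (rule integrable_of_real)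
    also have "(\<lambda>t. complex_of_real (indicator A t *\<^sub>R t powr (a + s))) = (\<lambda>t. exp (s * ln t) *\<^sub>R \<phi> t)"
      using A by (auto simp: fun_eq_iff \<phi>_def indicator_def powr_def exp_add algebra_simps scaleR_conv_of_real)
    finally show "integrable lborel (\<lambda>t. exp (s * ln t) *\<^sub>R \<phi> t)" .
  qed (use \<epsilon> in auto)
  hence "integrable lborel (\<lambda>t. norm ((ln t ^ j * exp (0 * ln t)) *\<^sub>R \<phi> t))" by (rule integrable_norm)
  also have "(\<lambda>t. norm ((ln t ^ j * exp (0 * ln t)) *\<^sub>R \<phi> t)) = (\<lambda>t. indicator A t *\<^sub>R (\<bar>ln t\<bar> ^ j * t powr a))"
    by (auto simp: \<phi>_def fun_eq_iff indicator_def abs_mult power_abs norm_mult)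
  finally show ?thesis unfolding set_integrable_def .
qed

section \<open>The Bessel heat kernel near the diagonal\<close>

text \<open>As \<open>x\<^sup>2 + y\<^sup>2 = (x - y)\<^sup>2 + 2 x y\<close>, the Gaussian in \<open>x - y\<close> splits off and leaves the factor
\<open>exp (- w)\<close> that normalises \<open>I\<close> at \<open>w = x y / (2 t)\<close>.\<close>
lemma bessel_heat_eq:
  assumes "t > 0" "x > 0" "y > 0"
  shows "bessel_heat \<nu> t x y = euclid_heat t (x - y) * bessel_ratio \<nu> (x * y / (2 * t))"
proof -
  define w where "w = x * y / (2 * t)"
  have "- ((x\<^sup>2 + y\<^sup>2) / (4 * t)) = - ((x - y)\<^sup>2 / (4 * t)) + (- w)"
    using assms by (simp add: w_def field_simps power2_eq_square)
  hence e: "exp (- ((x\<^sup>2 + y\<^sup>2) / (4 * t))) = exp (- ((x - y)\<^sup>2 / (4 * t))) * exp (- w)"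
    by (simp only: exp_add)
  have "2 * pi * w = pi * (x * y) / t" by (simp add: w_def)
  hence r: "1 / (2 * sqrt (pi * t)) * sqrt (2 * pi * w) = sqrt (x * y) / (2 * t)"
    unfolding \<open>2 * pi * w = pi * (x * y) / t\<close> real_sqrt_divide real_sqrt_mult[of pi] using assms
    by (simp add: field_simps)
  thus ?thesis
    unfolding bessel_heat_def euclid_heat_def bessel_ratio_def e w_def[symmetric] r[symmetric] by (simp add: mult_ac)
qed

lemma bessel_heat_bounds:
  assumes "\<nu> > - (1/2)"
  obtains C where "C > 0"
    "\<And>t x y. t > 0 \<Longrightarrow> x > 0 \<Longrightarrow> y > 0 \<Longrightarrow> \<bar>bessel_heat \<nu> t x y\<bar> \<le> C * euclid_heat t (x - y)"
    "\<And>t x y. t > 0 \<Longrightarrow> x > 0 \<Longrightarrow> y > 0 \<Longrightarrow>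
       \<bar>bessel_heat \<nu> t x y - euclid_heat t (x - y)\<bar> \<le> C / sqrt (x * y / (2 * t)) * euclid_heat t (x - y)"
proof -
  obtain C where C: "C > 0" "\<And>z. z > 0 \<Longrightarrow> \<bar>bessel_ratio \<nu> z\<bar> \<le> C" "\<And>z. z > 0 \<Longrightarrow> \<bar>bessel_ratio \<nu> z - 1\<bar> \<le> C / sqrt z"
    using bessel_ratio_bounds[OF assms] by blast
  show ?thesis
  proof (rule that[OF C(1)])
    fix t x y :: real assume pos: "t > 0" "x > 0" "y > 0"
    define w where "w = x * y / (2 * t)"
    have w: "w > 0" using pos by (simp add: w_def)
    have e: "euclid_heat t (x - y) \<ge> 0" using pos by (simp add: euclid_heat_nonneg)
    have "euclid_heat t (x - y) * \<bar>bessel_ratio \<nu> w\<bar> \<le> euclid_heat t (x - y) * C"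
      using C(2)[OF w] e by (intro mult_left_mono)
    thus "\<bar>bessel_heat \<nu> t x y\<bar> \<le> C * euclid_heat t (x - y)"
      using e by (simp add: bessel_heat_eq[OF pos] abs_mult w_def mult.commute)
    have "euclid_heat t (x - y) * \<bar>bessel_ratio \<nu> w - 1\<bar> \<le> euclid_heat t (x - y) * (C / sqrt w)"
      using C(3)[OF w] e by (intro mult_left_mono)
    also have "euclid_heat t (x - y) * \<bar>bessel_ratio \<nu> w - 1\<bar> = \<bar>euclid_heat t (x - y) * (bessel_ratio \<nu> w - 1)\<bar>"
      using e by (simp add: abs_mult)
    also have "euclid_heat t (x - y) * (bessel_ratio \<nu> w - 1) = bessel_heat \<nu> t x y - euclid_heat t (x - y)"
      unfolding bessel_heat_eq[OF pos] w_def by (simp add: algebra_simps)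
    finally show "\<bar>bessel_heat \<nu> t x y - euclid_heat t (x - y)\<bar> \<le> C / sqrt (x * y / (2 * t)) * euclid_heat t (x - y)"
      by (simp add: w_def mult.commute)
  qed
qed

text \<open>For \<open>y \<ge> x / 2\<close> the rate in \<open>bessel_ratio_bounds\<close> is a multiple of \<open>sqrt t\<close>. For smaller \<open>y\<close> the
argument \<open>x y / (2 t)\<close> of the ratio may be small and the rate says nothing; but then
\<open>\<bar>x - y\<bar> \<ge> x / 2\<close>, and the Gaussian supplies the factor \<open>sqrt t\<close>.\<close>
lemma bessel_heat_minus_euclid_heat_bound:
  assumes \<nu>: "\<nu> > - (1/2)" and x: "x > 0"
  obtains C where "C > 0"
    "\<And>t y. t > 0 \<Longrightarrow> y > 0 \<Longrightarrow> \<bar>bessel_heat \<nu> t x y - euclid_heat t (x - y)\<bar> \<le> C * (sqrt t * double_heat t (x - y))"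
proof -
  obtain C where C: "C > 0"
    "\<And>t x y. t > 0 \<Longrightarrow> x > 0 \<Longrightarrow> y > 0 \<Longrightarrow> \<bar>bessel_heat \<nu> t x y\<bar> \<le> C * euclid_heat t (x - y)"
    "\<And>t x y. t > 0 \<Longrightarrow> x > 0 \<Longrightarrow> y > 0 \<Longrightarrow>
       \<bar>bessel_heat \<nu> t x y - euclid_heat t (x - y)\<bar> \<le> C / sqrt (x * y / (2 * t)) * euclid_heat t (x - y)"
    using bessel_heat_bounds[OF \<nu>] by blast
  show ?thesis
  proof (rule that[of "(C + 1) * 8 / x"])
    show "(C + 1) * 8 / x > 0" using C x by simp
    fix t y :: real assume t: "t > 0" and y: "y > 0"
    have e: "euclid_heat t (x - y) \<ge> 0" using t by (simp add: euclid_heat_nonneg)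
    have d: "double_heat t (x - y) \<ge> 0" using t by (simp add: double_heat_nonneg)
    show "\<bar>bessel_heat \<nu> t x y - euclid_heat t (x - y)\<bar> \<le> (C + 1) * 8 / x * (sqrt t * double_heat t (x - y))"
    proof (cases "y \<ge> x / 2")
      case True
      have "x\<^sup>2 / (4 * t) \<le> x * y / (2 * t)"
        using True x t by (simp add: field_simps power2_eq_square mult_left_mono)
      hence "sqrt (x\<^sup>2 / (4 * t)) \<le> sqrt (x * y / (2 * t))" by (rule real_sqrt_le_mono)
      moreover have "sqrt (x\<^sup>2 / (4 * t)) = x / (2 * sqrt t)" using x by (simp add: real_sqrt_divide real_sqrt_mult)
      ultimately have s: "x / (2 * sqrt t) \<le> sqrt (x * y / (2 * t))" by simp
      have "\<bar>bessel_heat \<nu> t x y - euclid_heat t (x - y)\<bar> \<le> C / sqrt (x * y / (2 * t)) * euclid_heat t (x - y)"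
        using C t x y by blast
      also have "\<dots> \<le> C / (x / (2 * sqrt t)) * double_heat t (x - y)"
        using s C t x y e by (intro mult_mono divide_left_mono euclid_heat_le_double_heat) auto
      also have "\<dots> = C * 2 / x * (sqrt t * double_heat t (x - y))" by simp
      also have "\<dots> \<le> (C + 1) * 8 / x * (sqrt t * double_heat t (x - y))"
        using C x t d by (intro mult_right_mono divide_right_mono) auto
      finally show ?thesis .
    next
      case False
      hence far: "x / 2 \<le> \<bar>x - y\<bar>" using y by (simp add: abs_if field_simps)
      have "\<bar>bessel_heat \<nu> t x y - euclid_heat t (x - y)\<bar> \<le> C * euclid_heat t (x - y) + euclid_heat t (x - y)"
        using C(2)[OF t x y] e by linarith
      also have "\<dots> = (C + 1) * 2 / x * (x / 2 * euclid_heat t (x - y))" using x by (simp add: field_simps)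
      also have "\<dots> \<le> (C + 1) * 2 / x * (\<bar>x - y\<bar> * euclid_heat t (x - y))"
        using C x far e by (intro mult_left_mono mult_right_mono) auto
      also have "\<dots> \<le> (C + 1) * 2 / x * (4 * sqrt t * double_heat t (x - y))"
        using C x t by (intro mult_left_mono abs_mult_euclid_heat_le_double_heat) auto
      also have "\<dots> = (C + 1) * 8 / x * (sqrt t * double_heat t (x - y))" by simp
      finally show ?thesis .
    qed
  qed
qed

text \<open>A fixed point \<open>x\<close> and the properties of \<open>f\<close> that enter the estimates of its heat flow at \<open>x\<close>. One
constant \<open>L\<close> serves as a bound of \<open>f\<close> and as a Lipschitz constant at \<open>x\<close>; outside \<open>B(x, 1)\<close> the
second follows from the first.\<close>
locale heat_kernel_splitting =
  fixes \<nu> x L b :: real and f :: "real \<Rightarrow> complex"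
  assumes \<nu>: "\<nu> > - (1/2)" and x: "x > 0" and b: "x + 1 \<le> b"
    and f_measurable [measurable]: "(\<lambda>y. indicator {0<..} y *\<^sub>R f y) \<in> borel_measurable borel"
    and f_support: "\<And>y. y > b \<Longrightarrow> f y = 0"
    and f_Lipschitz: "\<And>y. y > 0 \<Longrightarrow> norm (f y - indicator (pos_ball x 1) y * f x) \<le> L * \<bar>x - y\<bar>"
    and f_bounded: "\<And>y. y > 0 \<Longrightarrow> norm (f y) \<le> L"
begin

lemma L_nonneg: "L \<ge> 0" using f_bounded[OF x] norm_ge_zero order_trans by blast

abbreviation "B \<equiv> pos_ball x 1"
abbreviation "W t y \<equiv> bessel_heat \<nu> t x y"
abbreviation "E t y \<equiv> euclid_heat t (x - y)"
abbreviation "early t y \<equiv> sqrt t * double_heat t (x - y)"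

lemma B_sets [measurable]: "B \<in> sets borel"
  unfolding pos_ball_def by measurable

text \<open>The function \<open>f\<close> after its value at \<open>x\<close> is subtracted near \<open>x\<close>. It is \<open>O(\<bar>x - y\<bar>)\<close>, which
compensates the singularity of the heat kernel as \<open>t\<close> tends to 0.\<close>
definition jump :: "real \<Rightarrow> complex" where
  "jump y = f y - indicator B y * f x"

lemma jump_measurable: "(\<lambda>y. indicator {0<..} y *\<^sub>R jump y) \<in> borel_measurable borel"
proof -
  have "(\<lambda>y. indicator {0<..} y *\<^sub>R jump y) = (\<lambda>y. indicator {0<..} y *\<^sub>R f y - indicator B y * f x)"
    by (auto simp: jump_def fun_eq_iff indicator_def pos_ball_def)
  thus ?thesis by simp
qed

text \<open>One constant for all the pieces into which the heat flow is split. The bounds by \<open>early\<close> are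
integrable in \<open>y\<close> with integral \<open>O(sqrt t)\<close> and serve for small \<open>t\<close>, those with an indicator serve
for large \<open>t\<close>, and the first one gives integrability at a fixed time.\<close>
lemma kernel_bounds:
  obtains C where "C > 0"
    "\<And>t y. t > 0 \<Longrightarrow> y > 0 \<Longrightarrow> \<bar>W t y\<bar> \<le> C * E t y"
    "\<And>t y. t > 0 \<Longrightarrow> y > 0 \<Longrightarrow> norm (jump y) * \<bar>W t y\<bar> \<le> C * early t y"
    "\<And>t y. t > 0 \<Longrightarrow> y > 0 \<Longrightarrow> y \<notin> B \<Longrightarrow> \<bar>W t y\<bar> \<le> C * early t y"
    "\<And>t y. t > 0 \<Longrightarrow> y > 0 \<Longrightarrow> \<bar>W t y - E t y\<bar> \<le> C * early t y"
    "\<And>t y. t > 0 \<Longrightarrow> y < 0 \<Longrightarrow> E t y \<le> C * early t y"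
    "\<And>t y. t > 0 \<Longrightarrow> y > 0 \<Longrightarrow> norm (jump y) * \<bar>W t y\<bar> \<le> C * indicator {0..b} y / sqrt t"
    "\<And>t y. t > 0 \<Longrightarrow> y \<in> B \<Longrightarrow> \<bar>W t y\<bar> \<le> C * indicator {0..b} y / sqrt t"
proof -
  obtain C1 where C1: "C1 > 0"
    "\<And>t x y. t > 0 \<Longrightarrow> x > 0 \<Longrightarrow> y > 0 \<Longrightarrow> \<bar>bessel_heat \<nu> t x y\<bar> \<le> C1 * euclid_heat t (x - y)"
    "\<And>t x y. t > 0 \<Longrightarrow> x > 0 \<Longrightarrow> y > 0 \<Longrightarrow>
       \<bar>bessel_heat \<nu> t x y - euclid_heat t (x - y)\<bar> \<le> C1 / sqrt (x * y / (2 * t)) * euclid_heat t (x - y)"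
    using bessel_heat_bounds[OF \<nu>] by blast
  obtain C2 where C2: "C2 > 0"
    "\<And>t y. t > 0 \<Longrightarrow> y > 0 \<Longrightarrow> \<bar>W t y - E t y\<bar> \<le> C2 * early t y"
    using bessel_heat_minus_euclid_heat_bound[OF \<nu> x] by blast
  define C where "C = 4 * C1 * (2 * L + 1) + C2 + 4 / x"
  have pos: "C1 * L \<ge> 0" "C2 > 0" "4 / x > 0" using C1 C2 x L_nonneg by auto
  have C: "C1 \<le> C" "4 * (L * C1) \<le> C" "2 * L * C1 \<le> C" "4 * C1 \<le> C" "C2 \<le> C" "4 / x \<le> C"
    using pos C1(1) unfolding C_def by (simp_all add: algebra_simps)
  have "C > 0" using C(1) C1(1) by linarith
  have small: "\<bar>x - y\<bar> * \<bar>W t y\<bar> \<le> 4 * C1 * early t y" if "t > 0" "y > 0" for t y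
  proof -
    have "\<bar>x - y\<bar> * \<bar>W t y\<bar> \<le> \<bar>x - y\<bar> * (C1 * E t y)"
      using C1 that x by (intro mult_left_mono) auto
    also have "\<dots> = C1 * (\<bar>x - y\<bar> * E t y)" by simp
    also have "\<dots> \<le> C1 * (4 * sqrt t * double_heat t (x - y))"
      using C1 that by (intro mult_left_mono abs_mult_euclid_heat_le_double_heat) auto
    finally show ?thesis by simp
  qed
  have large: "\<bar>W t y\<bar> \<le> C1 / sqrt t" if "t > 0" "y > 0" for t y
  proof -
    have "1 \<le> 2 * sqrt pi" using real_sqrt_ge_one[of pi] pi_gt3 by linarith
    hence "1 / (2 * sqrt (pi * t)) \<le> 1 / sqrt t"
      using that by (intro divide_left_mono) (auto simp: real_sqrt_mult)
    hence "E t y \<le> 1 / sqrt t" using euclid_heat_le[OF that(1), of "x - y"] by linarith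
    hence "C1 * E t y \<le> C1 * (1 / sqrt t)" using C1 by (intro mult_left_mono) auto
    thus ?thesis using C1(2)[OF that(1) x that(2)] by simp
  qed
  show ?thesis
  proof (rule that[OF \<open>C > 0\<close>])
    fix t y :: real assume t: "t > 0"
    have d: "early t y \<ge> 0" and e: "E t y \<ge> 0" and st: "sqrt t > 0"
      using t by (auto simp: double_heat_nonneg euclid_heat_nonneg)
    {
      assume y: "y > 0"
      show "\<bar>W t y\<bar> \<le> C * E t y"
        using C1(2)[OF t x y] mult_right_mono[OF C(1) e] by linarith
      have "norm (jump y) * \<bar>W t y\<bar> \<le> (L * \<bar>x - y\<bar>) * \<bar>W t y\<bar>"
        using f_Lipschitz[OF y] unfolding jump_def by (intro mult_right_mono) auto
      also have "\<dots> = L * (\<bar>x - y\<bar> * \<bar>W t y\<bar>)" by simp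
      also have "\<dots> \<le> L * (4 * C1 * early t y)"
        using small[OF t y] L_nonneg by (intro mult_left_mono)
      also have "\<dots> = 4 * (L * C1) * early t y" by simp
      also have "\<dots> \<le> C * early t y" using C(2) d by (rule mult_right_mono)
      finally show "norm (jump y) * \<bar>W t y\<bar> \<le> C * early t y" .
      show "\<bar>W t y - E t y\<bar> \<le> C * early t y"
        using C2(2)[OF t y] mult_right_mono[OF C(5) d] by linarith
      have fx: "norm (f x) \<le> L" using f_bounded[OF x] .
      have ind: "y \<le> b" if "y \<in> B" using that b by (auto simp: pos_ball_def)
      have "norm (jump y) \<le> 2 * L * indicator {0..b} y"
      proof (cases "y \<le> b")
        case True
        have "norm (jump y) \<le> norm (f y) + norm (indicator B y * f x)" unfolding jump_def by (rule norm_triangle_ineq4)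
        also have "norm (indicator B y * f x) \<le> norm (f x)" by (simp add: norm_mult indicator_def)
        finally show ?thesis using f_bounded[OF y] fx True y by simp
      next
        case False
        thus ?thesis using ind f_support[of y] by (auto simp: jump_def indicator_def)
      qed
      hence "norm (jump y) * \<bar>W t y\<bar> \<le> (2 * L * indicator {0..b} y) * (C1 / sqrt t)"
        using large[OF t y] L_nonneg by (intro mult_mono) auto
      also have "\<dots> = (2 * L * C1) * (indicator {0..b} y / sqrt t)" by simp
      also have "\<dots> \<le> C * (indicator {0..b} y / sqrt t)" using C(3) t by (intro mult_right_mono) auto
      finally show "norm (jump y) * \<bar>W t y\<bar> \<le> C * indicator {0..b} y / sqrt t" by simp
      show "\<bar>W t y\<bar> \<le> C * early t y" if "y \<notin> B"
      proof -
        have "1 \<le> \<bar>x - y\<bar>" using that y by (auto simp: pos_ball_def abs_if split: if_splits)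
        hence "1 * \<bar>W t y\<bar> \<le> \<bar>x - y\<bar> * \<bar>W t y\<bar>" by (intro mult_right_mono) auto
        also note small[OF t y]
        also have "4 * C1 * early t y \<le> C * early t y" using C(4) d by (rule mult_right_mono)
        finally show ?thesis by simp
      qed
    }
    show "E t y \<le> C * early t y" if y: "y < 0"
    proof -
      have "E t y = 1 / x * (x * E t y)" using x by simp
      also have "\<dots> \<le> 1 / x * (\<bar>x - y\<bar> * E t y)"
        using x y e by (intro mult_left_mono mult_right_mono) auto
      also have "\<dots> \<le> 1 / x * (4 * sqrt t * double_heat t (x - y))"
        using x t by (intro mult_left_mono abs_mult_euclid_heat_le_double_heat) auto
      also have "\<dots> = 4 / x * early t y" by simp
      also have "\<dots> \<le> C * early t y" using C(6) d by (rule mult_right_mono)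
      finally show ?thesis .
    qed
    show "\<bar>W t y\<bar> \<le> C * indicator {0..b} y / sqrt t" if "y \<in> B"
    proof -
      have y: "y > 0" "y \<le> b" using that b by (auto simp: pos_ball_def)
      have "\<bar>W t y\<bar> \<le> C1 / sqrt t" using large[OF t y(1)] .
      also have "\<dots> \<le> C / sqrt t" using C(1) t by (intro divide_right_mono) auto
      finally show ?thesis using y by simp
    qed
  qed
qed

text \<open>The condition on a weight under which functions that are \<open>O(sqrt t)\<close> at 0 and \<open>O(1 / sqrt t)\<close> at
infinity can be integrated against it. The weights \<open>ln t ^ j / t\<close> of the formula and the powers
of the Mellin transform both satisfy it, so that one splitting covers both.\<close>
definition admissible_weight :: "(real \<Rightarrow> real) \<Rightarrow> bool" where
  "admissible_weight w \<longleftrightarrow> w \<in> borel_measurable borel \<and>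
     set_integrable lborel {0<..1} (\<lambda>t. sqrt t * \<bar>w t\<bar>) \<and> set_integrable lborel {1..} (\<lambda>t. \<bar>w t\<bar> / sqrt t)"

lemma heat_pair_measurable [measurable]:
  "(\<lambda>p. bessel_heat \<nu> (snd p) x (fst p)) \<in> borel_measurable (borel \<Otimes>\<^sub>M borel)"
  "(\<lambda>p. euclid_heat (snd p) (x - fst p)) \<in> borel_measurable (borel \<Otimes>\<^sub>M borel)"
  unfolding bessel_heat_def euclid_heat_def by measurable

lemma jump_pair_measurable:
  assumes [measurable]: "w \<in> borel_measurable borel" "T \<in> sets borel"
  shows "set_borel_measurable (lborel \<Otimes>\<^sub>M lborel) ({0<..} \<times> T) (\<lambda>(y, t). jump y * of_real (W t y * w t))"
proof -
  note [measurable] = jump_measurable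
  have "(\<lambda>p. indicator ({0<..} \<times> T) p *\<^sub>R (case p of (y, t) \<Rightarrow> jump y * of_real (W t y * w t)))
     = (\<lambda>p. indicator T (snd p) *\<^sub>R ((indicator {0<..} (fst p) *\<^sub>R jump (fst p)) * of_real (bessel_heat \<nu> (snd p) x (fst p) * w (snd p))))"
    by (auto simp: fun_eq_iff indicator_def)
  also have "\<dots> \<in> borel_measurable (borel \<Otimes>\<^sub>M borel)"
  proof -
    have [measurable]: "(\<lambda>p. indicator {0<..} (fst p) *\<^sub>R jump (fst p)) \<in> borel_measurable (borel \<Otimes>\<^sub>M (borel :: real measure))"
      using measurable_compose[OF measurable_fst jump_measurable] by simp
    show ?thesis by measurable
  qed
  finally show ?thesis by (simp add: set_borel_measurable_def)
qed

lemma integrable_jump: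
  assumes w: "admissible_weight w"
  shows "set_integrable (lborel \<Otimes>\<^sub>M lborel) ({0<..} \<times> {0<..}) (\<lambda>(y, t). jump y * of_real (W t y * w t))"
proof -
  have [measurable]: "w \<in> borel_measurable borel" using w by (simp add: admissible_weight_def)
  obtain C where C: "C > 0"
    "\<And>t y. t > 0 \<Longrightarrow> y > 0 \<Longrightarrow> norm (jump y) * \<bar>W t y\<bar> \<le> C * early t y"
    "\<And>t y. t > 0 \<Longrightarrow> y > 0 \<Longrightarrow> norm (jump y) * \<bar>W t y\<bar> \<le> C * indicator {0..b} y / sqrt t"
    by (rule kernel_bounds; blast)
  have "set_integrable (lborel \<Otimes>\<^sub>M lborel) ({0<..} \<times> {0<..1}) (\<lambda>(y, t). jump y * of_real (W t y * w t))"
  proof (rule set_integrable_small_time[where C = C and x = x and w = w])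
    fix y t :: real assume "y \<in> {0<..}" "0 < t" "t \<le> 1"
    hence "norm (jump y) * \<bar>W t y\<bar> * \<bar>w t\<bar> \<le> C * early t y * \<bar>w t\<bar>"
      using C(2) by (intro mult_right_mono) auto
    thus "norm (case (y, t) of (y, t) \<Rightarrow> jump y * complex_of_real (W t y * w t)) \<le> C * early t y * \<bar>w t\<bar>"
      by (simp add: norm_mult abs_mult mult_ac)
  qed (use C w jump_pair_measurable in \<open>auto simp: admissible_weight_def\<close>)
  moreover have "set_integrable (lborel \<Otimes>\<^sub>M lborel) ({0<..} \<times> {1..}) (\<lambda>(y, t). jump y * of_real (W t y * w t))"
  proof (rule set_integrable_large_time[where C = C and a = 0 and b = b and w = w])
    fix y t :: real assume "y \<in> {0<..}" "1 \<le> t"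
    hence "norm (jump y) * \<bar>W t y\<bar> * \<bar>w t\<bar> \<le> C * indicator {0..b} y / sqrt t * \<bar>w t\<bar>"
      using C(3)[of t y] by (intro mult_right_mono) auto
    thus "norm (case (y, t) of (y, t) \<Rightarrow> jump y * complex_of_real (W t y * w t)) \<le> C * indicator {0..b} y / sqrt t * \<bar>w t\<bar>"
      by (simp add: norm_mult abs_mult mult_ac)
  qed (use C w jump_pair_measurable in \<open>auto simp: admissible_weight_def\<close>)
  ultimately have "set_integrable (lborel \<Otimes>\<^sub>M lborel) ({0<..} \<times> {0<..1} \<union> {0<..} \<times> {1..}) (\<lambda>(y, t). jump y * of_real (W t y * w t))"
    by (rule set_integrable_Un) auto
  also have "{0<..} \<times> {0<..1} \<union> {0<..} \<times> {1..} = ({0<..} \<times> {0<..} :: (real \<times> real) set)" by auto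
  finally show ?thesis .
qed

lemma integrable_early:
  assumes w: "admissible_weight w" and [measurable]: "S \<in> sets borel"
    "(\<lambda>p. k (snd p) (fst p)) \<in> borel_measurable (borel \<Otimes>\<^sub>M borel)"
    and k: "\<And>t y. t > 0 \<Longrightarrow> y \<in> S \<Longrightarrow> \<bar>k t y\<bar> \<le> C * early t y" and C: "C \<ge> 0"
  shows "set_integrable (lborel \<Otimes>\<^sub>M lborel) (S \<times> {0<..<1}) (\<lambda>(y, t). k t y * w t :: real)"
proof -
  have [measurable]: "w \<in> borel_measurable borel" using w by (simp add: admissible_weight_def)
  have "set_integrable (lborel \<Otimes>\<^sub>M lborel) (S \<times> {0<..1}) (\<lambda>(y, t). k t y * w t)"
  proof (rule set_integrable_small_time[where C = C and x = x and w = w])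
    fix y t :: real assume "y \<in> S" "0 < t" "t \<le> 1"
    hence "\<bar>k t y\<bar> * \<bar>w t\<bar> \<le> C * early t y * \<bar>w t\<bar>" using k by (intro mult_right_mono) auto
    thus "norm (case (y, t) of (y, t) \<Rightarrow> k t y * w t) \<le> C * early t y * \<bar>w t\<bar>" by (simp add: abs_mult)
  qed (use C w in \<open>auto simp: admissible_weight_def set_borel_measurable_def case_prod_beta'\<close>)
  thus ?thesis by (rule set_integrable_subset) auto
qed

lemma integrable_far:
  assumes w: "admissible_weight w"
  shows "set_integrable (lborel \<Otimes>\<^sub>M lborel) (({0<..} - B) \<times> {0<..<1}) (\<lambda>(y, t). W t y * w t)"
proof -
  obtain C where "C > 0" "\<And>t y. t > 0 \<Longrightarrow> y > 0 \<Longrightarrow> y \<notin> B \<Longrightarrow> \<bar>W t y\<bar> \<le> C * early t y"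
    by (rule kernel_bounds; blast)
  thus ?thesis by (intro integrable_early[OF w, of _ W C]) auto
qed

lemma integrable_difference:
  assumes w: "admissible_weight w"
  shows "set_integrable (lborel \<Otimes>\<^sub>M lborel) ({0<..} \<times> {0<..<1}) (\<lambda>(y, t). (W t y - E t y) * w t)"
proof -
  obtain C where "C > 0" "\<And>t y. t > 0 \<Longrightarrow> y > 0 \<Longrightarrow> \<bar>W t y - E t y\<bar> \<le> C * early t y"
    by (rule kernel_bounds; blast)
  thus ?thesis by (intro integrable_early[OF w, of _ "\<lambda>t y. W t y - E t y" C]) auto
qed

lemma integrable_negative:
  assumes w: "admissible_weight w"
  shows "set_integrable (lborel \<Otimes>\<^sub>M lborel) ({..<0} \<times> {0<..<1}) (\<lambda>(y, t). E t y * w t)"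
proof -
  obtain C where "C > 0" "\<And>t y. t > 0 \<Longrightarrow> y < 0 \<Longrightarrow> E t y \<le> C * early t y"
    by (rule kernel_bounds; blast)
  thus ?thesis by (intro integrable_early[OF w, of _ E C]) (auto simp: euclid_heat_nonneg)
qed

lemma integrable_near_late:
  assumes w: "admissible_weight w"
  shows "set_integrable (lborel \<Otimes>\<^sub>M lborel) (B \<times> {1<..}) (\<lambda>(y, t). W t y * w t)"
proof -
  have [measurable]: "w \<in> borel_measurable borel" using w by (simp add: admissible_weight_def)
  obtain C where C: "C > 0" "\<And>t y. t > 0 \<Longrightarrow> y \<in> B \<Longrightarrow> \<bar>W t y\<bar> \<le> C * indicator {0..b} y / sqrt t"
    by (rule kernel_bounds; blast)
  have "set_integrable (lborel \<Otimes>\<^sub>M lborel) (B \<times> {1..}) (\<lambda>(y, t). W t y * w t)"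
  proof (rule set_integrable_large_time[where C = C and a = 0 and b = b and w = w])
    fix y t :: real assume "y \<in> B" "1 \<le> t"
    hence "\<bar>W t y\<bar> * \<bar>w t\<bar> \<le> C * indicator {0..b} y / sqrt t * \<bar>w t\<bar>"
      using C(2)[of t y] by (intro mult_right_mono) auto
    thus "norm (case (y, t) of (y, t) \<Rightarrow> W t y * w t) \<le> C * indicator {0..b} y / sqrt t * \<bar>w t\<bar>"
      by (simp add: abs_mult)
  qed (use C w in \<open>auto simp: admissible_weight_def set_borel_measurable_def case_prod_beta'\<close>)
  thus ?thesis by (rule set_integrable_subset) auto
qed

definition heat_flow :: "real \<Rightarrow> complex" where
  "heat_flow t = (LINT y:{0<..}|lborel. of_real (W t y) * f y)"

lemma slice_measurable [measurable]:
  "(\<lambda>y. W t y) \<in> borel_measurable borel" "(\<lambda>y. E t y) \<in> borel_measurable borel"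
  unfolding bessel_heat_def euclid_heat_def by measurable

lemma set_integrable_euclid_heat_slice:
  assumes "t > 0" "A \<in> sets borel" shows "set_integrable lborel A (\<lambda>y. E t y)"
  unfolding set_integrable_def using assms integrable_euclid_heat[of t x] by (intro integrable_mult_indicator) auto

lemma set_integrable_bessel_heat_slice:
  assumes t: "t > 0" and A [measurable]: "A \<in> sets borel" "A \<subseteq> {0<..}"
  shows "set_integrable lborel A (\<lambda>y. W t y)"
proof -
  obtain C where C: "C > 0"
    "\<And>t y. t > 0 \<Longrightarrow> y > 0 \<Longrightarrow> \<bar>W t y\<bar> \<le> C * E t y"
    by (rule kernel_bounds; blast)
  show ?thesis unfolding set_integrable_def
  proof (rule Bochner_Integration.integrable_bound)
    show "integrable lborel (\<lambda>y. C * E t y)" using t by (intro integrable_mult_right integrable_euclid_heat)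
    show "AE y in lborel. norm (indicat_real A y *\<^sub>R W t y) \<le> norm (C * E t y)"
      using C t A(2) by (intro AE_I2) (auto simp: indicator_def abs_mult euclid_heat_nonneg)
  qed measurable
qed

lemma set_integrable_times_bessel_heat_slice:
  fixes g :: "real \<Rightarrow> complex"
  assumes t: "t > 0" and g [measurable]: "(\<lambda>y. indicator {0<..} y *\<^sub>R g y) \<in> borel_measurable borel"
    and M: "\<And>y. y > 0 \<Longrightarrow> norm (g y) \<le> M"
  shows "set_integrable lborel {0<..} (\<lambda>y. g y * of_real (W t y))"
proof -
  have "M \<ge> 0" using M[OF x] norm_ge_zero order_trans by blast
  have [measurable]: "(\<lambda>y. indicator {0<..} y *\<^sub>R (g y * of_real (W t y))) \<in> borel_measurable borel"
  proof -
    have eq: "(\<lambda>y. indicator {0<..} y *\<^sub>R (g y * of_real (W t y))) = (\<lambda>y. (indicator {0<..} y *\<^sub>R g y) * of_real (W t y))"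
      by auto
    show ?thesis unfolding eq by measurable
  qed
  have i: "integrable lborel (\<lambda>y. M * (indicator {0<..} y *\<^sub>R W t y))"
    using set_integrable_bessel_heat_slice[OF t, of "{0<..}"] unfolding set_integrable_def by (intro integrable_mult_right) auto
  show ?thesis unfolding set_integrable_def
  proof (rule Bochner_Integration.integrable_bound[OF i])
    show "AE y in lborel. norm (indicator {0<..} y *\<^sub>R (g y * of_real (W t y))) \<le> norm (M * (indicator {0<..} y *\<^sub>R W t y))"
      using M \<open>M \<ge> 0\<close> by (intro AE_I2) (auto simp: indicator_def abs_mult norm_mult intro: mult_right_mono)
  qed measurable
qed

lemma heat_flow_split:
  assumes t: "t > 0"
  shows "heat_flow t = (LINT y:{0<..}|lborel. jump y * of_real (W t y)) + f x * of_real (LINT y:B|lborel. W t y)"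
proof -
  have B: "B \<subseteq> {0<..}" by (auto simp: pos_ball_def)
  have 1: "set_integrable lborel {0<..} (\<lambda>y. f y * of_real (W t y))"
    by (rule set_integrable_times_bessel_heat_slice[OF t f_measurable f_bounded])
  have i2: "set_integrable lborel B (\<lambda>y. f x * complex_of_real (W t y))"
    using set_integrable_bessel_heat_slice[OF t B_sets B]
    by (intro set_integrable_mult_right) (simp add: set_integrable_def complex_of_real_integrable_eq scaleR_conv_of_real of_real_mult[symmetric] del: of_real_mult)
  have eq: "indicator {0<..} y *\<^sub>R (f y * of_real (W t y)) - indicator B y *\<^sub>R (f x * complex_of_real (W t y))
     = indicator {0<..} y *\<^sub>R (jump y * of_real (W t y))" for y
    using B by (auto simp: jump_def indicator_def algebra_simps)
  have "(LINT y:{0<..}|lborel. jump y * of_real (W t y)) = (LINT y:{0<..}|lborel. f y * of_real (W t y))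
     - (LINT y:B|lborel. f x * complex_of_real (W t y))"
    unfolding set_lebesgue_integral_def eq[symmetric] using 1 i2 unfolding set_integrable_def by (rule Bochner_Integration.integral_diff)
  thus ?thesis by (simp add: heat_flow_def set_integral_complex_of_real mult.commute)
qed

text \<open>The Euclidean kernel has mass 1 on the whole line, whereas it is compared with the Bessel kernel
on the half-line only; its mass on the negative half-line remains.\<close>
lemma mass_split:
  assumes t: "t > 0"
  shows "(LINT y:B|lborel. W t y) = 1 - (LINT y:{0<..} - B|lborel. W t y)
     + (LINT y:{0<..}|lborel. W t y - E t y) - (LINT y:{..<0}|lborel. E t y)"
proof -
  have B: "B \<subseteq> {0<..}" by (auto simp: pos_ball_def)
  note I = set_integrable_bessel_heat_slice[OF t] and E = set_integrable_euclid_heat_slice[OF t]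
  have 1: "(LINT y:B \<union> ({0<..} - B)|lborel. W t y) = (LINT y:B|lborel. W t y) + (LINT y:{0<..} - B|lborel. W t y)"
    using B by (intro set_integral_Un I) auto
  have 2: "B \<union> ({0<..} - B) = {0<..}" using B by auto
  have 3: "(LINT y:{0<..}|lborel. W t y - E t y) = (LINT y:{0<..}|lborel. W t y) - (LINT y:{0<..}|lborel. E t y)"
    by (intro set_integral_diff I E) auto
  have 4: "(LINT y:{0..}|lborel. E t y) = (LINT y:{0<..}|lborel. E t y)"
    unfolding set_lebesgue_integral_def
    by (rule integral_cong_AE) (auto intro!: AE_mp[OF AE_lborel_singleton[of 0] AE_I2] simp: indicator_def)
  have 5: "(LINT y:{..<0} \<union> {0..}|lborel. E t y) = (LINT y:{..<0}|lborel. E t y) + (LINT y:{0..}|lborel. E t y)"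
    by (intro set_integral_Un E) auto
  have 6: "(LINT y:{..<0} \<union> {0..}|lborel. E t y) = 1"
  proof -
    have "{..<0} \<union> {0..} = (UNIV :: real set)" by auto
    thus ?thesis using integral_euclid_heat[OF t, of x] by (simp add: set_lebesgue_integral_def)
  qed
  show ?thesis using 1 3 4 5 6 unfolding 2 by linarith
qed

text \<open>The difference between the heat flow and \<open>f x\<close>, restricted to \<open>t < 1\<close> because for large \<open>t\<close> the
heat flow itself is small.\<close>
definition defect :: "real \<Rightarrow> complex" where
  "defect t = heat_flow t - indicator {0<..<1} t * f x"

lemma defect_early:
  assumes t: "0 < t" "t < 1"
  shows "defect t = (LINT y:{0<..}|lborel. jump y * of_real (W t y)) + f x * of_real
     (- (LINT y:{0<..} - B|lborel. W t y)
     + (LINT y:{0<..}|lborel. W t y - E t y) - (LINT y:{..<0}|lborel. E t y))"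
  using t by (simp add: defect_def heat_flow_split mass_split algebra_simps)

lemma defect_late: "t > 1 \<Longrightarrow> defect t = (LINT y:{0<..}|lborel. jump y * of_real (W t y)) + f x * of_real (LINT y:B|lborel. W t y)"
  by (simp add: defect_def heat_flow_split)

text \<open>\<open>defect_early\<close> and \<open>defect_late\<close> are integrated against the weight, and in each of the five terms
the order of integration is exchanged.\<close>
lemma weighted_defect:
  assumes w: "admissible_weight w"
  shows "set_integrable lborel {0<..} (\<lambda>t. defect t * of_real (w t))"
    and "(LINT t:{0<..}|lborel. defect t * of_real (w t)) =
      (LINT y:{0<..}|lborel. jump y * of_real (LINT t:{0<..}|lborel. W t y * w t))
      + f x * of_real
        (- (LINT y:{0<..} - B|lborel. LINT t:{0<..<1}|lborel. W t y * w t)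
         + (LINT y:B|lborel. LINT t:{1<..}|lborel. W t y * w t)
         + (LINT y:{0<..}|lborel. LINT t:{0<..<1}|lborel. (W t y - E t y) * w t)
         - (LINT y:{..<0}|lborel. LINT t:{0<..<1}|lborel. E t y * w t))" (is "_ = ?rhs")
proof -
  note i1 = integrable_jump[OF w] and i2 = integrable_far[OF w] and i3 = integrable_near_late[OF w]
    and i4 = integrable_difference[OF w] and i5 = integrable_negative[OF w]
  define p1 where "p1 t = (LINT y:{0<..}|lborel. jump y * of_real (W t y * w t))" for t
  define p2 where "p2 t = (LINT y:{0<..} - B|lborel. W t y * w t)" for t
  define p3 where "p3 t = (LINT y:B|lborel. W t y * w t)" for t
  define p4 where "p4 t = (LINT y:{0<..}|lborel. (W t y - E t y) * w t)" for t
  define p5 where "p5 t = (LINT y:{..<0}|lborel. E t y * w t)" for t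
  have p: "set_integrable lborel {0<..} p1" "set_integrable lborel {0<..<1} p2" "set_integrable lborel {1<..} p3"
    "set_integrable lborel {0<..<1} p4" "set_integrable lborel {0<..<1} p5"
    using set_integrable_inner[OF i1] set_integrable_inner[OF i2] set_integrable_inner[OF i3] set_integrable_inner[OF i4] set_integrable_inner[OF i5]
    unfolding p1_def p2_def p3_def p4_def p5_def by simp_all
  define R where "R t = - (indicator {0<..<1} t *\<^sub>R p2 t) + indicator {1<..} t *\<^sub>R p3 t + indicator {0<..<1} t *\<^sub>R p4 t - indicator {0<..<1} t *\<^sub>R p5 t" for t
  have q: "integrable lborel (\<lambda>t. indicator {0<..<1} t *\<^sub>R p2 t)" "integrable lborel (\<lambda>t. indicator {1<..} t *\<^sub>R p3 t)"
    "integrable lborel (\<lambda>t. indicator {0<..<1} t *\<^sub>R p4 t)" "integrable lborel (\<lambda>t. indicator {0<..<1} t *\<^sub>R p5 t)"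
    using p(2-5) unfolding set_integrable_def by auto
  have R: "integrable lborel R" unfolding R_def
    by (intro Bochner_Integration.integrable_diff Bochner_Integration.integrable_add Bochner_Integration.integrable_minus q)
  have R_int: "(\<integral>t. R t \<partial>lborel) = - (LINT t:{0<..<1}|lborel. p2 t) + (LINT t:{1<..}|lborel. p3 t) + (LINT t:{0<..<1}|lborel. p4 t) - (LINT t:{0<..<1}|lborel. p5 t)"
  proof -
    have "integrable lborel (\<lambda>t. - (indicator {0<..<1} t *\<^sub>R p2 t))" using q(1) by (rule Bochner_Integration.integrable_minus)
    note a = this Bochner_Integration.integrable_add[OF this q(2)]
    note a = a Bochner_Integration.integrable_add[OF a(2) q(3)]
    show ?thesis unfolding R_def set_lebesgue_integral_def
      by (simp only: Bochner_Integration.integral_diff[OF a(3) q(4)] Bochner_Integration.integral_add[OF a(2) q(3)] Bochner_Integration.integral_add[OF a(1) q(2)] Bochner_Integration.integral_minus)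
  qed
  have p1: "integrable lborel (\<lambda>t. indicator {0<..} t *\<^sub>R p1 t)" using p(1) unfolding set_integrable_def .
  have tot: "integrable lborel (\<lambda>t. indicator {0<..} t *\<^sub>R p1 t + f x * of_real (R t))"
    using p1 R by (intro Bochner_Integration.integrable_add integrable_mult_right integrable_of_real)
  have eq: "indicator {0<..} t *\<^sub>R (defect t * of_real (w t)) = indicator {0<..} t *\<^sub>R p1 t + f x * of_real (R t)" if t1: "t \<noteq> 1" for t
  proof -
    have p1': "p1 t = (LINT y:{0<..}|lborel. jump y * of_real (W t y)) * of_real (w t)"
      unfolding p1_def by (subst set_integral_mult_left[symmetric]) (simp add: mult.assoc)
    consider "t \<le> 0" | "0 < t" "t < 1" | "t > 1" using t1 by linarith
    thus ?thesis
    proof cases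
      case 1 thus ?thesis by (simp add: R_def indicator_def)
    next
      case 2 thus ?thesis unfolding defect_early[OF 2] p1' R_def p2_def p3_def p4_def p5_def set_integral_mult_left by (simp add: algebra_simps)
    next
      case 3 thus ?thesis unfolding defect_late[OF 3] p1' R_def p2_def p3_def p4_def p5_def set_integral_mult_left by (simp add: algebra_simps)
    qed
  qed
  hence AE: "AE t in lborel. indicator {0<..} t *\<^sub>R (defect t * of_real (w t)) = indicator {0<..} t *\<^sub>R p1 t + f x * of_real (R t)"
    using AE_lborel_singleton[of 1] by auto
  have meas: "(\<lambda>t. indicator {0<..} t *\<^sub>R (defect t * of_real (w t))) \<in> borel_measurable lborel"
  proof -
    have "(\<lambda>t. indicator {0<..} t *\<^sub>R (defect t * of_real (w t))) = 
       (\<lambda>t. if t = 1 then defect 1 * of_real (w 1) else indicator {0<..} t *\<^sub>R p1 t + f x * of_real (R t))"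
      using eq by auto
    also have "\<dots> \<in> borel_measurable lborel"
      using borel_measurable_integrable[OF tot] by measurable
    finally show ?thesis .
  qed
  show "set_integrable lborel {0<..} (\<lambda>t. defect t * of_real (w t))"
    unfolding set_integrable_def using tot by (rule integrable_cong_AE_imp[OF _ meas]) (use AE in auto)
  have "(LINT t:{0<..}|lborel. defect t * of_real (w t)) = (\<integral>t. indicator {0<..} t *\<^sub>R p1 t + f x * of_real (R t) \<partial>lborel)"
    unfolding set_lebesgue_integral_def by (rule integral_cong_AE[OF meas borel_measurable_integrable[OF tot] AE])
  also have "\<dots> = (LINT t:{0<..}|lborel. p1 t) + f x * of_real (\<integral>t. R t \<partial>lborel)"
    using p1 R by (subst Bochner_Integration.integral_add) (auto simp: set_lebesgue_integral_def)
  also have "(LINT t:{0<..}|lborel. p1 t) = (LINT y:{0<..}|lborel. jump y * of_real (LINT t:{0<..}|lborel. W t y * w t))"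
    using set_Fubini[OF i1] unfolding p1_def by (simp add: set_integral_complex_of_real del: of_real_mult)
  also have "(\<integral>t. R t \<partial>lborel) = - (LINT y:{0<..} - B|lborel. LINT t:{0<..<1}|lborel. W t y * w t)
         + (LINT y:B|lborel. LINT t:{1<..}|lborel. W t y * w t)
         + (LINT y:{0<..}|lborel. LINT t:{0<..<1}|lborel. (W t y - E t y) * w t)
         - (LINT y:{..<0}|lborel. LINT t:{0<..<1}|lborel. E t y * w t)"
    unfolding R_int p2_def p3_def p4_def p5_def
    using set_Fubini[OF i2] set_Fubini[OF i3] set_Fubini[OF i4] set_Fubini[OF i5] by simp
  finally show "(LINT t:{0<..}|lborel. defect t * of_real (w t)) = ?rhs" .
qed

end

section \<open>The Hankel transform of a test function\<close>

text \<open>A test function with all its derivatives, and an interval at whose end points they all vanish, so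
that integration by parts produces no boundary terms.\<close>
locale test_function =
  fixes f :: "real \<Rightarrow> complex" and D :: "nat \<Rightarrow> real \<Rightarrow> complex" and a b :: real
  assumes a_pos: "0 < a" and a_less_b: "a < b" and D_0: "D 0 = f"
    and D_Suc: "\<And>n x. x > 0 \<Longrightarrow> (D n has_vector_derivative D (Suc n) x) (at x)"
    and vanish: "\<And>n x. x > 0 \<Longrightarrow> x \<le> a \<or> b \<le> x \<Longrightarrow> D n x = 0"

lemma Cc_smooth_test_function:
  assumes "f \<in> Cc_smooth"
  obtains D a b where "test_function f D a b"
proof -
  from assms obtain D K where D: "D 0 = f" "\<And>n x. x > 0 \<Longrightarrow> (D n has_vector_derivative D (Suc n) x) (at x)"
    and K: "compact K" "K \<subseteq> {0<..}" "\<And>x. x > 0 \<Longrightarrow> x \<notin> K \<Longrightarrow> f x = 0"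
    unfolding Cc_smooth_def by blast
  have "\<exists>c d. 0 < c \<and> c \<le> d \<and> K \<subseteq> {c..d}"
  proof (cases "K = {}")
    case False
    obtain c where c: "c \<in> K" "\<forall>t\<in>K. c \<le> t" using compact_attains_inf[OF K(1) False] by blast
    obtain d where d: "d \<in> K" "\<forall>t\<in>K. t \<le> d" using compact_attains_sup[OF K(1) False] by blast
    from c d K(2) show ?thesis by (intro exI[of _ c] exI[of _ d]) auto
  qed (auto intro!: exI[of _ 1])
  then obtain c d where cd: "0 < c" "c \<le> d" "K \<subseteq> {c..d}" by blast
  have op: "open ({0<..} - K)" using K(1) by (intro open_Diff open_greaterThan compact_imp_closed)
  have zero: "D n x = 0" if "x \<in> {0<..} - K" for n x
    using that
  proof (induction n arbitrary: x)
    case 0 thus ?case using K(3) D(1) by auto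
  next
    case (Suc n)
    have "(D n has_vector_derivative 0) (at x)"
      by (rule has_vector_derivative_transform_within_open[OF has_vector_derivative_const op Suc.prems]) (use Suc.IH in auto)
    moreover have "(D n has_vector_derivative D (Suc n) x) (at x)" using D(2) Suc.prems by auto
    ultimately show ?case by (rule vector_derivative_unique_at[symmetric])
  qed
  have "test_function f D (c / 2) (d + 1)"
  proof
    fix n x assume x: "(x::real) > 0" "x \<le> c / 2 \<or> d + 1 \<le> x"
    hence "x \<notin> K" using cd by auto
    thus "D n x = 0" using zero x by auto
  qed (use cd D in auto)
  thus ?thesis by (rule that)
qed

context test_function
begin

lemma D_continuous: "continuous_on {0<..} (D n)"
  by (intro continuous_at_imp_continuous_on ballI has_vector_derivative_continuous[OF D_Suc]) auto

lemma D_measurable: "(\<lambda>y. indicator {0<..} y *\<^sub>R D n y) \<in> borel_measurable borel"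
  by (intro borel_measurable_continuous_on_indicator D_continuous) auto

lemma D_bounded: obtains M where "M \<ge> 0" "\<And>x. x > 0 \<Longrightarrow> norm (D n x) \<le> M"
proof -
  have "compact (D n ` {a..b})"
    using a_pos by (intro compact_continuous_image continuous_on_subset[OF D_continuous]) auto
  hence "bounded (D n ` {a..b})" by (rule compact_imp_bounded)
  then obtain M where M: "\<And>x. x \<in> {a..b} \<Longrightarrow> norm (D n x) \<le> M" unfolding bounded_iff by blast
  show ?thesis
  proof (rule that[of "max 0 M"])
    fix x :: real assume "x > 0"
    show "norm (D n x) \<le> max 0 M"
    proof (cases "x \<in> {a..b}")
      case True thus ?thesis using M[of x] by simp
    next
      case False thus ?thesis using vanish[OF \<open>x > 0\<close>, of n] by auto
    qed
  qed simp
qed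

lemma f_measurable: "(\<lambda>y. indicator {0<..} y *\<^sub>R f y) \<in> borel_measurable borel"
  using D_measurable[of 0] by (simp add: D_0)

lemma Lipschitz: obtains L where "L \<ge> 0" "\<And>x y. x > 0 \<Longrightarrow> y > 0 \<Longrightarrow> norm (f y - f x) \<le> L * \<bar>x - y\<bar>"
proof -
  obtain M where M: "M \<ge> 0" "\<And>x. x > 0 \<Longrightarrow> norm (D 1 x) \<le> M" using D_bounded[of 1] by blast
  have "norm (f y - f x) \<le> M * \<bar>x - y\<bar>" if "x > 0" "y > 0" for x y
  proof -
    have "norm (f y - f x) \<le> M * norm (y - x)"
    proof (rule differentiable_bound[of "{0<..}"])
      fix z :: real assume z: "z \<in> {0<..}"
      show "(f has_derivative (\<lambda>h. h *\<^sub>R D 1 z)) (at z within {0<..})"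
        using D_Suc[of z 0] z unfolding D_0 has_vector_derivative_def by (auto intro: has_derivative_at_withinI)
      show "onorm (\<lambda>h. h *\<^sub>R D 1 z) \<le> M"
      proof (rule onorm_le)
        fix h :: real
        have "\<bar>h\<bar> * norm (D 1 z) \<le> \<bar>h\<bar> * M" using M(2)[of z] z by (intro mult_left_mono) auto
        thus "norm (h *\<^sub>R D 1 z) \<le> M * norm h" by (simp add: mult.commute)
      qed
    qed (use that in auto)
    thus ?thesis by (simp add: abs_minus_commute)
  qed
  thus ?thesis using that M(1) by blast
qed

lemma wave_times_D_continuous:
  assumes "\<nu> > -1" "x > 0"
  shows "continuous_on {a..b} (\<lambda>z. bessel_wave \<nu> (x * z) *\<^sub>R D n z)"
proof -
  have "continuous_on {0<..} (bessel_wave \<nu>)"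
    using assms(1) by (intro continuous_at_imp_continuous_on ballI DERIV_isCont[OF has_real_derivative_bessel_wave]) auto
  hence "continuous_on {a..b} (\<lambda>z. bessel_wave \<nu> (x * z))"
    by (rule continuous_on_compose2) (intro continuous_intros, intro image_subsetI, use assms(2) a_pos in auto)
  thus ?thesis using a_pos by (intro continuous_intros continuous_on_subset[OF D_continuous]) auto
qed

lemma hankel_integrable:
  assumes "\<nu> > -1" "x > 0"
  shows "set_integrable lborel {0<..} (\<lambda>y. of_real (hankel_kernel \<nu> x y) * f y)"
    and "(LINT y:{0<..}|lborel. of_real (hankel_kernel \<nu> x y) * f y) = integral {a..b} (\<lambda>z. bessel_wave \<nu> (x * z) *\<^sub>R f z)"
proof -
  have eq: "(\<lambda>y. indicator {0<..} y *\<^sub>R (of_real (hankel_kernel \<nu> x y) * f y)) = (\<lambda>y. indicator {a..b} y *\<^sub>R (bessel_wave \<nu> (x * y) *\<^sub>R f y))"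
    using vanish[of _ 0] a_pos by (auto simp: fun_eq_iff indicator_def hankel_kernel_eq D_0 scaleR_conv_of_real)
  have I: "set_integrable lborel {a..b} (\<lambda>z. bessel_wave \<nu> (x * z) *\<^sub>R f z)"
    using borel_integrable_atLeastAtMost'[OF wave_times_D_continuous[OF assms, of 0]] by (simp add: D_0)
  show "set_integrable lborel {0<..} (\<lambda>y. of_real (hankel_kernel \<nu> x y) * f y)"
    using I unfolding set_integrable_def eq .
  have "(LINT y:{0<..}|lborel. of_real (hankel_kernel \<nu> x y) * f y) = (LINT y:{a..b}|lborel. bessel_wave \<nu> (x * y) *\<^sub>R f y)"
    unfolding set_lebesgue_integral_def eq ..
  also have "\<dots> = integral {a..b} (\<lambda>z. bessel_wave \<nu> (x * z) *\<^sub>R f z)" by (rule set_borel_integral_eq_integral(2)[OF I])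
  finally show "(LINT y:{0<..}|lborel. of_real (hankel_kernel \<nu> x y) * f y) = integral {a..b} (\<lambda>z. bessel_wave \<nu> (x * z) *\<^sub>R f z)" .
qed

lemma hankel_eq_integral:
  assumes "\<nu> > -1" "x > 0"
  shows "hankel \<nu> f x = integral {a..b} (\<lambda>z. bessel_wave \<nu> (x * z) *\<^sub>R f z)"
    and "hankel \<nu> f x = (LINT y:{0<..}|lborel. of_real (bessel_wave \<nu> (x * y)) * f y)"
proof -
  have "hankel \<nu> f x = hankel_integral \<nu> f x" using hankel_integrable(1)[OF assms] by (simp only: hankel_def if_True)
  also have "\<dots> = (LINT y:{0<..}|lborel. of_real (hankel_kernel \<nu> x y) * f y)" by (rule hankel_integral_def)
  finally have *: "hankel \<nu> f x = (LINT y:{0<..}|lborel. of_real (hankel_kernel \<nu> x y) * f y)" .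
  show "hankel \<nu> f x = integral {a..b} (\<lambda>z. bessel_wave \<nu> (x * z) *\<^sub>R f z)"
    unfolding * by (rule hankel_integrable(2)[OF assms])
  show "hankel \<nu> f x = (LINT y:{0<..}|lborel. of_real (bessel_wave \<nu> (x * y)) * f y)"
    unfolding * by (simp only: hankel_kernel_eq)
qed

lemma hankel_measurable:
  assumes "\<nu> > -1"
  shows "(\<lambda>y. indicator {0<..} y *\<^sub>R hankel \<nu> f y) \<in> borel_measurable borel"
proof -
  define g where "g z = indicator {0<..} z *\<^sub>R f z" for z
  have [measurable]: "g \<in> borel_measurable borel" using f_measurable by (simp add: g_def[abs_def])
  have "(\<lambda>p :: real \<times> real. of_real (bessel_wave \<nu> (fst p * snd p)) * g (snd p)) \<in> borel_measurable (borel \<Otimes>\<^sub>M lborel)"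
    by measurable
  hence m: "(\<lambda>y. \<integral>z. of_real (bessel_wave \<nu> (y * z)) * g z \<partial>lborel) \<in> borel_measurable borel"
    by (intro lborel.borel_measurable_lebesgue_integral) (simp add: case_prod_beta')
  have "(\<lambda>y. indicator {0<..} y *\<^sub>R hankel \<nu> f y) = (\<lambda>y. indicator {0<..} y *\<^sub>R (\<integral>z. of_real (bessel_wave \<nu> (y * z)) * g z \<partial>lborel))"
  proof
    fix y :: real
    show "indicator {0<..} y *\<^sub>R hankel \<nu> f y = indicator {0<..} y *\<^sub>R (\<integral>z. of_real (bessel_wave \<nu> (y * z)) * g z \<partial>lborel)"
      using hankel_eq_integral(2)[OF assms, of y] by (cases "y > 0") (auto simp: set_lebesgue_integral_def g_def)
  qed
  also have "\<dots> \<in> borel_measurable borel" using m by (intro borel_measurable_scaleR) auto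
  finally show ?thesis .
qed

text \<open>The Bessel operator is symmetric, and \<open>z \<mapsto> bessel_wave \<nu> (x * z)\<close> is an eigenfunction with
eigenvalue \<open>x\<^sup>2\<close>.\<close>
lemma hankel_by_parts:
  assumes \<nu>: "\<nu> > -1" and x: "x > 0"
  shows "x\<^sup>2 *\<^sub>R hankel \<nu> f x = integral {a..b} (\<lambda>z. bessel_wave \<nu> (x * z) *\<^sub>R (((\<nu>\<^sup>2 - 1/4) / z\<^sup>2) *\<^sub>R f z - D 2 z))"
proof -
  let ?K = "\<lambda>z. bessel_wave \<nu> (x * z)" and ?K' = "\<lambda>z. x * bessel_wave' \<nu> (x * z)"
  \<comment> \<open>the Wronskian of the kernel and \<open>f\<close>\<close>
  define \<Theta> where "\<Theta> z = ?K' z *\<^sub>R f z - ?K z *\<^sub>R D 1 z" for z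
  define c where "c = \<nu>\<^sup>2 - 1/4"
  define I1 where "I1 z = ?K z *\<^sub>R f z" for z
  define I2 where "I2 z = ?K z *\<^sub>R ((c / z\<^sup>2) *\<^sub>R f z - D 2 z)" for z
  have "(\<Theta> has_vector_derivative (I2 z - x\<^sup>2 *\<^sub>R I1 z)) (at z within {a..b})" if z: "z \<in> {a..b}" for z
  proof -
    have z0: "z > 0" "x * z > 0" using z a_pos x by auto
    have xz: "((\<lambda>z. x * z) has_real_derivative x) (at z)" by (auto intro!: derivative_eq_intros)
    have K: "(?K has_real_derivative ?K' z) (at z)"
      using DERIV_chain2[where f = "bessel_wave \<nu>" and g = "\<lambda>z. x * z" and x = z, OF has_real_derivative_bessel_wave[OF \<nu> z0(2)] xz]
      by (simp add: mult.commute)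
    have K': "(?K' has_real_derivative x * (((c / (x * z)\<^sup>2 - 1) * ?K z) * x)) (at z)"
      by (rule DERIV_cmult, rule DERIV_chain2[where f = "bessel_wave' \<nu>" and g = "\<lambda>z. x * z" and x = z, OF _ xz])
         (use bessel_wave_ode[OF \<nu> z0(2)] in \<open>simp add: c_def\<close>)
    have f': "(f has_vector_derivative D 1 z) (at z)" using D_Suc[OF z0(1), of 0] by (simp add: D_0)
    have D1': "(D 1 has_vector_derivative D 2 z) (at z)" using D_Suc[OF z0(1), of 1] by (simp add: numeral_2_eq_2)
    have "(\<Theta> has_vector_derivative ((?K' z *\<^sub>R D 1 z + (x * (((c / (x * z)\<^sup>2 - 1) * ?K z) * x)) *\<^sub>R f z)
        - (?K z *\<^sub>R D 2 z + ?K' z *\<^sub>R D 1 z))) (at z)"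
      unfolding \<Theta>_def[abs_def]
      by (intro has_vector_derivative_diff has_vector_derivative_scaleR K K' f' D1')
    also have "(?K' z *\<^sub>R D 1 z + (x * (((c / (x * z)\<^sup>2 - 1) * ?K z) * x)) *\<^sub>R f z) - (?K z *\<^sub>R D 2 z + ?K' z *\<^sub>R D 1 z)
       = I2 z - x\<^sup>2 *\<^sub>R I1 z"
    proof -
      have "x * (((c / (x * z)\<^sup>2 - 1) * ?K z) * x) = ?K z * (c / z\<^sup>2) - x\<^sup>2 * ?K z"
        using x z0 by (simp add: field_simps power2_eq_square)
      thus ?thesis by (simp only:) (simp add: I1_def I2_def algebra_simps)
    qed
    finally show ?thesis by (rule has_vector_derivative_at_within)
  qed
  hence FTC: "((\<lambda>z. I2 z - x\<^sup>2 *\<^sub>R I1 z) has_integral (\<Theta> b - \<Theta> a)) {a..b}"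
    using a_less_b by (intro fundamental_theorem_of_calculus) auto
  have "\<Theta> b = 0" "\<Theta> a = 0"
    using vanish[of b 0] vanish[of b 1] vanish[of a 0] vanish[of a 1] a_pos a_less_b by (auto simp: \<Theta>_def D_0)
  with FTC have FTC: "((\<lambda>z. I2 z - x\<^sup>2 *\<^sub>R I1 z) has_integral 0) {a..b}" by simp
  have i1: "I1 integrable_on {a..b}" unfolding I1_def
    using wave_times_D_continuous[OF \<nu> x, of 0] by (intro integrable_continuous_real) (simp add: D_0)
  have "((\<lambda>z. (I2 z - x\<^sup>2 *\<^sub>R I1 z) + x\<^sup>2 *\<^sub>R I1 z) has_integral (0 + x\<^sup>2 *\<^sub>R integral {a..b} I1)) {a..b}"
    by (intro has_integral_add FTC has_integral_cmul integrable_integral i1)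
  hence "(I2 has_integral (x\<^sup>2 *\<^sub>R integral {a..b} I1)) {a..b}" by simp
  thus ?thesis using hankel_eq_integral(1)[OF \<nu> x] by (simp add: integral_unique I1_def[abs_def] I2_def[abs_def] c_def)
qed

text \<open>The kernel is bounded and \<open>f\<close> has compact support; for the second bound the same is applied to the
image of \<open>f\<close> under the Bessel operator.\<close>
lemma hankel_decay:
  assumes \<nu>: "\<nu> > - (1/2)"
  obtains C where "C \<ge> 0" "\<And>x. x > 0 \<Longrightarrow> norm (hankel \<nu> f x) \<le> C" "\<And>x. x > 0 \<Longrightarrow> norm (hankel \<nu> f x) \<le> C / x\<^sup>2"
proof -
  have \<nu>': "\<nu> > -1" using \<nu> by simp
  from bessel_wave_bounded[OF \<nu>] obtain K where K: "K > 0" "\<And>z. z > 0 \<Longrightarrow> \<bar>bessel_wave \<nu> z\<bar> \<le> K" by blast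
  obtain M0 where M0: "M0 \<ge> 0" "\<And>x. x > 0 \<Longrightarrow> norm (D 0 x) \<le> M0" using D_bounded[of 0] by blast
  obtain M2 where M2: "M2 \<ge> 0" "\<And>x. x > 0 \<Longrightarrow> norm (D 2 x) \<le> M2" using D_bounded[of 2] by blast
  define N where "N = \<bar>\<nu>\<^sup>2 - 1/4\<bar> / a\<^sup>2 * M0 + M2"
  have N: "N \<ge> 0" using M0 M2 by (auto simp: N_def)
  define C where "C = K * (M0 + N) * (b - a)"
  have C: "K * M0 * (b - a) \<le> C" "K * N * (b - a) \<le> C" "C \<ge> 0"
    using K(1) M0(1) N a_less_b unfolding C_def by (auto intro!: mult_right_mono mult_left_mono)
  have b1: "norm (hankel \<nu> f x) \<le> C" if x: "x > 0" for x
  proof -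
    have "norm (hankel \<nu> f x) \<le> K * M0 * (b - a)"
      unfolding hankel_eq_integral(1)[OF \<nu>' x]
    proof (rule integral_bound)
      show "continuous_on {a..b} (\<lambda>z. bessel_wave \<nu> (x * z) *\<^sub>R f z)" using wave_times_D_continuous[OF \<nu>' x, of 0] by (simp add: D_0)
      fix z assume "z \<in> {a..b}"
      hence "z > 0" using a_pos by auto
      thus "norm (bessel_wave \<nu> (x * z) *\<^sub>R f z) \<le> K * M0"
        using K x M0(2)[of z] by (auto simp: D_0 intro!: mult_mono)
    qed (use a_less_b in auto)
    thus ?thesis using C by linarith
  qed
  have b2: "norm (hankel \<nu> f x) \<le> C / x\<^sup>2" if x: "x > 0" for x
  proof -
    have "norm (x\<^sup>2 *\<^sub>R hankel \<nu> f x) \<le> K * N * (b - a)"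
      unfolding hankel_by_parts[OF \<nu>' x]
    proof (rule integral_bound)
      have "continuous_on {a..b} (\<lambda>z. ((\<nu>\<^sup>2 - 1/4) / z\<^sup>2) *\<^sub>R (bessel_wave \<nu> (x * z) *\<^sub>R D 0 z) - bessel_wave \<nu> (x * z) *\<^sub>R D 2 z)"
        using a_pos by (intro continuous_intros wave_times_D_continuous \<nu>' x) auto
      thus "continuous_on {a..b} (\<lambda>z. bessel_wave \<nu> (x * z) *\<^sub>R (((\<nu>\<^sup>2 - 1/4) / z\<^sup>2) *\<^sub>R f z - D 2 z))"
        by (simp add: D_0 scaleR_diff_right mult.commute)
      fix z assume z: "z \<in> {a..b}"
      hence z0: "z > 0" using a_pos by auto
      have "a\<^sup>2 \<le> z\<^sup>2" using z a_pos by (intro power_mono) auto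
      hence "\<bar>(\<nu>\<^sup>2 - 1/4) / z\<^sup>2\<bar> \<le> \<bar>\<nu>\<^sup>2 - 1/4\<bar> / a\<^sup>2" using a_pos z0 by (auto simp: abs_divide intro!: divide_left_mono)
      hence "\<bar>(\<nu>\<^sup>2 - 1/4) / z\<^sup>2\<bar> * norm (f z) \<le> \<bar>\<nu>\<^sup>2 - 1/4\<bar> / a\<^sup>2 * M0"
        using M0(2)[OF z0] by (intro mult_mono) (auto simp: D_0)
      hence "norm (((\<nu>\<^sup>2 - 1/4) / z\<^sup>2) *\<^sub>R f z - D 2 z) \<le> N"
        using norm_triangle_ineq4[of "((\<nu>\<^sup>2 - 1/4) / z\<^sup>2) *\<^sub>R f z" "D 2 z"] M2(2)[OF z0]
        unfolding N_def norm_scaleR by linarith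
      moreover have "\<bar>bessel_wave \<nu> (x * z)\<bar> \<le> K" using K(2) x z0 by simp
      ultimately show "norm (bessel_wave \<nu> (x * z) *\<^sub>R (((\<nu>\<^sup>2 - 1/4) / z\<^sup>2) *\<^sub>R f z - D 2 z)) \<le> K * N"
        unfolding norm_scaleR using K(1) by (intro mult_mono) auto
    qed (use a_less_b in auto)
    hence "x\<^sup>2 * norm (hankel \<nu> f x) \<le> C" using C by simp
    thus ?thesis using x by (simp add: field_simps)
  qed
  show ?thesis using that[OF C(3)] b1 b2 by blast
qed

end

text \<open>Boundedness near 0 and decay of order 2 at infinity leave room for \<open>y powr (2 s)\<close> with
\<open>\<bar>s\<bar> < 1/2\<close>.\<close>
lemma integrable_square_exp_family:
  fixes \<phi> :: "real \<Rightarrow> complex"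
  assumes [measurable]: "\<phi> \<in> borel_measurable borel" and zero: "\<And>y. y \<le> 0 \<Longrightarrow> \<phi> y = 0"
    and bnd: "\<And>y. y > 0 \<Longrightarrow> norm (\<phi> y) \<le> C" "\<And>y. y > 0 \<Longrightarrow> norm (\<phi> y) \<le> C / y\<^sup>2"
    and s: "\<bar>s\<bar> < 1/2"
  shows "integrable lborel (\<lambda>y. exp (s * (2 * ln y)) *\<^sub>R \<phi> y)"
proof (rule Bochner_Integration.integrable_bound)
  have "C \<ge> 0" using bnd(1)[of 1] norm_ge_zero[of "\<phi> 1"] by linarith
  show "integrable lborel (\<lambda>y. C * (indicator {0<..1} y *\<^sub>R y powr (2 * s)) + C * (indicator {1..} y *\<^sub>R y powr (2 * s - 2)))"
    using set_integrable_powr_0_1[of "2 * s"] set_integrable_powr_1_inf[of "2 * s - 2"] s unfolding set_integrable_def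
    by (intro Bochner_Integration.integrable_add integrable_mult_right) auto
  show "AE y in lborel. norm (exp (s * (2 * ln y)) *\<^sub>R \<phi> y) \<le> norm (C * (indicator {0<..1} y *\<^sub>R y powr (2 * s)) + C * (indicator {1..} y *\<^sub>R y powr (2 * s - 2)))"
  proof (rule AE_I2)
    fix y :: real
    have e: "exp (s * (2 * ln y)) = y powr (2 * s)" if "y > 0" using that by (simp add: powr_def mult_ac)
    consider "y \<le> 0" | "0 < y" "y \<le> 1" | "y > 1" by linarith
    thus "norm (exp (s * (2 * ln y)) *\<^sub>R \<phi> y) \<le> norm (C * (indicator {0<..1} y *\<^sub>R y powr (2 * s)) + C * (indicator {1..} y *\<^sub>R y powr (2 * s - 2)))"
    proof cases
      case 1 thus ?thesis by (simp add: zero)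
    next
      case 2
      have "norm (exp (s * (2 * ln y)) *\<^sub>R \<phi> y) \<le> C * y powr (2 * s)"
        using mult_left_mono[OF bnd(1)[OF 2(1)], of "y powr (2 * s)"] unfolding norm_scaleR e[OF 2(1)] by (simp add: mult.commute)
      also have "\<dots> \<le> C * y powr (2 * s) + C * (indicator {1..} y *\<^sub>R y powr (2 * s - 2))" using \<open>C \<ge> 0\<close> by simp
      finally show ?thesis using 2 \<open>C \<ge> 0\<close> by simp
    next
      case 3
      hence y: "y > 0" by simp
      have "norm (exp (s * (2 * ln y)) *\<^sub>R \<phi> y) \<le> y powr (2 * s) * (C / y\<^sup>2)"
        using mult_left_mono[OF bnd(2)[OF y], of "y powr (2 * s)"] unfolding norm_scaleR e[OF y] by simp
      also have "\<dots> = C * y powr (2 * s - 2)" using y by (simp add: powr_diff)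
      finally show ?thesis using 3 \<open>C \<ge> 0\<close> by simp
    qed
  qed
qed measurable

section \<open>Powers and logarithms as moments of one density\<close>

lemma (in test_function) heat_kernel_splitting_exists:
  assumes \<nu>: "\<nu> > - (1/2)" and x: "x > 0"
  obtains L c where "heat_kernel_splitting \<nu> x L c f"
proof -
  obtain L1 where L1: "L1 \<ge> 0" "\<And>x y. x > 0 \<Longrightarrow> y > 0 \<Longrightarrow> norm (f y - f x) \<le> L1 * \<bar>x - y\<bar>" using Lipschitz by blast
  obtain M where M: "M \<ge> 0" "\<And>x. x > 0 \<Longrightarrow> norm (D 0 x) \<le> M" using D_bounded[of 0] by blast
  have "heat_kernel_splitting \<nu> x (L1 + M) (max b (x + 1)) f"
  proof
    show "\<nu> > - (1/2)" "x > 0" "x + 1 \<le> max b (x + 1)" using assms by auto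
    show "(\<lambda>y. indicator {0<..} y *\<^sub>R f y) \<in> borel_measurable borel" by (rule f_measurable)
    show "f y = 0" if "y > max b (x + 1)" for y using vanish[of y 0] that x by (simp add: D_0)
    show "norm (f y) \<le> L1 + M" if "y > 0" for y using M(2)[OF that] L1 by (simp add: D_0)
    show "norm (f y - indicator (pos_ball x 1) y * f x) \<le> (L1 + M) * \<bar>x - y\<bar>" if y: "y > 0" for y
    proof (cases "y \<in> pos_ball x 1")
      case True
      have "norm (f y - f x) \<le> L1 * \<bar>x - y\<bar>" using L1(2)[OF x y] .
      also have "\<dots> \<le> (L1 + M) * \<bar>x - y\<bar>" using M by (intro mult_right_mono) auto
      finally show ?thesis using True by simp
    next
      case False
      hence far: "1 \<le> \<bar>x - y\<bar>" using y by (auto simp: pos_ball_def abs_if split: if_splits)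
      have "norm (f y) \<le> M * 1" using M(2)[OF y] by (simp add: D_0)
      also have "\<dots> \<le> (L1 + M) * \<bar>x - y\<bar>" using M L1 far by (intro mult_mono) auto
      finally show ?thesis using False by simp
    qed
  qed
  thus ?thesis by (rule that)
qed

lemma (in test_function) f_in_L2: "f \<in> L2_pos"
proof -
  have "continuous_on {a..b} (D 0)" using a_pos by (intro continuous_on_subset[OF D_continuous]) auto
  hence "set_integrable lborel {a..b} (\<lambda>y. (norm (f y))\<^sup>2)"
    by (intro borel_integrable_atLeastAtMost' continuous_intros) (simp add: D_0)
  also have "?this \<longleftrightarrow> set_integrable lborel {0<..} (\<lambda>y. (norm (f y))\<^sup>2)"
    unfolding set_integrable_def
  proof (rule arg_cong[where f = "integrable lborel"], rule ext)
    fix y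
    show "indicator {a..b} y *\<^sub>R (cmod (f y))\<^sup>2 = indicator {0<..} y *\<^sub>R (cmod (f y))\<^sup>2"
      using vanish[of y 0] a_pos by (cases "y \<in> {a..b}") (auto simp: D_0 indicator_def)
  qed
  finally show ?thesis using f_measurable by (simp add: L2_pos_def set_borel_measurable_def)
qed

text \<open>The density \<open>\<phi>\<close> here is the squared modulus of the transform; \<open>y powr (2 s)\<close> becomes
\<open>y powr (4 s)\<close> when squared, which halves the admitted range of \<open>s\<close>.\<close>
lemma (in test_function) hankel_in_L2:
  assumes \<nu>: "\<nu> > - (1/2)"
  shows "\<bar>s\<bar> < 1/4 \<Longrightarrow> (\<lambda>y. of_real (y powr (2 * s)) * hankel \<nu> f y) \<in> L2_pos"
    and "(\<lambda>y. of_real ((2 * ln y) ^ m) * hankel \<nu> f y) \<in> L2_pos"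
proof -
  define g where "g y = indicator {0<..} y *\<^sub>R hankel \<nu> f y" for y
  have g [measurable]: "g \<in> borel_measurable borel" using hankel_measurable[of \<nu>] \<nu> by (simp add: g_def[abs_def])
  obtain C where C: "C \<ge> 0" "\<And>x. x > 0 \<Longrightarrow> norm (hankel \<nu> f x) \<le> C" "\<And>x. x > 0 \<Longrightarrow> norm (hankel \<nu> f x) \<le> C / x\<^sup>2"
    using hankel_decay[OF \<nu>] by blast
  define \<phi> where "\<phi> y = complex_of_real ((norm (g y))\<^sup>2)" for y
  have \<phi>m [measurable]: "\<phi> \<in> borel_measurable borel" unfolding \<phi>_def by measurable
  have int: "integrable lborel (\<lambda>y. exp (s * (2 * ln y)) *\<^sub>R \<phi> y)" if "\<bar>s\<bar> < 1/2" for s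
  proof (rule integrable_square_exp_family[OF \<phi>m _ _ _ that])
    fix y :: real assume y: "y > 0"
    have g: "norm (g y) \<le> C" "norm (g y) \<le> C / y\<^sup>2" using C(2)[OF y] C(3)[OF y] y by (simp_all add: g_def)
    have "norm (g y) * norm (g y) \<le> C * C" "norm (g y) * norm (g y) \<le> C * (C / y\<^sup>2)"
      using mult_mono[OF g(1) g(1) C(1) norm_ge_zero] mult_mono[OF g(1) g(2) C(1) norm_ge_zero] by simp_all
    thus "norm (\<phi> y) \<le> C * C" "norm (\<phi> y) \<le> C * C / y\<^sup>2" by (simp_all add: \<phi>_def power2_eq_square norm_mult)
  qed (auto simp: \<phi>_def g_def)
  have L2: "(\<lambda>y. of_real (h y) * hankel \<nu> f y) \<in> L2_pos"
    if [measurable]: "h \<in> borel_measurable borel" and i: "integrable lborel (\<lambda>y. (h y)\<^sup>2 *\<^sub>R \<phi> y)" for h :: "real \<Rightarrow> real"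
  proof -
    have m: "(\<lambda>y. indicator {0<..} y *\<^sub>R (of_real (h y) * hankel \<nu> f y)) = (\<lambda>y. of_real (h y) * g y)"
      by (auto simp: g_def)
    have n: "(\<lambda>y. indicator {0<..} y *\<^sub>R (cmod (of_real (h y) * hankel \<nu> f y))\<^sup>2) = (\<lambda>y. Re ((h y)\<^sup>2 *\<^sub>R \<phi> y))"
      by (auto simp: g_def \<phi>_def norm_mult power_mult_distrib fun_eq_iff indicator_def)
    have "integrable lborel (\<lambda>y. Re ((h y)\<^sup>2 *\<^sub>R \<phi> y))" using i by (rule integrable_Re)
    thus ?thesis unfolding L2_pos_def set_borel_measurable_def set_integrable_def mem_Collect_eq m n by simp
  qed
  show "(\<lambda>y. of_real (y powr (2 * s)) * hankel \<nu> f y) \<in> L2_pos" if "\<bar>s\<bar> < 1/4"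
  proof (rule L2)
    have "(\<lambda>y. (y powr (2 * s))\<^sup>2 *\<^sub>R \<phi> y) = (\<lambda>y. exp ((2 * s) * (2 * ln y)) *\<^sub>R \<phi> y)"
      by (auto simp: fun_eq_iff \<phi>_def g_def indicator_def powr_def power2_eq_square mult_exp_exp mult_ac)
    thus "integrable lborel (\<lambda>y. (y powr (2 * s))\<^sup>2 *\<^sub>R \<phi> y)" using int[of "2 * s"] that by simp
  qed measurable
  show "(\<lambda>y. of_real ((2 * ln y) ^ m) * hankel \<nu> f y) \<in> L2_pos"
  proof (rule L2)
    have "integrable lborel (\<lambda>y. ((2 * ln y) ^ (2 * m) * exp (0 * (2 * ln y))) *\<^sub>R \<phi> y)"
      by (rule integrable_power_exp_family[where \<epsilon> = "1/2"]) (use int in auto)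
    thus "integrable lborel (\<lambda>y. ((2 * ln y) ^ m)\<^sup>2 *\<^sub>R \<phi> y)" by (simp add: power_even_eq)
  qed measurable
qed

locale log_formula = test_function f D a b + heat_kernel_splitting \<nu> x L c f
  for f D a b \<nu> x L c
begin

text \<open>The density on the spectral side. Every multiplier of the Hankel transform, applied to \<open>f\<close> and
evaluated at \<open>x\<close>, is the integral of the multiplier against \<open>\<phi>\<close> (\<open>hankel_multiplier\<close>).\<close>
definition \<phi> :: "real \<Rightarrow> complex" where
  "\<phi> y = indicator {0<..} y *\<^sub>R (of_real (bessel_wave \<nu> (x * y)) * hankel \<nu> f y)"

lemma \<nu>': "\<nu> > -1" using \<nu> by simp

lemma \<phi>_measurable [measurable]: "\<phi> \<in> borel_measurable borel"
proof -
  define g where "g y = indicator {0<..} y *\<^sub>R hankel \<nu> f y" for y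
  have [measurable]: "g \<in> borel_measurable borel" using hankel_measurable[OF \<nu>'] by (simp add: g_def[abs_def])
  have "\<phi> = (\<lambda>y. of_real (bessel_wave \<nu> (x * y)) * g y)" by (auto simp: \<phi>_def g_def fun_eq_iff)
  thus ?thesis by simp
qed

lemma integrable_\<phi>:
  assumes "\<bar>s\<bar> < 1/2" shows "integrable lborel (\<lambda>y. exp (s * (2 * ln y)) *\<^sub>R \<phi> y)"
proof -
  from bessel_wave_bounded[OF \<nu>] obtain K where K: "K > 0" "\<And>z. z > 0 \<Longrightarrow> \<bar>bessel_wave \<nu> z\<bar> \<le> K" by blast
  obtain C where C: "C \<ge> 0" "\<And>x. x > 0 \<Longrightarrow> norm (hankel \<nu> f x) \<le> C" "\<And>x. x > 0 \<Longrightarrow> norm (hankel \<nu> f x) \<le> C / x\<^sup>2"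
    using hankel_decay[OF \<nu>] by blast
  show ?thesis
  proof (rule integrable_square_exp_family[OF \<phi>_measurable _ _ _ assms])
    fix y :: real assume y: "y > 0"
    have k: "\<bar>bessel_wave \<nu> (x * y)\<bar> \<le> K" using K(2) x y by simp
    have "norm (\<phi> y) = \<bar>bessel_wave \<nu> (x * y)\<bar> * norm (hankel \<nu> f y)" using y by (simp add: \<phi>_def norm_mult)
    moreover have "\<dots> \<le> K * C" "\<dots> \<le> K * (C / y\<^sup>2)"
      using mult_mono[OF k C(2)[OF y]] mult_mono[OF k C(3)[OF y]] K(1) by simp_all
    ultimately show "norm (\<phi> y) \<le> K * C" "norm (\<phi> y) \<le> K * C / y\<^sup>2" by simp_all
  qed (auto simp: \<phi>_def)
qed

lemma integrable_\<phi>_0: "integrable lborel \<phi>"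
  using integrable_\<phi>[of 0] by simp

text \<open>The \<open>n\<close>-th derivative in \<open>s\<close> of the \<open>s\<close>-th power of the Bessel operator, applied to \<open>f\<close> and
evaluated at \<open>x\<close>.\<close>
definition G :: "nat \<Rightarrow> real \<Rightarrow> complex" where
  "G n s = (\<integral>y. ((2 * ln y) ^ n * exp (s * (2 * ln y))) *\<^sub>R \<phi> y \<partial>lborel)"

lemma G_deriv: "\<bar>s\<bar> < 1/2 \<Longrightarrow> (G n has_vector_derivative G (Suc n) s) (at s)"
  unfolding G_def[abs_def] by (rule has_vector_derivative_exp_family[where \<epsilon> = "1/2"]) (auto intro: integrable_\<phi>)

lemma hankel_multiplier:
  assumes "integrable lborel (\<lambda>y. h y *\<^sub>R \<phi> y)"
  shows "hankel \<nu> (\<lambda>y. of_real (h y) * hankel \<nu> f y) x = (\<integral>y. h y *\<^sub>R \<phi> y \<partial>lborel)"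
proof -
  have eq: "(\<lambda>y. indicator {0<..} y *\<^sub>R (of_real (hankel_kernel \<nu> x y) * (of_real (h y) * hankel \<nu> f y))) = (\<lambda>y. h y *\<^sub>R \<phi> y)"
    by (auto simp: fun_eq_iff \<phi>_def hankel_kernel_eq scaleR_conv_of_real)
  have "set_integrable lborel {0<..} (\<lambda>y. of_real (hankel_kernel \<nu> x y) * (of_real (h y) * hankel \<nu> f y))"
    using assms unfolding set_integrable_def eq .
  hence "hankel \<nu> (\<lambda>y. of_real (h y) * hankel \<nu> f y) x = hankel_integral \<nu> (\<lambda>y. of_real (h y) * hankel \<nu> f y) x"
    by (simp only: hankel_def[of \<nu> "\<lambda>y. of_real (h y) * hankel \<nu> f y"] if_True)
  thus ?thesis by (simp only: hankel_integral_def set_lebesgue_integral_def eq)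
qed

lemma bessel_log_eq: "bessel_log \<nu> m f x = G m 0"
proof -
  have "integrable lborel (\<lambda>y. ((2 * ln y) ^ m * exp (0 * (2 * ln y))) *\<^sub>R \<phi> y)"
    by (rule integrable_power_exp_family[where \<epsilon> = "1/2"]) (auto intro: integrable_\<phi>)
  hence "integrable lborel (\<lambda>y. ((2 * ln y) ^ m) *\<^sub>R \<phi> y)" by simp
  from hankel_multiplier[OF this] show ?thesis by (simp add: bessel_log_def G_def)
qed

lemma bessel_pow_eq:
  assumes "s \<noteq> 0" "\<bar>s\<bar> < 1/2" shows "bessel_pow \<nu> s f x = G 0 s"
proof -
  have eq: "(\<lambda>y. (y powr (2 * s)) *\<^sub>R \<phi> y) = (\<lambda>y. exp (s * (2 * ln y)) *\<^sub>R \<phi> y)"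
    by (auto simp: fun_eq_iff \<phi>_def powr_def indicator_def mult_ac)
  have "integrable lborel (\<lambda>y. (y powr (2 * s)) *\<^sub>R \<phi> y)" unfolding eq by (rule integrable_\<phi>[OF assms(2)])
  from hankel_multiplier[OF this] show ?thesis using assms(1) unfolding eq by (simp add: bessel_pow_def G_def)
qed

text \<open>By Weber's integral the heat kernel is \<open>\<integral> exp (- t z\<^sup>2) K(x z) K(y z) dz\<close> with \<open>K = bessel_wave \<nu>\<close>;
integrating over \<open>y\<close> first produces the Hankel transform of \<open>f\<close>.\<close>
lemma heat_flow_eq:
  assumes t: "t > 0" shows "heat_flow t = (\<integral>z. exp (- (t * z\<^sup>2)) *\<^sub>R \<phi> z \<partial>lborel)"
proof -
  from bessel_wave_bounded[OF \<nu>] obtain K where K: "K > 0" "\<And>z. z > 0 \<Longrightarrow> \<bar>bessel_wave \<nu> z\<bar> \<le> K" by blast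
  obtain M where M: "M \<ge> 0" "\<And>x. x > 0 \<Longrightarrow> norm (D 0 x) \<le> M" using D_bounded[of 0] by blast
  define F where "F = (\<lambda>(y, z). of_real (exp (- (t * z\<^sup>2)) * (bessel_wave \<nu> (x * z) * bessel_wave \<nu> (y * z))) * f y)"
  have I: "set_integrable (lborel \<Otimes>\<^sub>M lborel) ({0<..} \<times> {0<..}) F"
  proof (rule set_integrable_prod_dominated[where g = "\<lambda>z y. M * indicator {a..b} y" and w = "\<lambda>z. K * K * (z powr (2 * (1/2) - 1) * exp (- (t * z\<^sup>2)))" and K = "M * (b - a)"])
    define g where "g y = indicator {0<..} y *\<^sub>R f y" for y
    have [measurable]: "g \<in> borel_measurable borel" using f_measurable by (simp add: g_def[abs_def])
    have "(\<lambda>p. indicator ({0<..} \<times> {0<..}) p *\<^sub>R F p) = (\<lambda>p. indicator {0<..} (snd p) *\<^sub>R 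
       (of_real (exp (- (t * (snd p)\<^sup>2)) * (bessel_wave \<nu> (x * snd p) * bessel_wave \<nu> (fst p * snd p))) * g (fst p)))"
      by (auto simp: fun_eq_iff F_def g_def indicator_def)
    also have "\<dots> \<in> borel_measurable (borel \<Otimes>\<^sub>M borel)" by measurable
    finally show "set_borel_measurable (lborel \<Otimes>\<^sub>M lborel) ({0<..} \<times> {0<..}) F" by (simp add: set_borel_measurable_def)
    show "set_integrable lborel {0<..} (\<lambda>z. K * K * (z powr (2 * (1/2) - 1) * exp (- (t * z\<^sup>2))))"
      by (intro set_integrable_mult_right set_integrable_Gaussian_moment t) auto
    fix z :: real assume z: "z \<in> {0<..}"
    show "(\<integral>\<^sup>+y. ennreal (M * indicator {a..b} y) \<partial>lborel) \<le> ennreal (M * (b - a))"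
      using M(1) a_less_b by (subst nn_integral_eq_integral) auto
    show "0 \<le> K * K * (z powr (2 * (1/2) - 1) * exp (- (t * z\<^sup>2)))" using K(1) by simp
    fix y :: real assume y: "y \<in> {0<..}"
    have p1: "\<bar>bessel_wave \<nu> (x * z)\<bar> * \<bar>bessel_wave \<nu> (y * z)\<bar> \<le> K * K"
      using K y z x by (intro mult_mono) auto
    have p2: "norm (f y) \<le> M * indicator {a..b} y"
      using M(2)[of y] vanish[of y 0] y by (auto simp: D_0 indicator_def)
    have "exp (- (t * z\<^sup>2)) * (\<bar>bessel_wave \<nu> (x * z)\<bar> * \<bar>bessel_wave \<nu> (y * z)\<bar>) * norm (f y)
        \<le> exp (- (t * z\<^sup>2)) * (K * K) * (M * indicator {a..b} y)"
      by (rule mult_mono[OF mult_left_mono[OF p1] p2]) (use K(1) in auto)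
    thus "norm (F (y, z)) \<le> M * indicator {a..b} y * (K * K * (z powr (2 * (1/2) - 1) * exp (- (t * z\<^sup>2))))"
      using z by (simp add: F_def norm_mult abs_mult mult_ac)
  qed simp_all
  have "heat_flow t = (LINT y:{0<..}|lborel. LINT z:{0<..}|lborel. F (y, z))"
    unfolding heat_flow_def
  proof (rule set_lebesgue_integral_cong; (intro allI impI)?)
    fix y :: real assume "y \<in> {0<..}"
    hence "W t y = (LINT z:{0<..}|lborel. exp (- (t * z\<^sup>2)) * (bessel_wave \<nu> (x * z) * bessel_wave \<nu> (y * z)))"
      using Weber_second_exponential_integral(2)[OF \<nu>' x _ t, of y] by simp
    thus "of_real (W t y) * f y = (LINT z:{0<..}|lborel. F (y, z))"
      unfolding F_def case_prod_conv set_integral_mult_left set_integral_complex_of_real by simp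
  qed simp
  also have "\<dots> = (LINT z:{0<..}|lborel. LINT y:{0<..}|lborel. F (y, z))" by (rule set_Fubini[OF I])
  also have "\<dots> = (LINT z:{0<..}|lborel. exp (- (t * z\<^sup>2)) *\<^sub>R \<phi> z)"
  proof (rule set_lebesgue_integral_cong; (intro allI impI)?)
    fix z :: real assume z: "z \<in> {0<..}"
    have "(LINT y:{0<..}|lborel. F (y, z)) = (LINT y:{0<..}|lborel. of_real (exp (- (t * z\<^sup>2)) * bessel_wave \<nu> (x * z)) * (of_real (bessel_wave \<nu> (z * y)) * f y))"
      by (simp add: F_def mult_ac)
    also have "\<dots> = of_real (exp (- (t * z\<^sup>2)) * bessel_wave \<nu> (x * z)) * hankel \<nu> f z"
      unfolding set_integral_mult_right using hankel_eq_integral(2)[OF \<nu>', of z] z by simp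
    finally show "(LINT y:{0<..}|lborel. F (y, z)) = exp (- (t * z\<^sup>2)) *\<^sub>R \<phi> z"
      using z by (simp add: \<phi>_def scaleR_conv_of_real)
  qed simp
  also have "\<dots> = (\<integral>z. exp (- (t * z\<^sup>2)) *\<^sub>R \<phi> z \<partial>lborel)"
    unfolding set_lebesgue_integral_def by (rule Bochner_Integration.integral_cong) (simp_all add: \<phi>_def indicator_def)
  finally show ?thesis .
qed

lemma heat_flow_tendsto: "(\<lambda>n. heat_flow (1 / real (n + 2))) \<longlonglongrightarrow> G 0 0"
proof -
  have "(\<lambda>n. \<integral>z. exp (- (1 / real (n + 2) * z\<^sup>2)) *\<^sub>R \<phi> z \<partial>lborel) \<longlonglongrightarrow> (\<integral>z. \<phi> z \<partial>lborel)"
  proof (rule integral_dominated_convergence[where w = "\<lambda>z. norm (\<phi> z)"])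
    show "integrable lborel (\<lambda>z. norm (\<phi> z))" using integrable_\<phi>_0 by (rule integrable_norm)
    show "AE z in lborel. (\<lambda>n. exp (- (1 / real (n + 2) * z\<^sup>2)) *\<^sub>R \<phi> z) \<longlonglongrightarrow> \<phi> z"
    proof (rule AE_I2)
      fix z :: real
      have "(\<lambda>n. 1 / real (n + 2)) \<longlonglongrightarrow> 0" using LIMSEQ_ignore_initial_segment[OF lim_inverse_n', of 2] by simp
      hence "(\<lambda>n. exp (- (1 / real (n + 2) * z\<^sup>2)) *\<^sub>R \<phi> z) \<longlonglongrightarrow> exp (- (0 * z\<^sup>2)) *\<^sub>R \<phi> z" by (intro tendsto_intros)
      thus "(\<lambda>n. exp (- (1 / real (n + 2) * z\<^sup>2)) *\<^sub>R \<phi> z) \<longlonglongrightarrow> \<phi> z" by simp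
    qed
    fix n show "AE z in lborel. norm (exp (- (1 / real (n + 2) * z\<^sup>2)) *\<^sub>R \<phi> z) \<le> norm (\<phi> z)"
      by (rule AE_I2) (simp add: mult_left_le_one_le)
  qed measurable
  thus ?thesis by (simp add: heat_flow_eq G_def)
qed

lemma norm_set_integral_double_heat_le:
  fixes F :: "real \<Rightarrow> 'b::{banach, second_countable_topology}"
  assumes t: "t > 0" and C: "C \<ge> 0" and F: "\<And>y. y \<in> A \<Longrightarrow> norm (F y) \<le> C * early t y"
  shows "norm (LINT y:A|lborel. F y) \<le> 2 * C * sqrt t"
proof (cases "integrable lborel (\<lambda>y. indicator A y *\<^sub>R F y)")
  case True
  have "norm (LINT y:A|lborel. F y) \<le> (\<integral>y. norm (indicator A y *\<^sub>R F y) \<partial>lborel)"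
    unfolding set_lebesgue_integral_def by (rule integral_norm_bound)
  also have "\<dots> \<le> (\<integral>y. C * sqrt t * double_heat t (x - y) \<partial>lborel)"
  proof (rule integral_mono)
    show "integrable lborel (\<lambda>y. norm (indicator A y *\<^sub>R F y))" using True by (rule integrable_norm)
    show "integrable lborel (\<lambda>y. C * sqrt t * double_heat t (x - y))" by (intro integrable_mult_right integrable_double_heat t)
    show "norm (indicator A y *\<^sub>R F y) \<le> C * sqrt t * double_heat t (x - y)" for y
      using F[of y] C t double_heat_nonneg[OF t, of "x - y"] by (cases "y \<in> A") (auto simp: mult.assoc)
  qed
  also have "\<dots> = 2 * C * sqrt t" by (simp add: integral_double_heat[OF t])
  finally show ?thesis .
next
  case False
  thus ?thesis using C t by (simp add: set_lebesgue_integral_def not_integrable_integral_eq)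
qed

lemma defect_le: obtains C where "\<And>t. 0 < t \<Longrightarrow> t < 1 \<Longrightarrow> norm (defect t) \<le> C * sqrt t"
proof (rule kernel_bounds, goal_cases)
  case (1 C)
  note that = 1(1) and C = 1(2-)
  have "norm (defect t) \<le> (2 * C + norm (f x) * (6 * C)) * sqrt t" if t: "0 < t" "t < 1" for t
  proof -
    define i1 where "i1 = (LINT y:{0<..}|lborel. jump y * of_real (W t y))"
    define i2 where "i2 = (LINT y:{0<..} - B|lborel. W t y)"
    define i3 where "i3 = (LINT y:{0<..}|lborel. W t y - E t y)"
    define i4 where "i4 = (LINT y:{..<0}|lborel. E t y)"
    note le = norm_set_integral_double_heat_le[OF t(1) less_imp_le[OF C(1)]]
    have b1: "norm i1 \<le> 2 * C * sqrt t"
      unfolding i1_def by (rule le) (use C(3)[OF t(1)] in \<open>simp add: norm_mult\<close>)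
    have b2: "norm i2 \<le> 2 * C * sqrt t"
      unfolding i2_def by (rule le) (use C(4)[OF t(1)] in simp)
    have b3: "norm i3 \<le> 2 * C * sqrt t"
      unfolding i3_def by (rule le) (use C(5)[OF t(1)] in simp)
    have b4: "norm i4 \<le> 2 * C * sqrt t"
      unfolding i4_def by (rule le) (use C(6)[OF t(1)] euclid_heat_nonneg[OF t(1)] in simp)
    note b = b1 b2 b3 b4
    have "norm (defect t) \<le> norm i1 + norm (f x * of_real (- i2 + i3 - i4))"
      unfolding defect_early[OF t] i1_def i2_def i3_def i4_def by (rule norm_triangle_ineq)
    also have "norm (f x * of_real (- i2 + i3 - i4)) = norm (f x) * \<bar>- i2 + i3 - i4\<bar>" by (simp add: norm_mult del: of_real_diff of_real_add)
    also have "\<dots> \<le> norm (f x) * (6 * C * sqrt t)" using b by (intro mult_left_mono) auto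
    finally show ?thesis using b(1) by (simp add: algebra_simps)
  qed
  thus ?thesis by (rule that)
qed

text \<open>As \<open>t\<close> tends to 0, the heat flow tends to \<open>G 0 0\<close> on the spectral side and to \<open>f x\<close> by the bounds
on the kernel. This is Hankel's inversion formula at the point \<open>x\<close>, and it is what makes
\<open>s \<mapsto> bessel_pow \<nu> s f x\<close> continuous at 0.\<close>
lemma Hankel_inversion: "G 0 0 = f x"
proof -
  obtain C where C: "\<And>t. 0 < t \<Longrightarrow> t < 1 \<Longrightarrow> norm (defect t) \<le> C * sqrt t" using defect_le by blast
  have "(\<lambda>n. defect (1 / real (n + 2))) \<longlonglongrightarrow> 0"
  proof (rule Lim_null_comparison)
    show "\<forall>\<^sub>F n in sequentially. norm (defect (1 / real (n + 2))) \<le> C * sqrt (1 / real (n + 2))"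
      by (intro always_eventually allI C) auto
    have "(\<lambda>n. 1 / real (n + 2)) \<longlonglongrightarrow> 0" using LIMSEQ_ignore_initial_segment[OF lim_inverse_n', of 2] by simp
    hence "(\<lambda>n. C * sqrt (1 / real (n + 2))) \<longlonglongrightarrow> C * sqrt 0" by (intro tendsto_intros)
    thus "(\<lambda>n. C * sqrt (1 / real (n + 2))) \<longlonglongrightarrow> 0" by simp
  qed
  hence "(\<lambda>n. defect (1 / real (n + 2)) + f x) \<longlonglongrightarrow> 0 + f x" by (intro tendsto_intros)
  moreover have "defect (1 / real (n + 2)) + f x = heat_flow (1 / real (n + 2))" for n by (simp add: defect_def)
  ultimately have "(\<lambda>n. heat_flow (1 / real (n + 2))) \<longlonglongrightarrow> f x" by simp
  with heat_flow_tendsto show ?thesis by (rule LIMSEQ_unique)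
qed

lemma bessel_pow_eq': "\<bar>s\<bar> < 1/2 \<Longrightarrow> bessel_pow \<nu> s f x = G 0 s"
  using bessel_pow_eq[of s] Hankel_inversion by (cases "s = 0") (auto simp: bessel_pow_def)

text \<open>The Mellin transform of \<open>t \<mapsto> exp (- t z\<^sup>2)\<close> at \<open>\<sigma>\<close> is \<open>Gamma \<sigma> * z powr (- 2 \<sigma>)\<close>, and it may be taken
under the spectral integral.\<close>
lemma Mellin_heat_flow:
  assumes \<sigma>: "0 < \<sigma>" "\<sigma> < 1/2"
  shows "(LINT t:{0<..}|lborel. heat_flow t * of_real (t powr (\<sigma> - 1))) = of_real (Gamma \<sigma>) * G 0 (- \<sigma>)"
proof -
  define F where "F = (\<lambda>(t, z). of_real (exp (- (z\<^sup>2 * t)) * t powr (\<sigma> - 1)) * \<phi> z)"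
  define g where "g z t = z powr (2 * \<sigma>) * (indicator {0<..} t * (exp (- (z\<^sup>2 * t)) * t powr (\<sigma> - 1)))" for z t :: real
  have g_nonneg: "g z t \<ge> 0" for z t by (simp add: g_def)
  have zz: "(z\<^sup>2) powr (- \<sigma>) = z powr (- 2 * \<sigma>)" if "z > 0" for z :: real
  proof -
    have "(z * z) powr (- \<sigma>) = z powr (- \<sigma>) * z powr (- \<sigma>)" by (rule powr_mult)
    thus ?thesis by (simp add: power2_eq_square powr_add[symmetric])
  qed
  have ez: "exp ((- \<sigma>) * (2 * ln z)) = z powr (- 2 * \<sigma>)" if "z > 0" for z :: real using that by (simp add: powr_def mult_ac)
  have gam: "set_integrable lborel {0<..} (\<lambda>t. exp (- (z\<^sup>2 * t)) * t powr (\<sigma> - 1))"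
    "(LINT t:{0<..}|lborel. exp (- (z\<^sup>2 * t)) * t powr (\<sigma> - 1)) = Gamma \<sigma> * z powr (- 2 * \<sigma>)" if "z > 0" for z
    using set_integrable_Gamma_scaled[OF \<sigma>(1), of "z\<^sup>2"] set_integral_Gamma_scaled[OF \<sigma>(1), of "z\<^sup>2"] zz[OF that] that by auto
  have I: "set_integrable (lborel \<Otimes>\<^sub>M lborel) ({0<..} \<times> {0<..}) F"
  proof (rule set_integrable_prod_dominated[where g = g
        and w = "\<lambda>z. z powr (- 2 * \<sigma>) * norm (\<phi> z)" and K = "Gamma \<sigma>"])
    show "set_borel_measurable (lborel \<Otimes>\<^sub>M lborel) ({0<..} \<times> {0<..}) F"
      unfolding set_borel_measurable_def F_def case_prod_beta' by measurable
    show "set_integrable lborel {0<..} (\<lambda>z. z powr (- 2 * \<sigma>) * norm (\<phi> z))"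
    proof -
      have "integrable lborel (\<lambda>z. norm (exp ((- \<sigma>) * (2 * ln z)) *\<^sub>R \<phi> z))"
        using \<sigma> by (intro integrable_norm integrable_\<phi>) auto
      also have "(\<lambda>z. norm (exp ((- \<sigma>) * (2 * ln z)) *\<^sub>R \<phi> z)) = (\<lambda>z. indicator {0<..} z *\<^sub>R (z powr (- 2 * \<sigma>) * norm (\<phi> z)))"
      proof
        fix z :: real show "norm (exp ((- \<sigma>) * (2 * ln z)) *\<^sub>R \<phi> z) = indicator {0<..} z *\<^sub>R (z powr (- 2 * \<sigma>) * norm (\<phi> z))"
          using ez[of z] by (cases "z > 0") (simp_all add: \<phi>_def)
      qed
      finally show ?thesis unfolding set_integrable_def .
    qed
    fix z :: real assume z: "z \<in> {0<..}"
    have i: "integrable lborel (\<lambda>t. g z t)"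
      using gam(1)[of z] z unfolding set_integrable_def g_def by (intro integrable_mult_right) auto
    have "(\<integral>t. g z t \<partial>lborel) = z powr (2 * \<sigma>) * (Gamma \<sigma> * z powr (- 2 * \<sigma>))"
      using gam(2)[of z] z unfolding set_lebesgue_integral_def g_def by simp
    also have "\<dots> = Gamma \<sigma>" using z by (simp add: powr_minus)
    finally show "(\<integral>\<^sup>+t. ennreal (g z t) \<partial>lborel) \<le> ennreal (Gamma \<sigma>)"
      using i by (subst nn_integral_eq_integral) (auto simp: g_nonneg)
    show "0 \<le> z powr (- 2 * \<sigma>) * norm (\<phi> z)" by simp
    fix t :: real assume t: "t \<in> {0<..}"
    show "norm (F (t, z)) \<le> g z t * (z powr (- 2 * \<sigma>) * norm (\<phi> z))"
    proof -
      have one: "z powr (2 * \<sigma>) * z powr (- 2 * \<sigma>) = 1" using z by (simp add: powr_minus)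
      have "norm (F (t, z)) = (z powr (2 * \<sigma>) * z powr (- 2 * \<sigma>)) * (exp (- (z\<^sup>2 * t)) * t powr (\<sigma> - 1) * norm (\<phi> z))"
        unfolding one by (simp add: F_def norm_mult)
      also have "\<dots> = g z t * (z powr (- 2 * \<sigma>) * norm (\<phi> z))"
        using t by (simp only: g_def indicator_simps(1) mult_1 mult_ac)
      finally show ?thesis by simp
    qed
  qed (auto simp: g_def case_prod_beta')
  have "(LINT t:{0<..}|lborel. heat_flow t * of_real (t powr (\<sigma> - 1))) = (LINT t:{0<..}|lborel. LINT z:{0<..}|lborel. F (t, z))"
  proof (rule set_lebesgue_integral_cong; (intro allI impI)?)
    fix t :: real assume "t \<in> {0<..}"
    hence "heat_flow t = (\<integral>z. exp (- (t * z\<^sup>2)) *\<^sub>R \<phi> z \<partial>lborel)" by (simp add: heat_flow_eq)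
    also have "\<dots> = (LINT z:{0<..}|lborel. exp (- (t * z\<^sup>2)) *\<^sub>R \<phi> z)"
      unfolding set_lebesgue_integral_def by (rule Bochner_Integration.integral_cong) (simp_all add: \<phi>_def indicator_def)
    finally have "heat_flow t * of_real (t powr (\<sigma> - 1)) = (LINT z:{0<..}|lborel. exp (- (t * z\<^sup>2)) *\<^sub>R \<phi> z * of_real (t powr (\<sigma> - 1)))"
      by (simp only: set_integral_mult_left)
    thus "heat_flow t * of_real (t powr (\<sigma> - 1)) = (LINT z:{0<..}|lborel. F (t, z))"
      by (simp add: F_def scaleR_conv_of_real mult_ac)
  qed simp
  also have "\<dots> = (LINT z:{0<..}|lborel. LINT t:{0<..}|lborel. F (t, z))" by (rule set_Fubini[OF I])
  also have "\<dots> = (LINT z:{0<..}|lborel. of_real (Gamma \<sigma>) * (exp ((- \<sigma>) * (2 * ln z)) *\<^sub>R \<phi> z))"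
  proof (rule set_lebesgue_integral_cong; (intro allI impI)?)
    fix z :: real assume z: "z \<in> {0<..}"
    have "(LINT t:{0<..}|lborel. F (t, z)) = of_real (Gamma \<sigma> * z powr (- 2 * \<sigma>)) * \<phi> z"
      unfolding F_def case_prod_conv set_integral_mult_left set_integral_complex_of_real using gam(2)[of z] z by simp
    thus "(LINT t:{0<..}|lborel. F (t, z)) = of_real (Gamma \<sigma>) * (exp ((- \<sigma>) * (2 * ln z)) *\<^sub>R \<phi> z)"
      using ez[of z] z by (simp add: scaleR_conv_of_real)
  qed simp
  also have "\<dots> = of_real (Gamma \<sigma>) * (LINT z:{0<..}|lborel. exp ((- \<sigma>) * (2 * ln z)) *\<^sub>R \<phi> z)" by (rule set_integral_mult_right)
  also have "(LINT z:{0<..}|lborel. exp ((- \<sigma>) * (2 * ln z)) *\<^sub>R \<phi> z) = G 0 (- \<sigma>)"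
    unfolding set_lebesgue_integral_def G_def by (rule Bochner_Integration.integral_cong) (simp_all add: \<phi>_def indicator_def)
  finally show ?thesis .
qed

lemma sqrt_mult_powr: "t > 0 \<Longrightarrow> sqrt t * t powr r = t powr (r + 1/2)"
  by (simp add: powr_add powr_half_sqrt)

lemma powr_divide_sqrt: "t > 0 \<Longrightarrow> t powr r / sqrt t = t powr (r - 1/2)"
  by (simp add: powr_diff powr_half_sqrt)

lemma admissible_powr:
  assumes "\<bar>s\<bar> < 1/2" shows "admissible_weight (\<lambda>t. t powr (- s - 1))"
proof -
  have "set_integrable lborel {0<..1} (\<lambda>t. t powr (- s - 1 + 1/2))" "set_integrable lborel {1..} (\<lambda>t. t powr (- s - 1 - 1/2))"
    using assms by (auto intro!: set_integrable_powr_0_1 set_integrable_powr_1_inf)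
  moreover have "set_integrable lborel {0<..1} (\<lambda>t. sqrt t * \<bar>t powr (- s - 1)\<bar>) \<longleftrightarrow> set_integrable lborel {0<..1} (\<lambda>t. t powr (- s - 1 + 1/2))"
  proof (rule set_integrable_cong)
    fix t :: real assume "t \<in> {0<..1}"
    hence "t > 0" by simp
    thus "sqrt t * \<bar>t powr (- s - 1)\<bar> = t powr (- s - 1 + 1/2)" by (simp only: sqrt_mult_powr abs_of_nonneg powr_ge_zero)
  qed simp_all
  moreover have "set_integrable lborel {1..} (\<lambda>t. \<bar>t powr (- s - 1)\<bar> / sqrt t) \<longleftrightarrow> set_integrable lborel {1..} (\<lambda>t. t powr (- s - 1 - 1/2))"
  proof (rule set_integrable_cong)
    fix t :: real assume "t \<in> {1..}"
    hence "t > 0" by simp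
    thus "\<bar>t powr (- s - 1)\<bar> / sqrt t = t powr (- s - 1 - 1/2)" by (simp only: powr_divide_sqrt abs_of_nonneg powr_ge_zero)
  qed simp_all
  ultimately show ?thesis unfolding admissible_weight_def by simp
qed

lemma admissible_ln: "admissible_weight (\<lambda>t. ln t ^ j / t)"
proof -
  have ln: "\<bar>ln t ^ j / t\<bar> = \<bar>ln t\<bar> ^ j * t powr (-1)" if "t > 0" for t :: real
    using that by (simp add: abs_divide power_abs powr_minus_divide)
  have 1: "set_integrable lborel {0<..1} (\<lambda>t::real. \<bar>ln t\<bar> ^ j * t powr (- 1 + 1/2))"
    by (rule set_integrable_log_powr[where \<epsilon> = "1/2"]) (auto intro!: set_integrable_powr_0_1)
  have 2: "set_integrable lborel {1..} (\<lambda>t::real. \<bar>ln t\<bar> ^ j * t powr (- 1 - 1/2))"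
    by (rule set_integrable_log_powr[where \<epsilon> = "1/2"]) (auto intro!: set_integrable_powr_1_inf)
  have "set_integrable lborel {0<..1} (\<lambda>t. sqrt t * \<bar>ln t ^ j / t\<bar>) \<longleftrightarrow> set_integrable lborel {0<..1} (\<lambda>t::real. \<bar>ln t\<bar> ^ j * t powr (- 1 + 1/2))"
  proof (rule set_integrable_cong)
    fix t :: real assume "t \<in> {0<..1}"
    hence t: "t > 0" by simp
    show "sqrt t * \<bar>ln t ^ j / t\<bar> = \<bar>ln t\<bar> ^ j * t powr (- 1 + 1/2)"
      unfolding ln[OF t] sqrt_mult_powr[OF t, symmetric] by (rule mult.left_commute)
  qed simp_all
  moreover have "set_integrable lborel {1..} (\<lambda>t. \<bar>ln t ^ j / t\<bar> / sqrt t) \<longleftrightarrow> set_integrable lborel {1..} (\<lambda>t::real. \<bar>ln t\<bar> ^ j * t powr (- 1 - 1/2))"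
  proof (rule set_integrable_cong)
    fix t :: real assume "t \<in> {1..}"
    hence t: "t > 0" by simp
    show "\<bar>ln t ^ j / t\<bar> / sqrt t = \<bar>ln t\<bar> ^ j * t powr (- 1 - 1/2)"
      unfolding ln[OF t] powr_divide_sqrt[OF t, symmetric] by (rule times_divide_eq_right[symmetric])
  qed simp_all
  ultimately show ?thesis using 1 2 unfolding admissible_weight_def by simp
qed

definition \<psi> :: "real \<Rightarrow> complex" where
  "\<psi> t = indicator {0<..} t *\<^sub>R (defect t * of_real (1 / t))"

lemma \<psi>_weight: "exp (s * (- ln t)) *\<^sub>R \<psi> t = indicator {0<..} t *\<^sub>R (defect t * of_real (t powr (- s - 1)))"
proof (cases "t > 0")
  case True
  hence "exp (s * (- ln t)) * (1 / t) = t powr (- s - 1)" by (simp add: powr_diff) (simp add: powr_def)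
  hence e: "complex_of_real (exp (s * (- ln t))) * of_real (1 / t) = of_real (t powr (- s - 1))"
    by (simp only: of_real_mult[symmetric])
  have "exp (s * (- ln t)) *\<^sub>R \<psi> t = defect t * (complex_of_real (exp (s * (- ln t))) * of_real (1 / t))"
    using True by (simp add: \<psi>_def scaleR_conv_of_real)
  thus ?thesis unfolding e using True by simp
qed (simp add: \<psi>_def)

lemma integrable_\<psi>: "\<bar>s\<bar> < 1/2 \<Longrightarrow> integrable lborel (\<lambda>t. exp (s * (- ln t)) *\<^sub>R \<psi> t)"
  using weighted_defect(1)[OF admissible_powr] unfolding set_integrable_def \<psi>_weight .

lemma \<psi>_measurable [measurable]: "\<psi> \<in> borel_measurable borel"
  using borel_measurable_integrable[OF integrable_\<psi>[of 0]] by simp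

text \<open>The \<open>n\<close>-th derivative of the Mellin transform of the defect, \<open>s \<mapsto> \<integral> defect t * t powr (- s - 1) dt\<close>.\<close>
definition H :: "nat \<Rightarrow> real \<Rightarrow> complex" where
  "H n s = (\<integral>t. ((- ln t) ^ n * exp (s * (- ln t))) *\<^sub>R \<psi> t \<partial>lborel)"

lemma H_deriv: "\<bar>s\<bar> < 1/2 \<Longrightarrow> (H n has_vector_derivative H (Suc n) s) (at s)"
  unfolding H_def[abs_def]
  by (rule has_vector_derivative_exp_family[where \<epsilon> = "1/2" and L = "\<lambda>t. - ln t", OF _ _ integrable_\<psi>]) simp_all

lemma H_at_0: "H j 0 = (-1) ^ j * (LINT t:{0<..}|lborel. defect t * of_real (ln t ^ j / t))"
proof -
  have "((- ln t) ^ j * exp (0 * (- ln t))) *\<^sub>R \<psi> t = (-1) ^ j * (indicator {0<..} t *\<^sub>R (defect t * of_real (ln t ^ j / t)))" for t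
    by (simp add: \<psi>_def power_minus[of "ln t"] scaleR_conv_of_real indicator_def)
  thus ?thesis unfolding H_def set_lebesgue_integral_def by (simp only: integral_mult_right_zero)
qed

text \<open>For \<open>\<sigma> = - s > 0\<close>, replacing the heat flow by the defect subtracts \<open>f x / \<sigma>\<close> from its Mellin
transform. Dividing by \<open>Gamma \<sigma> = Gamma (1 - s) / \<sigma>\<close> gives the equation. The Mellin transform of
the heat flow requires \<open>s < 0\<close>, but both sides are smooth for \<open>\<bar>s\<bar> < 1/2\<close>.\<close>
lemma functional_equation:
  assumes s: "- (1/2) < s" "s < 0"
  shows "G 0 s = f x * of_real (rGamma_deriv 0 s) - of_real s * (of_real (rGamma_deriv 0 s) * H 0 s)"
proof -
  define \<sigma> where "\<sigma> = - s"
  have \<sigma>: "0 < \<sigma>" "\<sigma> < 1/2" using s by (auto simp: \<sigma>_def)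
  have one: "set_integrable lborel {0<..<1} (\<lambda>t. t powr (\<sigma> - 1))" "(LINT t:{0<..<1}|lborel. t powr (\<sigma> - 1)) = 1 / \<sigma>"
  proof -
    show i: "set_integrable lborel {0<..<1} (\<lambda>t. t powr (\<sigma> - 1))"
      using \<sigma> by (intro set_integrable_subset[OF set_integrable_powr_0_1[of "\<sigma> - 1"]]) auto
    have "((\<lambda>t. t powr (\<sigma> - 1)) has_integral 1 / \<sigma>) {0..1}" using has_integral_powr_from_0[of "\<sigma> - 1" 1] \<sigma> by simp
    hence "((\<lambda>t. t powr (\<sigma> - 1)) has_integral 1 / \<sigma>) {0<..<1}" by (simp add: has_integral_Icc_iff_Ioo)
    thus "(LINT t:{0<..<1}|lborel. t powr (\<sigma> - 1)) = 1 / \<sigma>" using set_borel_integral_eq_integral(2)[OF i] by (simp add: integral_unique)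
  qed
  have d: "integrable lborel (\<lambda>t. indicator {0<..} t *\<^sub>R (defect t * of_real (t powr (\<sigma> - 1))))"
    using integrable_\<psi>[of s] s unfolding \<psi>_weight by (simp add: \<sigma>_def)
  have H0: "H 0 s = (\<integral>t. indicator {0<..} t *\<^sub>R (defect t * of_real (t powr (\<sigma> - 1))) \<partial>lborel)"
    unfolding H_def power_0 mult_1 \<psi>_weight \<sigma>_def ..
  have o: "integrable lborel (\<lambda>t. f x * of_real (indicator {0<..<1} t *\<^sub>R t powr (\<sigma> - 1)))"
    using one(1) unfolding set_integrable_def by (intro integrable_mult_right integrable_of_real)
  have "(LINT t:{0<..}|lborel. heat_flow t * of_real (t powr (\<sigma> - 1))) =
     (\<integral>t. indicator {0<..} t *\<^sub>R (defect t * of_real (t powr (\<sigma> - 1))) + f x * of_real (indicator {0<..<1} t *\<^sub>R t powr (\<sigma> - 1)) \<partial>lborel)"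
    unfolding set_lebesgue_integral_def
    by (rule Bochner_Integration.integral_cong) (auto simp: defect_def indicator_def algebra_simps)
  also have "\<dots> = H 0 s + f x * of_real (1 / \<sigma>)"
    unfolding Bochner_Integration.integral_add[OF d o] H0 using one(2) unfolding set_lebesgue_integral_def
    by (simp only: integral_mult_right_zero integral_complex_of_real)
  finally have "of_real (Gamma \<sigma>) * G 0 s = H 0 s + f x * of_real (1 / \<sigma>)"
    using Mellin_heat_flow[OF \<sigma>] by (simp add: \<sigma>_def)
  moreover have "rGamma_deriv 0 s = 1 / (\<sigma> * Gamma \<sigma>)"
  proof -
    have "\<sigma> \<notin> \<int>\<^sub>\<le>\<^sub>0" using nonpos_Ints_nonpos[of \<sigma>] \<sigma> by force
    hence "Gamma (1 - s) = \<sigma> * Gamma \<sigma>" using Gamma_plus1[of \<sigma>] by (simp add: \<sigma>_def add_ac)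
    moreover have "1 / Gamma (1 - s) = rGamma_deriv 0 s" using fun_cong[OF deriv_inverse_Gamma_eq[of 0], of s] by simp
    ultimately show ?thesis by simp
  qed
  moreover have "Gamma \<sigma> \<noteq> 0" using Gamma_real_pos[OF \<sigma>(1)] by linarith
  ultimately have "G 0 s = (H 0 s + f x * of_real (1 / \<sigma>)) / of_real (Gamma \<sigma>)" "s = - \<sigma>" 
    by (auto simp: \<sigma>_def field_simps)
  thus ?thesis using \<sigma> \<open>Gamma \<sigma> \<noteq> 0\<close> unfolding \<open>rGamma_deriv 0 s = 1 / (\<sigma> * Gamma \<sigma>)\<close>
    by (simp add: field_simps)
qed

definition R :: "nat \<Rightarrow> real \<Rightarrow> complex" where
  "R n s = of_real (rGamma_deriv n s)"

lemma R_deriv: "(R n has_vector_derivative R (Suc n) s) (at s)"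
  unfolding R_def[abs_def]
  using bounded_linear.has_vector_derivative[OF bounded_linear_of_real] has_real_derivative_rGamma_deriv
  by (fastforce simp: has_real_derivative_iff_has_vector_derivative)

abbreviation "P \<equiv> leibniz_sum R H"

text \<open>The \<open>n\<close>-th derivative of the right-hand side of \<open>functional_equation\<close>. For \<open>n = 0\<close> the term with
\<open>n - 1\<close> has the factor 0.\<close>
definition rhs :: "nat \<Rightarrow> real \<Rightarrow> complex" where
  "rhs n s = f x * R n s - (of_real s * P n s + of_nat n * P (n - 1) s)"

lemma rhs_deriv:
  assumes s: "\<bar>s\<bar> < 1/2" shows "(rhs n has_vector_derivative rhs (Suc n) s) (at s)"
proof -
  have P: "(P k has_vector_derivative P (Suc k) s) (at s)" for k
    by (intro has_vector_derivative_leibniz_sum R_deriv H_deriv s)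
  have id: "((\<lambda>s. complex_of_real s) has_vector_derivative 1) (at s)"
    using bounded_linear.has_vector_derivative[OF bounded_linear_of_real has_vector_derivative_id, of "at s"] by simp
  have last: "((\<lambda>s. of_nat n * P (n - 1) s) has_vector_derivative of_nat n * P n s) (at s)"
    using has_vector_derivative_mult_right[OF P[of "n - 1"], of "of_nat n"] by (cases n) auto
  have "(rhs n has_vector_derivative (f x * R (Suc n) s - ((of_real s * P (Suc n) s + 1 * P n s) + of_nat n * P n s))) (at s)"
    unfolding rhs_def[abs_def]
    by (intro has_vector_derivative_diff has_vector_derivative_add has_vector_derivative_mult_right R_deriv last
        has_vector_derivative_mult id P)
  thus ?thesis by (simp add: rhs_def algebra_simps)
qed

lemma G_eq_rhs_left: "- (1/2) < s \<Longrightarrow> s < 0 \<Longrightarrow> G n s = rhs n s"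
proof (induction n arbitrary: s)
  case 0
  thus ?case using functional_equation[of s] by (simp add: rhs_def R_def leibniz_sum_def)
next
  case (Suc n)
  have s: "\<bar>s\<bar> < 1/2" using Suc.prems by auto
  have "(G n has_vector_derivative rhs (Suc n) s) (at s)"
    by (rule has_vector_derivative_transform_within_open[OF rhs_deriv[OF s], of "{- (1/2)<..<0}"])
       (use Suc in auto)
  with G_deriv[OF s] show ?case by (rule vector_derivative_unique_at)
qed

text \<open>All derivatives agree to the left of 0 and are continuous at 0.\<close>
lemma G_eq_rhs_0: "G n 0 = rhs n 0"
proof -
  have "isCont (G n) 0" "isCont (rhs n) 0"
    using has_vector_derivative_continuous[OF G_deriv[of 0 n]] has_vector_derivative_continuous[OF rhs_deriv[of 0 n]] by auto
  hence "(G n \<longlongrightarrow> G n 0) (at_left 0)" "(rhs n \<longlongrightarrow> rhs n 0) (at_left 0)"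
    by (auto simp: isCont_def intro: filterlim_mono[OF _ order_refl at_le])
  moreover have "\<forall>\<^sub>F s in at_left 0. G n s = rhs n s"
    using eventually_at_left_real[of "- (1/2)" 0] by (auto elim!: eventually_mono intro: G_eq_rhs_left)
  ultimately show ?thesis
    using tendsto_cong[of "G n" "rhs n" "at_left 0"] tendsto_unique[OF trivial_limit_at_left_real] by metis
qed

lemma has_nth_vderiv_pow: "has_nth_vderiv m (\<lambda>s. bessel_pow \<nu> s f x) 0 (bessel_log \<nu> m f x)"
proof -
  have "has_nth_vderiv m (G 0) 0 (G (m + 0) 0)" by (rule has_nth_vderiv_chain[where \<epsilon> = "1/2"]) (auto intro: G_deriv)
  moreover have "\<forall>\<^sub>F u in nhds 0. G 0 u = bessel_pow \<nu> u f x"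
    using eventually_nhds_in_open[of "{- (1/2)<..<1/2}" "0::real"] by (auto elim!: eventually_mono simp: bessel_pow_eq' abs_less_iff)
  ultimately have "has_nth_vderiv m (\<lambda>s. bessel_pow \<nu> s f x) 0 (G (m + 0) 0)" by (rule has_nth_vderiv_cong[rotated])
  thus ?thesis by (simp add: bessel_log_eq)
qed

lemma has_nth_vderiv_neg_pow: "has_nth_vderiv m (\<lambda>s. bessel_pow \<nu> (- s) f x) 0 ((-1) ^ m * bessel_log \<nu> m f x)"
proof -
  define N where "N n s = (-1) ^ n * G n (- s)" for n s
  have N: "(N n has_vector_derivative N (Suc n) s) (at s)" if "\<bar>s\<bar> < 1/2" for n s
  proof -
    have "((\<lambda>s. - s) has_vector_derivative - 1) (at s)" by (auto intro!: derivative_eq_intros)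
    from vector_diff_chain_at[OF this, of "G n" "G (Suc n) (- s)"] G_deriv[of "- s" n] that
    have "((\<lambda>s. G n (- s)) has_vector_derivative - G (Suc n) (- s)) (at s)" by (simp add: o_def)
    from has_vector_derivative_mult_right[OF this, of "(-1) ^ n"] show ?thesis by (simp add: N_def[abs_def])
  qed
  have "has_nth_vderiv m (N 0) 0 (N (m + 0) 0)" by (rule has_nth_vderiv_chain[where \<epsilon> = "1/2"]) (auto intro: N)
  moreover have "\<forall>\<^sub>F u in nhds 0. N 0 u = bessel_pow \<nu> (- u) f x"
    using eventually_nhds_in_open[of "{- (1/2)<..<1/2}" "0::real"] by (auto elim!: eventually_mono simp: N_def bessel_pow_eq' abs_less_iff)
  ultimately have "has_nth_vderiv m (\<lambda>s. bessel_pow \<nu> (- s) f x) 0 (N (m + 0) 0)" by (rule has_nth_vderiv_cong[rotated])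
  thus ?thesis by (simp add: bessel_log_eq N_def)
qed

end

section \<open>The formula for the logarithm\<close>

theorem theorem1p2:
  fixes \<nu> :: real and f :: "real \<Rightarrow> complex" and m :: nat
  assumes "\<nu> > - (1 / 2)" and "f \<in> Cc_smooth" and "m \<ge> 1"
  shows "f \<in> bessel_log_dom \<nu> m \<and>
    (AE x in lborel. x > 0 \<longrightarrow>
      bessel_log \<nu> m f x =
        - of_nat m * (\<Sum>j = 0..m - 1.
            (-1) ^ j * of_nat ((m - 1) choose j)
            * of_real ((deriv ^^ (m - j - 1)) (\<lambda>s::real. 1 / Gamma (1 - s)) 0)
            * ((LINT y:{0<..}|lborel. (f y - indicator (pos_ball x 1) y * f x)
                   * of_real (LINT t:{0<..}|lborel. bessel_heat \<nu> t x y * (ln t ^ j / t)))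
               + f x * of_real
                  (- (LINT y:{0<..} - pos_ball x 1|lborel.
                        LINT t:{0<..<1}|lborel. bessel_heat \<nu> t x y * (ln t ^ j / t))
                   + (LINT y:pos_ball x 1|lborel.
                        LINT t:{1<..}|lborel. bessel_heat \<nu> t x y * (ln t ^ j / t))
                   + (LINT y:{0<..}|lborel.
                        LINT t:{0<..<1}|lborel.
                          (bessel_heat \<nu> t x y - euclid_heat t (x - y)) * (ln t ^ j / t))
                   - euclid_tail j x)))
        + f x * of_real ((deriv ^^ m) (\<lambda>s::real. 1 / Gamma (1 - s)) 0))
  \<and> (\<forall>x>0. \<forall>j\<in>{0..m - 1}.
      set_integrable (lborel \<Otimes>\<^sub>M lborel) ({0<..} \<times> {0<..})
        (\<lambda>(y, t). (f y - indicator (pos_ball x 1) y * f x)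
                   * of_real (bessel_heat \<nu> t x y * (ln t ^ j / t)))
      \<and> set_integrable (lborel \<Otimes>\<^sub>M lborel) (({0<..} - pos_ball x 1) \<times> {0<..<1})
          (\<lambda>(y, t). bessel_heat \<nu> t x y * (ln t ^ j / t))
      \<and> set_integrable (lborel \<Otimes>\<^sub>M lborel) (pos_ball x 1 \<times> {1<..})
          (\<lambda>(y, t). bessel_heat \<nu> t x y * (ln t ^ j / t))
      \<and> set_integrable (lborel \<Otimes>\<^sub>M lborel) ({0<..} \<times> {0<..<1})
          (\<lambda>(y, t). (bessel_heat \<nu> t x y - euclid_heat t (x - y)) * (ln t ^ j / t))
      \<and> set_integrable (lborel \<Otimes>\<^sub>M lborel) ({..<0} \<times> {0<..<1})
          (\<lambda>(y, t). euclid_heat t (x - y) * (ln t ^ j / t)))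
  \<and> (\<forall>\<^sub>F s in at 0. f \<in> bessel_pow_dom \<nu> s)
  \<and> (AE x in lborel. x > 0 \<longrightarrow>
      has_nth_vderiv m (\<lambda>s. bessel_pow \<nu> s f x) 0 (bessel_log \<nu> m f x) \<and>
      (\<exists>d. has_nth_vderiv m (\<lambda>s. bessel_pow \<nu> (- s) f x) 0 d \<and>
           bessel_log \<nu> m f x = (-1) ^ m * d))"
proof -
  from Cc_smooth_test_function[OF assms(2)] obtain D a b where "test_function f D a b" .
  then interpret test_function f D a b .
  have at_point: "\<exists>L c. log_formula f D a b \<nu> x L c" if x: "x > 0" for x
    using heat_kernel_splitting_exists[OF assms(1) x] test_function_axioms by (metis log_formula.intro)
  show ?thesis
  proof (intro conjI, goal_cases)
    case 1
    show ?case using f_in_L2 hankel_in_L2(2)[OF assms(1)] by (simp add: bessel_log_dom_def)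
  next
    case 2
    show ?case
    proof (intro AE_I2 impI, goal_cases)
      case (1 x)
      obtain L c where "log_formula f D a b \<nu> x L c" using at_point[OF 1(2)] by blast
      then interpret log_formula f D a b \<nu> x L c .
      define r where "r k = (deriv ^^ k) (\<lambda>s::real. 1 / Gamma (1 - s)) 0" for k
      have r: "rGamma_deriv k 0 = r k" for k by (simp add: r_def deriv_inverse_Gamma_eq)
      \<comment> \<open>at \<open>s = 0\<close> the factor \<open>s\<close> of the functional equation leaves \<open>m\<close> times a derivative of order \<open>m - 1\<close>\<close>
      have "bessel_log \<nu> m f x = f x * of_real (r m) - of_nat m * P (m - 1) 0"
        unfolding bessel_log_eq G_eq_rhs_0 by (simp add: rhs_def R_def r)
      also have "P (m - 1) 0 = (\<Sum>j = 0..m - 1. (-1) ^ j * of_nat ((m - 1) choose j) * of_real (r (m - j - 1))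
          * (LINT t:{0<..}|lborel. defect t * of_real (ln t ^ j / t)))"
        unfolding leibniz_sum_def atLeast0AtMost[symmetric]
        by (intro sum.cong refl) (simp add: R_def r H_at_0 diff_right_commute mult_ac)
      finally show ?case
        unfolding r_def[symmetric] weighted_defect(2)[OF admissible_ln] jump_def euclid_tail_def by simp
    qed
  next
    case 3
    show ?case
    proof (intro allI impI ballI, goal_cases)
      case (1 x j)
      obtain L c where "log_formula f D a b \<nu> x L c" using at_point[OF 1(1)] by blast
      then interpret log_formula f D a b \<nu> x L c .
      note w = admissible_ln[of j]
      show ?case
        using integrable_jump[OF w] integrable_far[OF w] integrable_near_late[OF w] integrable_difference[OF w]
          integrable_negative[OF w]
        unfolding jump_def by (intro conjI)
    qed
  next
    case 4
    show ?case using f_in_L2 hankel_in_L2(1)[OF assms(1)]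
      by (auto simp: bessel_pow_dom_def eventually_at dist_norm intro!: exI[of _ "1/4"])
  next
    case 5
    show ?case
    proof (intro AE_I2 impI, goal_cases)
      case (1 x)
      obtain L c where "log_formula f D a b \<nu> x L c" using at_point[OF 1(2)] by blast
      then interpret log_formula f D a b \<nu> x L c .
      show ?case
        using has_nth_vderiv_pow has_nth_vderiv_neg_pow
        by (intro conjI exI[of _ "(-1) ^ m * bessel_log \<nu> m f x"])
           (auto simp: mult.assoc[symmetric] power_mult_distrib[symmetric])
    qed
  qed
qed

end
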